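(* Let $\Lambda$ be a finite-dimensional Nakayama algebra over a field $K$, and let $\mathcal{G}_1$ and $\mathcal{G}_2$ be maximal green sequences of $\Lambda$ having the same set of bricks (up to isomorphism). Then $\mathcal{G}_1$ and $\mathcal{G}_2$ are equivalent, i.e. related by a finite sequence of deformations across squares.
   Context: A Nakayama algebra is a finite-dimensional algebra for which every finite-dimensional indecomposable module is uniserial (has a unique composition series). $\operatorname{mod}\Lambda$ is the category of finitely generated right $\Lambda$-modules. A torsion class is a full subcategory of $\operatorname{mod}\Lambda$ closed under factor modules and extensions; covering relations in the inclusion order are called minimal inclusions. A maximal green sequence of $\Lambda$ is a finite chain of minimal inclusions of torsion classes $\operatorname{mod}\Lambda=\mathcal{T}_0\supset\dots\supset\mathcal{T}_r=\{0\}$. A brick is a module whose endomorphism ring is a division ring. $\operatorname{Filt}(B)$ is the full subcategory of modules with a finite filtration with factors in $\operatorname{add}B$. For each minimal inclusion $\mathcal{T}_{i-1}\supset\mathcal{T}_i$ there is a brick $B_i$, unique up to isomorphism, with $\mathcal{T}_{i-1}\cap\{M\mid\operatorname{Hom}_\Lambda(\mathcal{T}_i,M)=0\}=\operatorname{Filt}(B_i)$. The set of bricks of the maximal green sequence is $\{B_1,\dots,B_r\}$. Sending a maximal green sequence to $B_1,\dots,B_r$ gives a bijection with maximal backwards $\operatorname{Hom}$-orthogonal sequences of bricks: sequences of bricks with $\operatorname{Hom}_\Lambda(B_j,B_i)=0$ for $i<j$ into which no further brick can be inserted preserving this property. Two maximal green sequences are related by deformation across a square if, as chains of torsion classes, they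 differ in exactly one term, i.e. one contains $\mathcal{T}_{i-1}\supset\mathcal{T}_i\supset\mathcal{T}_{i+1}$ and the other contains instead $\mathcal{T}_{i-1}\supset\mathcal{T}'_i\supset\mathcal{T}_{i+1}$ with $\mathcal{T}'_i\ne\mathcal{T}_i$, all other terms being equal; in terms of brick sequences, this means that two adjacent bricks $B_i,B_{i+1}$ are swapped. Equivalence of maximal green sequences is the equivalence relation generated by deformations across squares. *)

theory Defs
  imports "HOL-Algebra.Module" "HOL-Algebra.AbelCoset"
begin

section \<open>Finite-dimensional algebras and their right modules\<close>

text \<open>
  The library locale \<open>algebra\<close> is about commutative algebras only. The zero algebra is not
  excluded. Finite dimension: some finite set lies in no proper \<open>K\<close>-subspace.
\<close>

locale finite_dimensional_algebra =
  K: field K + module K \<Lambda> + \<Lambda>: ring \<Lambda>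
    for K :: "('k, 'c) ring_scheme" and \<Lambda> :: "('k, 'a) module" +
  assumes smult_mult_left:
      "\<lbrakk>c \<in> carrier K; a \<in> carrier \<Lambda>; b \<in> carrier \<Lambda>\<rbrakk> \<Longrightarrow>
        (c \<odot>\<^bsub>\<Lambda>\<^esub> a) \<otimes>\<^bsub>\<Lambda>\<^esub> b = c \<odot>\<^bsub>\<Lambda>\<^esub> (a \<otimes>\<^bsub>\<Lambda>\<^esub> b)"
    and smult_mult_right:
      "\<lbrakk>c \<in> carrier K; a \<in> carrier \<Lambda>; b \<in> carrier \<Lambda>\<rbrakk> \<Longrightarrow>
        a \<otimes>\<^bsub>\<Lambda>\<^esub> (c \<odot>\<^bsub>\<Lambda>\<^esub> b) = c \<odot>\<^bsub>\<Lambda>\<^esub> (a \<otimes>\<^bsub>\<Lambda>\<^esub> b)"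
    and finite_dimensional:
      "\<exists>S. finite S \<and> S \<subseteq> carrier \<Lambda> \<and>
        (\<forall>H. submodule H K \<Lambda> \<longrightarrow> S \<subseteq> H \<longrightarrow> H = carrier \<Lambda>)"

text \<open>
  Right modules reuse the library record \<open>module\<close>, with \<open>a \<odot>\<^bsub>M\<^esub> x\<close> read as \<open>x \<cdot> a\<close>: compare the
  order of the factors in \<open>smult_mult\<close>. The fields \<open>mult\<close> and \<open>one\<close> of the record play no role.
  The library predicate \<open>submodule\<close> does not depend on the side or on commutativity of the ring,
  so it describes submodules of right modules as well.
\<close>

locale right_module = \<Lambda>: ring \<Lambda> + M: abelian_group M
    for \<Lambda> :: "('a, 'c) ring_scheme" and M :: "('a, 'm) module" +
  assumes smult_closed:
      "\<lbrakk>a \<in> carrier \<Lambda>; x \<in> carrier M\<rbrakk> \<Longrightarrow> a \<odot>\<^bsub>M\<^esub> x \<in> carrier M"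
    and smult_add_ring:
      "\<lbrakk>a \<in> carrier \<Lambda>; b \<in> carrier \<Lambda>; x \<in> carrier M\<rbrakk> \<Longrightarrow>
        (a \<oplus>\<^bsub>\<Lambda>\<^esub> b) \<odot>\<^bsub>M\<^esub> x = (a \<odot>\<^bsub>M\<^esub> x) \<oplus>\<^bsub>M\<^esub> (b \<odot>\<^bsub>M\<^esub> x)"
    and smult_add_module:
      "\<lbrakk>a \<in> carrier \<Lambda>; x \<in> carrier M; y \<in> carrier M\<rbrakk> \<Longrightarrow>
        a \<odot>\<^bsub>M\<^esub> (x \<oplus>\<^bsub>M\<^esub> y) = (a \<odot>\<^bsub>M\<^esub> x) \<oplus>\<^bsub>M\<^esub> (a \<odot>\<^bsub>M\<^esub> y)"
    and smult_mult:
      "\<lbrakk>a \<in> carrier \<Lambda>; b \<in> carrier \<Lambda>; x \<in> carrier M\<rbrakk> \<Longrightarrow>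
        (a \<otimes>\<^bsub>\<Lambda>\<^esub> b) \<odot>\<^bsub>M\<^esub> x = b \<odot>\<^bsub>M\<^esub> (a \<odot>\<^bsub>M\<^esub> x)"
    and smult_one:
      "x \<in> carrier M \<Longrightarrow> \<one>\<^bsub>\<Lambda>\<^esub> \<odot>\<^bsub>M\<^esub> x = x"

definition finitely_generated ::
    "('a, 'c) ring_scheme \<Rightarrow> ('a, 'm) module \<Rightarrow> bool" where
  "finitely_generated \<Lambda> M \<longleftrightarrow>
    (\<exists>S. finite S \<and> S \<subseteq> carrier M \<and>
      (\<forall>H. submodule H \<Lambda> M \<longrightarrow> S \<subseteq> H \<longrightarrow> H = carrier M))"

text \<open>
  The objects of \<open>mod \<Lambda>\<close> have their elements in the fixed type \<open>nat \<Rightarrow> 'a\<close>. Every finitely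
  generated right module is a quotient of some \<open>\<Lambda>\<^sup>n\<close>, hence isomorphic to one whose carrier is
  a subset of this type, so nothing is lost up to isomorphism.
\<close>

type_synonym 'a rmod = "('a, nat \<Rightarrow> 'a) module"

definition fg_modules :: "('a, 'c) ring_scheme \<Rightarrow> 'a rmod set" where
  "fg_modules \<Lambda> = {M. right_module \<Lambda> M \<and> finitely_generated \<Lambda> M}"

definition zero_modules :: "('a, 'c) ring_scheme \<Rightarrow> 'a rmod set" where
  "zero_modules \<Lambda> = {M \<in> fg_modules \<Lambda>. carrier M = {\<zero>\<^bsub>M\<^esub>}}"

definition rmod_hom ::
    "('a, 'c) ring_scheme \<Rightarrow> ('a, 'm) module \<Rightarrow> ('a, 'n) module \<Rightarrow> ('m \<Rightarrow> 'n) set" where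
  "rmod_hom \<Lambda> M N =
    {f \<in> hom (add_monoid M) (add_monoid N).
      \<forall>a\<in>carrier \<Lambda>. \<forall>x\<in>carrier M. f (a \<odot>\<^bsub>M\<^esub> x) = a \<odot>\<^bsub>N\<^esub> f x}"

definition rmod_isomorphic ::
    "('a, 'c) ring_scheme \<Rightarrow> ('a, 'm) module \<Rightarrow> ('a, 'n) module \<Rightarrow> bool" where
  "rmod_isomorphic \<Lambda> M N \<longleftrightarrow>
    (\<exists>f\<in>rmod_hom \<Lambda> M N. bij_betw f (carrier M) (carrier N))"

definition short_exact ::
    "('a, 'c) ring_scheme \<Rightarrow> ('a, 'l) module \<Rightarrow> ('a, 'm) module \<Rightarrow> ('a, 'n) module \<Rightarrow>
      ('l \<Rightarrow> 'm) \<Rightarrow> ('m \<Rightarrow> 'n) \<Rightarrow> bool" where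
  "short_exact \<Lambda> L M N f g \<longleftrightarrow>
    f \<in> rmod_hom \<Lambda> L M \<and> g \<in> rmod_hom \<Lambda> M N \<and>
    inj_on f (carrier L) \<and> f ` carrier L = a_kernel M N g \<and> g ` carrier M = carrier N"


section \<open>Nakayama algebras\<close>

definition internal_direct_sum ::
    "('a, 'c) ring_scheme \<Rightarrow> ('a, 'm) module \<Rightarrow> 'm set \<Rightarrow> 'm set \<Rightarrow> bool" where
  "internal_direct_sum \<Lambda> M S T \<longleftrightarrow>
    submodule S \<Lambda> M \<and> submodule T \<Lambda> M \<and> S \<inter> T = {\<zero>\<^bsub>M\<^esub>} \<and> S <+>\<^bsub>M\<^esub> T = carrier M"

definition indecomposable :: "('a, 'c) ring_scheme \<Rightarrow> ('a, 'm) module \<Rightarrow> bool" where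
  "indecomposable \<Lambda> M \<longleftrightarrow>
    carrier M \<noteq> {\<zero>\<^bsub>M\<^esub>} \<and>
    (\<forall>S T. internal_direct_sum \<Lambda> M S T \<longrightarrow> S = {\<zero>\<^bsub>M\<^esub>} \<or> T = {\<zero>\<^bsub>M\<^esub>})"

text \<open>
  Composition series are listed from \<open>0\<close> up to \<open>M\<close>; simplicity of the factors says that no
  submodule lies strictly between two consecutive terms.
\<close>

definition composition_series ::
    "('a, 'c) ring_scheme \<Rightarrow> ('a, 'm) module \<Rightarrow> 'm set list \<Rightarrow> bool" where
  "composition_series \<Lambda> M Ns \<longleftrightarrow>
    Ns \<noteq> [] \<and> hd Ns = {\<zero>\<^bsub>M\<^esub>} \<and> last Ns = carrier M \<and>
    (\<forall>N\<in>set Ns. submodule N \<Lambda> M) \<and>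
    (\<forall>i. Suc i < length Ns \<longrightarrow>
      Ns ! i \<subset> Ns ! Suc i \<and>
      (\<nexists>H. submodule H \<Lambda> M \<and> Ns ! i \<subset> H \<and> H \<subset> Ns ! Suc i))"

definition uniserial :: "('a, 'c) ring_scheme \<Rightarrow> ('a, 'm) module \<Rightarrow> bool" where
  "uniserial \<Lambda> M \<longleftrightarrow> (\<exists>!Ns. composition_series \<Lambda> M Ns)"

text \<open>
  Over a finite-dimensional algebra the finite-dimensional modules are exactly the finitely
  generated ones.
\<close>

locale nakayama_algebra = finite_dimensional_algebra +
  assumes indecomposable_uniserial:
    "\<lbrakk>M \<in> fg_modules \<Lambda>; indecomposable \<Lambda> M\<rbrakk> \<Longrightarrow> uniserial \<Lambda> M"


section \<open>Bricks and filtrations\<close>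

text \<open>
  Endomorphisms are taken to be \<open>undefined\<close> outside the carrier, so that equality in the
  endomorphism ring is equality on the carrier.
\<close>

definition End_ring ::
    "('a, 'c) ring_scheme \<Rightarrow> ('a, 'm) module \<Rightarrow> ('m \<Rightarrow> 'm) ring" where
  "End_ring \<Lambda> M =
    \<lparr>carrier = rmod_hom \<Lambda> M M \<inter> extensional (carrier M),
     monoid.mult = (\<lambda>f g. compose (carrier M) f g),
     one = (\<lambda>x\<in>carrier M. x),
     ring.zero = (\<lambda>x\<in>carrier M. \<zero>\<^bsub>M\<^esub>),
     ring.add = (\<lambda>f g. \<lambda>x\<in>carrier M. f x \<oplus>\<^bsub>M\<^esub> g x)\<rparr>"

text \<open>Since \<open>\<one>\<close> is a unit, the second condition forces \<open>\<one> \<noteq> \<zero>\<close>.\<close>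

locale skew_field = ring +
  assumes skew_field_Units: "Units R = carrier R - {\<zero>}"

definition brick :: "('a, 'c) ring_scheme \<Rightarrow> ('a, 'm) module \<Rightarrow> bool" where
  "brick \<Lambda> B \<longleftrightarrow> skew_field (End_ring \<Lambda> B)"

text \<open>\<open>power_module M n\<close> is \<open>M\<^sup>n\<close>; the unused fields \<open>mult\<close> and \<open>one\<close> are arbitrary.\<close>

definition power_module :: "('a, 'm) module \<Rightarrow> nat \<Rightarrow> ('a, nat \<Rightarrow> 'm) module" where
  "power_module M n =
    \<lparr>carrier = (\<Pi>\<^sub>E i\<in>{..<n}. carrier M),
     monoid.mult = undefined,
     one = undefined,
     ring.zero = (\<lambda>i\<in>{..<n}. \<zero>\<^bsub>M\<^esub>),
     ring.add = (\<lambda>x y. \<lambda>i\<in>{..<n}. x i \<oplus>\<^bsub>M\<^esub> y i),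
     smult = (\<lambda>a x. \<lambda>i\<in>{..<n}. a \<odot>\<^bsub>M\<^esub> x i)\<rparr>"

definition add_closure :: "('a, 'c) ring_scheme \<Rightarrow> 'a rmod \<Rightarrow> 'a rmod set" where
  "add_closure \<Lambda> B =
    {X \<in> fg_modules \<Lambda>. \<exists>n S T. internal_direct_sum \<Lambda> (power_module B n) S T \<and>
      rmod_isomorphic \<Lambda> X ((power_module B n)\<lparr>carrier := S\<rparr>)}"

text \<open>
  That \<open>N' / N\<close> is isomorphic to \<open>X\<close> is expressed by a surjection \<open>N' \<rightarrow> X\<close> with kernel \<open>N\<close>.
\<close>

definition factor_isomorphic ::
    "('a, 'c) ring_scheme \<Rightarrow> ('a, 'm) module \<Rightarrow> 'm set \<Rightarrow> 'm set \<Rightarrow> ('a, 'n) module \<Rightarrow> bool" where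
  "factor_isomorphic \<Lambda> M N' N X \<longleftrightarrow>
    (\<exists>p\<in>rmod_hom \<Lambda> (M\<lparr>carrier := N'\<rparr>) X.
      p ` N' = carrier X \<and> a_kernel (M\<lparr>carrier := N'\<rparr>) X p = N)"

definition Filt :: "('a, 'c) ring_scheme \<Rightarrow> 'a rmod \<Rightarrow> 'a rmod set" where
  "Filt \<Lambda> B =
    {M \<in> fg_modules \<Lambda>. \<exists>Ns. Ns \<noteq> [] \<and> hd Ns = {\<zero>\<^bsub>M\<^esub>} \<and> last Ns = carrier M \<and>
      (\<forall>N\<in>set Ns. submodule N \<Lambda> M) \<and>
      (\<forall>i. Suc i < length Ns \<longrightarrow>
        Ns ! i \<subseteq> Ns ! Suc i \<and>
        (\<exists>X\<in>add_closure \<Lambda> B. factor_isomorphic \<Lambda> M (Ns ! Suc i) (Ns ! i) X))}"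


section \<open>Torsion classes and maximal green sequences\<close>

text \<open>
  A full subcategory is given by its set of objects. Closure under factor modules includes closure
  under isomorphism, so equality of torsion classes is equality of these sets. The zero modules are
  required to belong to a torsion class; this only excludes the empty subcategory.
\<close>

definition torsion_class :: "('a, 'c) ring_scheme \<Rightarrow> 'a rmod set \<Rightarrow> bool" where
  "torsion_class \<Lambda> \<T> \<longleftrightarrow>
    zero_modules \<Lambda> \<subseteq> \<T> \<and> \<T> \<subseteq> fg_modules \<Lambda> \<and>
    (\<forall>M\<in>\<T>. \<forall>N\<in>fg_modules \<Lambda>. \<forall>g\<in>rmod_hom \<Lambda> M N.
      g ` carrier M = carrier N \<longrightarrow> N \<in> \<T>) \<and>
    (\<forall>L\<in>\<T>. \<forall>N\<in>\<T>. \<forall>M\<in>fg_modules \<Lambda>. \<forall>f g.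
      short_exact \<Lambda> L M N f g \<longrightarrow> M \<in> \<T>)"

definition minimal_inclusion ::
    "('a, 'c) ring_scheme \<Rightarrow> 'a rmod set \<Rightarrow> 'a rmod set \<Rightarrow> bool" where
  "minimal_inclusion \<Lambda> \<T> \<T>' \<longleftrightarrow>
    torsion_class \<Lambda> \<T> \<and> torsion_class \<Lambda> \<T>' \<and> \<T>' \<subset> \<T> \<and>
    (\<nexists>\<U>. torsion_class \<Lambda> \<U> \<and> \<T>' \<subset> \<U> \<and> \<U> \<subset> \<T>)"

definition maximal_green_sequence ::
    "('a, 'c) ring_scheme \<Rightarrow> 'a rmod set list \<Rightarrow> bool" where
  "maximal_green_sequence \<Lambda> \<G> \<longleftrightarrow>
    \<G> \<noteq> [] \<and> hd \<G> = fg_modules \<Lambda> \<and> last \<G> = zero_modules \<Lambda> \<and>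
    (\<forall>\<T>\<in>set \<G>. torsion_class \<Lambda> \<T>) \<and>
    (\<forall>i. Suc i < length \<G> \<longrightarrow> minimal_inclusion \<Lambda> (\<G> ! i) (\<G> ! Suc i))"

definition hom_orthogonal ::
    "('a, 'c) ring_scheme \<Rightarrow> 'a rmod set \<Rightarrow> 'a rmod set" where
  "hom_orthogonal \<Lambda> \<T> =
    {M \<in> fg_modules \<Lambda>. \<forall>T\<in>\<T>. \<forall>f\<in>rmod_hom \<Lambda> T M. \<forall>x\<in>carrier T. f x = \<zero>\<^bsub>M\<^esub>}"

definition brick_label ::
    "('a, 'c) ring_scheme \<Rightarrow> 'a rmod set \<Rightarrow> 'a rmod set \<Rightarrow> 'a rmod \<Rightarrow> bool" where
  "brick_label \<Lambda> \<T> \<T>' B \<longleftrightarrow>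
    B \<in> fg_modules \<Lambda> \<and> brick \<Lambda> B \<and> \<T> \<inter> hom_orthogonal \<Lambda> \<T>' = Filt \<Lambda> B"

text \<open>
  A brick label is unique only up to isomorphism. This set contains all labels, so it is closed
  under isomorphism, and two maximal green sequences have the same set of bricks up to isomorphism
  iff these sets are equal.
\<close>

definition bricks_of ::
    "('a, 'c) ring_scheme \<Rightarrow> 'a rmod set list \<Rightarrow> 'a rmod set" where
  "bricks_of \<Lambda> \<G> =
    {B. \<exists>i. Suc i < length \<G> \<and> brick_label \<Lambda> (\<G> ! i) (\<G> ! Suc i) B}"

definition square_deformation ::
    "('a, 'c) ring_scheme \<Rightarrow> 'a rmod set list \<Rightarrow> 'a rmod set list \<Rightarrow> bool" where
  "square_deformation \<Lambda> \<G> \<G>' \<longleftrightarrow>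
    maximal_green_sequence \<Lambda> \<G> \<and> maximal_green_sequence \<Lambda> \<G>' \<and>
    (\<exists>i \<T>'. 0 < i \<and> Suc i < length \<G> \<and> \<T>' \<noteq> \<G> ! i \<and> \<G>' = \<G>[i := \<T>'])"

definition mgs_equivalent ::
    "('a, 'c) ring_scheme \<Rightarrow> 'a rmod set list \<Rightarrow> 'a rmod set list \<Rightarrow> bool" where
  "mgs_equivalent \<Lambda> = equivclp (square_deformation \<Lambda>)"

end

theory Submission
  imports Defs
begin

text \<open>
  For torsion classes \<open>\<T>' \<subset> \<T>\<close> put \<open>W = \<T> \<inter> \<T>'\<^sup>\<bottom>\<close>. The inclusion is minimal iff \<open>Hom(X, Y) \<noteq> 0\<close> for all
  nonzero \<open>X, Y \<in> W\<close>, and then \<open>W = Filt(B)\<close> for \<open>B \<in> W\<close> nonzero of minimal length. So a maximal green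
  sequence may be handled through its classes \<open>W\<^sub>i\<close>, listed in the order of the steps, which determine
  it; moreover \<open>Hom(W\<^sub>a, W\<^sub>b) \<noteq> 0\<close> forces \<open>a \<le> b\<close>.

  Let two sequences have the same classes, and let \<open>W\<^sub>i, W\<^sub>i\<^sub>+\<^sub>1\<close> be adjacent in the first and in the
  opposite order in the second. Take \<open>E \<in> \<T>\<^sub>i \<inter> \<T>\<^sub>i\<^sub>+\<^sub>2\<^sup>\<bottom>\<close> indecomposable, hence uniserial, and suppose that its
  \<open>\<T>\<^sub>i\<^sub>+\<^sub>1\<close>-torsion part \<open>Y\<close> is neither \<open>0\<close> nor \<open>E\<close>. Where \<open>E\<close> leaves the second sequence it has a torsion
  part \<open>E'\<close> and a quotient \<open>C = E/E'\<close> lying in one of the classes, say \<open>W\<^sub>c\<close>. If \<open>E' \<subset> Y\<close>, then \<open>Hom(Y, C)\<close>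
  and \<open>Hom(C, E/Y)\<close> are nonzero, so \<open>i + 1 \<le> c \<le> i\<close>; if \<open>Y \<subseteq> E'\<close>, then \<open>Hom(E/Y, C) \<noteq> 0\<close> forces \<open>E' = Y\<close>, which
  contradicts the order in the second sequence. Hence every indecomposable of \<open>\<T>\<^sub>i \<inter> \<T>\<^sub>i\<^sub>+\<^sub>2\<^sup>\<bottom>\<close> lies in
  \<open>W\<^sub>i\<close> or \<open>W\<^sub>i\<^sub>+\<^sub>1\<close>, so the two classes can be swapped by a deformation across a square, and bubble sort
  turns the first sequence into the second.
\<close>

section \<open>Submodules, quotients and homomorphisms\<close>

text \<open>A brick label is determined only up to isomorphism, whereas
  \<open>Filt \<Lambda> B\<close> is the same class for every label \<open>B\<close> of a step.
  Equality of the sets of bricks therefore passes to the classes as soon as every step has a label;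
  this existence is what the modules of minimal length are for.

  The new middle term of a square is cut out of T_i by the condition Hom(-, Y0) = 0 for a nonzero Y0
  in W_{i+1}; such modules form a torsion class. Its two classes must be computed on all modules,
  while uniseriality speaks only of indecomposable ones. Decomposition into indecomposables bridges
  the gap, because torsion classes and their orthogonals are closed under summands and direct sums.

  Uniseriality acts through the comparability of any two submodules of an indecomposable module.
  This makes the torsion parts of E in the two sequences nested, so that there are nonzero maps
  between the corresponding quotients of E.\<close>

context right_module
begin

lemma smult_zero_ring: "x \<in> carrier M \<Longrightarrow> \<zero>\<^bsub>\<Lambda>\<^esub> \<odot>\<^bsub>M\<^esub> x = \<zero>\<^bsub>M\<^esub>"
  using smult_add_ring[of "\<zero>\<^bsub>\<Lambda>\<^esub>" "\<zero>\<^bsub>\<Lambda>\<^esub>" x] smult_closed[of "\<zero>\<^bsub>\<Lambda>\<^esub>" x]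
  by (simp add: M.add.l_cancel_one')

lemma smult_zero_module: "a \<in> carrier \<Lambda> \<Longrightarrow> a \<odot>\<^bsub>M\<^esub> \<zero>\<^bsub>M\<^esub> = \<zero>\<^bsub>M\<^esub>"
  using smult_add_module[of a "\<zero>\<^bsub>M\<^esub>" "\<zero>\<^bsub>M\<^esub>"] smult_closed[of a "\<zero>\<^bsub>M\<^esub>"]
  by (simp add: M.add.l_cancel_one')

lemma smult_minus_one:
  assumes "x \<in> carrier M"
  shows "(\<ominus>\<^bsub>\<Lambda>\<^esub> \<one>\<^bsub>\<Lambda>\<^esub>) \<odot>\<^bsub>M\<^esub> x = \<ominus>\<^bsub>M\<^esub> x"
proof -
  have "((\<ominus>\<^bsub>\<Lambda>\<^esub> \<one>\<^bsub>\<Lambda>\<^esub>) \<odot>\<^bsub>M\<^esub> x) \<oplus>\<^bsub>M\<^esub> x = (\<ominus>\<^bsub>\<Lambda>\<^esub> \<one>\<^bsub>\<Lambda>\<^esub> \<oplus>\<^bsub>\<Lambda>\<^esub> \<one>\<^bsub>\<Lambda>\<^esub>) \<odot>\<^bsub>M\<^esub> x"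
    using assms by (simp add: smult_add_ring smult_one)
  also have "\<dots> = \<zero>\<^bsub>M\<^esub>" using assms by (simp add: \<Lambda>.l_neg smult_zero_ring)
  finally show ?thesis
    using assms M.minus_equality smult_closed by simp
qed

lemma smult_minus:
  assumes "a \<in> carrier \<Lambda>" "x \<in> carrier M" "y \<in> carrier M"
  shows "a \<odot>\<^bsub>M\<^esub> (x \<ominus>\<^bsub>M\<^esub> y) = a \<odot>\<^bsub>M\<^esub> x \<ominus>\<^bsub>M\<^esub> a \<odot>\<^bsub>M\<^esub> y"
proof -
  have "a \<odot>\<^bsub>M\<^esub> (\<ominus>\<^bsub>M\<^esub> y) \<oplus>\<^bsub>M\<^esub> a \<odot>\<^bsub>M\<^esub> y = \<zero>\<^bsub>M\<^esub>"
    using assms by (simp flip: smult_add_module add: M.l_neg smult_zero_module)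
  then have "\<ominus>\<^bsub>M\<^esub> (a \<odot>\<^bsub>M\<^esub> y) = a \<odot>\<^bsub>M\<^esub> (\<ominus>\<^bsub>M\<^esub> y)"
    using assms M.minus_equality smult_closed by simp
  then show ?thesis using assms by (simp add: M.minus_eq smult_add_module)
qed

lemma minus_eq_zero_iff:
  "x \<in> carrier M \<Longrightarrow> y \<in> carrier M \<Longrightarrow> x \<ominus>\<^bsub>M\<^esub> y = \<zero>\<^bsub>M\<^esub> \<longleftrightarrow> x = y"
  by (metis M.add.inv_closed M.minus_equality M.minus_minus M.r_neg a_minus_def)

text \<open>Negatives are obtained by acting with minus one, so the additive subgroup demanded by
  the library predicate reduces to closure under zero, sums and scalars.\<close>

lemma submodule_iff:
  "submodule S \<Lambda> M \<longleftrightarrow> S \<subseteq> carrier M \<and> \<zero>\<^bsub>M\<^esub> \<in> S \<and>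
     (\<forall>x\<in>S. \<forall>y\<in>S. x \<oplus>\<^bsub>M\<^esub> y \<in> S) \<and> (\<forall>a\<in>carrier \<Lambda>. \<forall>x\<in>S. a \<odot>\<^bsub>M\<^esub> x \<in> S)" (is "?l \<longleftrightarrow> ?r")
proof
  assume l: ?l
  then interpret submodule S \<Lambda> M .
  show ?r using subset m_closed one_closed smult_closed by auto
next
  assume r: ?r
  have "inv\<^bsub>add_monoid M\<^esub> x \<in> S" if "x \<in> S" for x
  proof -
    have "\<ominus>\<^bsub>M\<^esub> x = (\<ominus>\<^bsub>\<Lambda>\<^esub> \<one>\<^bsub>\<Lambda>\<^esub>) \<odot>\<^bsub>M\<^esub> x" using r that smult_minus_one by auto
    then show ?thesis using r that by (simp add: a_inv_def)
  qed
  then have "subgroup S (add_monoid M)"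
    using r by (intro subgroup.intro) auto
  then show ?l using r
    by (simp add: submodule_def submodule_axioms_def)
qed

lemma submodule_minus:
  assumes "submodule S \<Lambda> M" "x \<in> S" "y \<in> S"
  shows "x \<ominus>\<^bsub>M\<^esub> y \<in> S"
proof -
  have "\<ominus>\<^bsub>M\<^esub> y \<in> S"
    using assms smult_minus_one[of y] unfolding submodule_iff
    by (metis \<Lambda>.add.inv_closed \<Lambda>.one_closed in_mono)
  then show ?thesis using assms unfolding submodule_iff by (simp add: a_minus_def)
qed

lemma zero_submodule: "submodule {\<zero>\<^bsub>M\<^esub>} \<Lambda> M"
  by (simp add: submodule_iff smult_zero_module)

lemma carrier_submodule: "submodule (carrier M) \<Lambda> M"
  by (auto simp: submodule_iff smult_closed)

lemma submodule_sum_iff: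
  "x \<in> S <+>\<^bsub>M\<^esub> T \<longleftrightarrow> (\<exists>s\<in>S. \<exists>t\<in>T. x = s \<oplus>\<^bsub>M\<^esub> t)"
  by (auto simp: set_add_def')

lemma submodule_sum:
  assumes S: "submodule S \<Lambda> M" and T: "submodule T \<Lambda> M"
  shows "submodule (S <+>\<^bsub>M\<^esub> T) \<Lambda> M"
  unfolding submodule_iff
proof (intro conjI ballI)
  note S = S[unfolded submodule_iff] and T = T[unfolded submodule_iff]
  show "S <+>\<^bsub>M\<^esub> T \<subseteq> carrier M"
    using S T by (auto simp: submodule_sum_iff subset_iff)
  show "\<zero>\<^bsub>M\<^esub> \<in> S <+>\<^bsub>M\<^esub> T" unfolding submodule_sum_iff using S T M.l_zero[OF M.zero_closed] by (intro bexI[of _ "\<zero>\<^bsub>M\<^esub>"]) simp_all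
  fix x y assume "x \<in> S <+>\<^bsub>M\<^esub> T" "y \<in> S <+>\<^bsub>M\<^esub> T"
  then obtain s t s' t' where "s \<in> S" "t \<in> T" "x = s \<oplus>\<^bsub>M\<^esub> t"
    "s' \<in> S" "t' \<in> T" "y = s' \<oplus>\<^bsub>M\<^esub> t'" by (auto simp: submodule_sum_iff)
  moreover from this have "x \<oplus>\<^bsub>M\<^esub> y = (s \<oplus>\<^bsub>M\<^esub> s') \<oplus>\<^bsub>M\<^esub> (t \<oplus>\<^bsub>M\<^esub> t')"
    using S T by (simp add: M.a_ac subset_iff)
  ultimately show "x \<oplus>\<^bsub>M\<^esub> y \<in> S <+>\<^bsub>M\<^esub> T" using S T unfolding submodule_sum_iff by blast
next
  note S = S[unfolded submodule_iff] and T = T[unfolded submodule_iff]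
  fix a x assume "a \<in> carrier \<Lambda>" "x \<in> S <+>\<^bsub>M\<^esub> T"
  then obtain s t where "s \<in> S" "t \<in> T" "x = s \<oplus>\<^bsub>M\<^esub> t" by (auto simp: submodule_sum_iff)
  then show "a \<odot>\<^bsub>M\<^esub> x \<in> S <+>\<^bsub>M\<^esub> T"
    using S T \<open>a \<in> carrier \<Lambda>\<close> smult_add_module[of a s t] unfolding submodule_sum_iff by blast
qed

lemma submodule_sum_ge:
  assumes "submodule S \<Lambda> M" "submodule T \<Lambda> M"
  shows "S \<subseteq> S <+>\<^bsub>M\<^esub> T" "T \<subseteq> S <+>\<^bsub>M\<^esub> T"
proof -
  note S = assms(1)[unfolded submodule_iff] and T = assms(2)[unfolded submodule_iff]
  show "S \<subseteq> S <+>\<^bsub>M\<^esub> T"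
  proof
    fix x assume "x \<in> S"
    then show "x \<in> S <+>\<^bsub>M\<^esub> T"
      using S T M.r_zero[of x] unfolding submodule_sum_iff by (metis subsetD)
  qed
  show "T \<subseteq> S <+>\<^bsub>M\<^esub> T"
  proof
    fix x assume "x \<in> T"
    then show "x \<in> S <+>\<^bsub>M\<^esub> T"
      using S T M.l_zero[of x] unfolding submodule_sum_iff by (metis subsetD)
  qed
qed

lemma right_module_sub:
  assumes "submodule S \<Lambda> M"
  shows "right_module \<Lambda> (M\<lparr>carrier := S\<rparr>)"
proof -
  note S = assms[unfolded submodule_iff]
  have "abelian_group (M\<lparr>carrier := S\<rparr>)"
  proof (rule abelian_groupI, goal_cases)
    case (6 x)
    then show ?case using S submodule_minus[OF assms, of "\<zero>\<^bsub>M\<^esub>" x]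
      by (auto intro!: bexI[of _ "\<zero>\<^bsub>M\<^esub> \<ominus>\<^bsub>M\<^esub> x"] simp: M.minus_eq M.l_neg subset_iff)
  qed (use S in \<open>auto simp: M.a_ac subset_iff\<close>)
  then show ?thesis
    using S unfolding right_module_def right_module_axioms_def
    by (auto simp: \<Lambda>.ring_axioms smult_add_ring smult_add_module smult_mult smult_one subset_iff)
qed

lemma submodule_sub_iff:
  assumes "submodule S \<Lambda> M"
  shows "submodule T \<Lambda> (M\<lparr>carrier := S\<rparr>) \<longleftrightarrow> submodule T \<Lambda> M \<and> T \<subseteq> S"
proof -
  interpret S: right_module \<Lambda> "M\<lparr>carrier := S\<rparr>" using assms by (rule right_module_sub)
  show ?thesis using assms unfolding S.submodule_iff submodule_iff by auto
qed

end

section \<open>Homomorphisms and quotients\<close>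

lemma rmod_hom_iff:
  "f \<in> rmod_hom \<Lambda> M N \<longleftrightarrow> (\<forall>x\<in>carrier M. f x \<in> carrier N) \<and>
    (\<forall>x\<in>carrier M. \<forall>y\<in>carrier M. f (x \<oplus>\<^bsub>M\<^esub> y) = f x \<oplus>\<^bsub>N\<^esub> f y) \<and>
    (\<forall>a\<in>carrier \<Lambda>. \<forall>x\<in>carrier M. f (a \<odot>\<^bsub>M\<^esub> x) = a \<odot>\<^bsub>N\<^esub> f x)"
  by (auto simp: rmod_hom_def hom_def)

lemma rmod_hom_comp:
  "f \<in> rmod_hom \<Lambda> L M \<Longrightarrow> g \<in> rmod_hom \<Lambda> M N \<Longrightarrow> (\<lambda>x. g (f x)) \<in> rmod_hom \<Lambda> L N"
  by (auto simp: rmod_hom_iff)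

lemma rmod_hom_id: "(\<lambda>x. x) \<in> rmod_hom \<Lambda> M M"
  by (auto simp: rmod_hom_iff)

lemma rmod_hom_restrict:
  assumes "f \<in> rmod_hom \<Lambda> M N" "S \<subseteq> carrier M" "f ` S \<subseteq> T"
  shows "f \<in> rmod_hom \<Lambda> (M\<lparr>carrier := S\<rparr>) (N\<lparr>carrier := T\<rparr>)"
  using assms unfolding rmod_hom_iff by (simp add: subset_iff image_subset_iff)

lemma rmod_hom_restrict_source:
  "f \<in> rmod_hom \<Lambda> M N \<Longrightarrow> S \<subseteq> carrier M \<Longrightarrow> f \<in> rmod_hom \<Lambda> (M\<lparr>carrier := S\<rparr>) N"
  by (auto simp: rmod_hom_iff subset_iff)

lemma rmod_hom_extend_target:
  "f \<in> rmod_hom \<Lambda> M (N\<lparr>carrier := T\<rparr>) \<Longrightarrow> T \<subseteq> carrier N \<Longrightarrow> f \<in> rmod_hom \<Lambda> M N"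
  by (auto simp: rmod_hom_iff)

locale rmod_hom_loc = M: right_module \<Lambda> M + N: right_module \<Lambda> N
    for \<Lambda> :: "('a, 'c) ring_scheme" and M :: "('a, 'm) module" and N :: "('a, 'n) module" +
  fixes f
  assumes hom: "f \<in> rmod_hom \<Lambda> M N"
begin

lemma
  shows closed: "x \<in> carrier M \<Longrightarrow> f x \<in> carrier N"
    and add: "x \<in> carrier M \<Longrightarrow> y \<in> carrier M \<Longrightarrow> f (x \<oplus>\<^bsub>M\<^esub> y) = f x \<oplus>\<^bsub>N\<^esub> f y"
    and smult: "a \<in> carrier \<Lambda> \<Longrightarrow> x \<in> carrier M \<Longrightarrow> f (a \<odot>\<^bsub>M\<^esub> x) = a \<odot>\<^bsub>N\<^esub> f x"
  using hom by (auto simp: rmod_hom_iff)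

lemma zero: "f \<zero>\<^bsub>M\<^esub> = \<zero>\<^bsub>N\<^esub>"
  using smult[of "\<zero>\<^bsub>\<Lambda>\<^esub>" "\<zero>\<^bsub>M\<^esub>"] by (simp add: M.smult_zero_ring N.smult_zero_ring closed)

lemma minus: "x \<in> carrier M \<Longrightarrow> y \<in> carrier M \<Longrightarrow> f (x \<ominus>\<^bsub>M\<^esub> y) = f x \<ominus>\<^bsub>N\<^esub> f y"
  using smult[of "\<ominus>\<^bsub>\<Lambda>\<^esub> \<one>\<^bsub>\<Lambda>\<^esub>" y]
  by (simp add: a_minus_def add M.smult_minus_one N.smult_minus_one closed)

lemma eq_iff: "x \<in> carrier M \<Longrightarrow> y \<in> carrier M \<Longrightarrow> f x = f y \<longleftrightarrow> f (x \<ominus>\<^bsub>M\<^esub> y) = \<zero>\<^bsub>N\<^esub>"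
  by (simp add: minus closed N.minus_eq_zero_iff)

lemma inj_iff: "inj_on f (carrier M) \<longleftrightarrow> (\<forall>x\<in>carrier M. f x = \<zero>\<^bsub>N\<^esub> \<longrightarrow> x = \<zero>\<^bsub>M\<^esub>)"
proof
  assume "inj_on f (carrier M)"
  then show "\<forall>x\<in>carrier M. f x = \<zero>\<^bsub>N\<^esub> \<longrightarrow> x = \<zero>\<^bsub>M\<^esub>"
    using zero by (metis M.M.zero_closed inj_onD)
next
  assume "\<forall>x\<in>carrier M. f x = \<zero>\<^bsub>N\<^esub> \<longrightarrow> x = \<zero>\<^bsub>M\<^esub>"
  then show "inj_on f (carrier M)"
    by (intro inj_onI) (metis M.minus_eq_zero_iff M.M.minus_closed eq_iff)
qed

lemma vimage_submodule:
  assumes "submodule T \<Lambda> N"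
  shows "submodule {x \<in> carrier M. f x \<in> T} \<Lambda> M"
  using assms unfolding M.submodule_iff N.submodule_iff
  by (auto simp: zero add smult M.smult_closed)

lemma image_submodule:
  assumes "submodule S \<Lambda> M"
  shows "submodule (f ` S) \<Lambda> N"
proof -
  have S: "S \<subseteq> carrier M" "\<zero>\<^bsub>M\<^esub> \<in> S" "\<And>x y. x \<in> S \<Longrightarrow> y \<in> S \<Longrightarrow> x \<oplus>\<^bsub>M\<^esub> y \<in> S"
    "\<And>a x. a \<in> carrier \<Lambda> \<Longrightarrow> x \<in> S \<Longrightarrow> a \<odot>\<^bsub>M\<^esub> x \<in> S"
    using assms unfolding M.submodule_iff by auto
  have "\<zero>\<^bsub>N\<^esub> \<in> f ` S" using S(2) zero by (metis imageI)
  moreover have "\<forall>x\<in>f ` S. \<forall>y\<in>f ` S. x \<oplus>\<^bsub>N\<^esub> y \<in> f ` S"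
    using S add by (auto simp: subset_iff) (metis imageI)
  moreover have "\<forall>a\<in>carrier \<Lambda>. \<forall>x\<in>f ` S. a \<odot>\<^bsub>N\<^esub> x \<in> f ` S"
    using S smult by (auto simp: subset_iff) (metis imageI)
  ultimately show ?thesis unfolding N.submodule_iff using S(1) closed by auto
qed

end

text \<open>Stands in for the quotient object: \<open>N\<close> is any module presented as the
  quotient of \<open>M\<close> by the named kernel \<open>S\<close>, so it is free up to isomorphism
  and no cosets appear as elements.\<close>

definition rmod_epi ::
    "('a, 'c) ring_scheme \<Rightarrow> ('a, 'm) module \<Rightarrow> ('a, 'n) module \<Rightarrow> 'm set \<Rightarrow> ('m \<Rightarrow> 'n) \<Rightarrow> bool" where
  "rmod_epi \<Lambda> M N S g \<longleftrightarrow> g \<in> rmod_hom \<Lambda> M N \<and> g ` carrier M = carrier N \<and>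
     {x \<in> carrier M. g x = \<zero>\<^bsub>N\<^esub>} = S"

text \<open>Universal property of the quotient: \<open>k\<close> evaluates \<open>h\<close> at an
  arbitrary preimage, and two preimages differ by an element of \<open>S\<close>, where
  \<open>h\<close> vanishes.\<close>

lemma rmod_hom_factor:
  assumes M: "right_module \<Lambda> M" and N: "right_module \<Lambda> N" and P: "right_module \<Lambda> P"
    and g: "rmod_epi \<Lambda> M N S g" and h: "h \<in> rmod_hom \<Lambda> M P"
    and ker: "\<And>x. x \<in> S \<Longrightarrow> h x = \<zero>\<^bsub>P\<^esub>"
  obtains k where "k \<in> rmod_hom \<Lambda> N P" "\<And>x. x \<in> carrier M \<Longrightarrow> k (g x) = h x"
proof -
  interpret g: rmod_hom_loc \<Lambda> M N g
    using M N g by (simp add: rmod_hom_loc_def rmod_hom_loc_axioms_def rmod_epi_def)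
  interpret h: rmod_hom_loc \<Lambda> M P h
    using M P h by (simp add: rmod_hom_loc_def rmod_hom_loc_axioms_def)
  define k where "k y = h (SOME x. x \<in> carrier M \<and> g x = y)" for y
  have kg: "k (g x) = h x" if x: "x \<in> carrier M" for x
  proof -
    define x' where "x' = (SOME x'. x' \<in> carrier M \<and> g x' = g x)"
    have x': "x' \<in> carrier M" "g x' = g x"
      unfolding x'_def using someI[of "\<lambda>x'. x' \<in> carrier M \<and> g x' = g x" x] x by auto
    then have "x' \<ominus>\<^bsub>M\<^esub> x \<in> S" using g x by (auto simp: g.eq_iff rmod_epi_def)
    then have "h x' = h x" using ker x x' by (simp add: h.eq_iff)
    then show ?thesis by (simp add: k_def x'_def)
  qed
  have sur: "\<exists>x\<in>carrier M. y = g x" if "y \<in> carrier N" for y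
    using g that by (auto simp: rmod_epi_def image_iff)
  have "k \<in> rmod_hom \<Lambda> N P"
    unfolding rmod_hom_iff
  proof (intro conjI ballI)
    fix x assume "x \<in> carrier N"
    then obtain x' where "x' \<in> carrier M" "x = g x'" using sur by blast
    then show "k x \<in> carrier P" by (simp add: kg h.closed)
  next
    fix x y assume "x \<in> carrier N" "y \<in> carrier N"
    then obtain x' y' where "x' \<in> carrier M" "y' \<in> carrier M" "x = g x'" "y = g y'" using sur by meson
    then show "k (x \<oplus>\<^bsub>N\<^esub> y) = k x \<oplus>\<^bsub>P\<^esub> k y"
      by (simp add: kg h.add flip: g.add)
  next
    fix a x assume "a \<in> carrier \<Lambda>" "x \<in> carrier N"
    then obtain x' where "x' \<in> carrier M" "x = g x'" using sur by blast
    then show "k (a \<odot>\<^bsub>N\<^esub> x) = a \<odot>\<^bsub>P\<^esub> k x"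
      using \<open>a \<in> carrier \<Lambda>\<close> by (metis g.smult h.smult kg g.M.smult_closed)
  qed
  then show thesis using kg that by blast
qed

text \<open>Every axiom for \<open>N\<close> is the image under \<open>g\<close> of the same axiom
  for \<open>M\<close>. That \<open>N\<close> is even a group is a conclusion here, so a freshly
  built quotient can be recognised as a module.\<close>

lemma right_module_image:
  assumes M: "right_module \<Lambda> M" and g: "g ` carrier M = carrier N"
    and add: "\<And>x y. x \<in> carrier M \<Longrightarrow> y \<in> carrier M \<Longrightarrow> g (x \<oplus>\<^bsub>M\<^esub> y) = g x \<oplus>\<^bsub>N\<^esub> g y"
    and smult: "\<And>a x. a \<in> carrier \<Lambda> \<Longrightarrow> x \<in> carrier M \<Longrightarrow> g (a \<odot>\<^bsub>M\<^esub> x) = a \<odot>\<^bsub>N\<^esub> g x"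
    and zero: "g \<zero>\<^bsub>M\<^esub> = \<zero>\<^bsub>N\<^esub>"
  shows "right_module \<Lambda> N"
proof -
  interpret M: right_module \<Lambda> M by fact
  have sur: "\<exists>x\<in>carrier M. y = g x" if "y \<in> carrier N" for y
    using g that by (auto simp: image_iff)
  have cl: "g x \<in> carrier N" if "x \<in> carrier M" for x using g that by auto
  have "abelian_group N"
  proof (rule abelian_groupI, goal_cases)
    case (1 x y) then show ?case using sur add cl by (metis M.M.a_closed)
  next
    case 2 then show ?case using cl[of "\<zero>\<^bsub>M\<^esub>"] zero by simp
  next
    case (3 x y z)
    then obtain x' y' z' where *: "x' \<in> carrier M" "y' \<in> carrier M" "z' \<in> carrier M"
      "x = g x'" "y = g y'" "z = g z'" using sur by meson
    then have "x \<oplus>\<^bsub>N\<^esub> y \<oplus>\<^bsub>N\<^esub> z = g (x' \<oplus>\<^bsub>M\<^esub> y' \<oplus>\<^bsub>M\<^esub> z')"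
      "x \<oplus>\<^bsub>N\<^esub> (y \<oplus>\<^bsub>N\<^esub> z) = g (x' \<oplus>\<^bsub>M\<^esub> (y' \<oplus>\<^bsub>M\<^esub> z'))" by (simp_all add: add)
    then show ?case using * by (simp add: M.M.a_assoc)
  next
    case (4 x y)
    then obtain x' y' where "x' \<in> carrier M" "y' \<in> carrier M" "x = g x'" "y = g y'" using sur by meson
    then show ?case by (simp add: M.M.a_comm flip: add)
  next
    case (5 x) then show ?case using sur add zero by (metis M.M.l_zero M.M.zero_closed)
  next
    case (6 x)
    then obtain x' where "x' \<in> carrier M" "x = g x'" using sur by blast
    then show ?case using add[of "\<ominus>\<^bsub>M\<^esub> x'" x'] zero cl by (metis M.M.a_inv_closed M.M.l_neg)
  qed
  moreover have "right_module_axioms \<Lambda> N"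
  proof (unfold_locales, goal_cases)
    case (1 a x) then show ?case using sur smult cl by (metis M.smult_closed)
  next
    case (2 a b x)
    then obtain x' where "x' \<in> carrier M" "x = g x'" using sur by blast
    with 2 show ?case by (simp add: M.smult_add_ring M.smult_closed flip: add smult)
  next
    case (3 a x y)
    then obtain x' y' where "x' \<in> carrier M" "x = g x'" "y' \<in> carrier M" "y = g y'" using sur by meson
    with 3 show ?case by (simp add: M.smult_add_module M.smult_closed flip: add smult)
  next
    case (4 a b x)
    then obtain x' where "x' \<in> carrier M" "x = g x'" using sur by blast
    with 4 show ?case by (simp add: M.smult_mult M.smult_closed flip: smult)
  next
    case (5 x)
    then obtain x' where "x' \<in> carrier M" "x = g x'" using sur by blast
    then show ?case by (metis M.smult_one smult M.\<Lambda>.one_closed)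
  qed
  ultimately show ?thesis by (simp add: right_module_def M.\<Lambda>.ring_axioms)
qed

text \<open>The images of generators generate: the preimage of a submodule containing them is a
  submodule containing the generators of \<open>M\<close>.\<close>

lemma finitely_generated_epi:
  assumes M: "right_module \<Lambda> M" and N: "right_module \<Lambda> N"
    and g: "g \<in> rmod_hom \<Lambda> M N" "g ` carrier M = carrier N" and fg: "finitely_generated \<Lambda> M"
  shows "finitely_generated \<Lambda> N"
proof -
  interpret rmod_hom_loc \<Lambda> M N g
    using M N g by (simp add: rmod_hom_loc_def rmod_hom_loc_axioms_def)
  obtain S where S: "finite S" "S \<subseteq> carrier M"
    "\<And>H. submodule H \<Lambda> M \<Longrightarrow> S \<subseteq> H \<Longrightarrow> H = carrier M"
    using fg by (auto simp: finitely_generated_def)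
  have "H = carrier N" if H: "submodule H \<Lambda> N" "g ` S \<subseteq> H" for H
  proof -
    have "{x \<in> carrier M. g x \<in> H} = carrier M"
      using S H by (intro S(3) vimage_submodule) auto
    then have "carrier N \<subseteq> H" unfolding g(2)[symmetric] by blast
    then show ?thesis using H(1) by (simp add: N.submodule_iff subset_antisym)
  qed
  then show ?thesis unfolding finitely_generated_def
    using S(1,2) closed by (intro exI[of _ "g ` S"]) (auto simp: image_subset_iff subset_iff)
qed

text \<open>The quotient is realised on a set of coset representatives, so that it stays in the type of \<open>M\<close>.\<close>

lemma quotient_exists:
  fixes M :: "('a, 'm) module"
  assumes M: "right_module \<Lambda> M" and S: "submodule S \<Lambda> M"
  obtains N :: "('a, 'm) module" and g where "right_module \<Lambda> N" "rmod_epi \<Lambda> M N S g"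
proof -
  interpret M: right_module \<Lambda> M by fact
  note S' = S[unfolded M.submodule_iff]
  define E where "E x y \<longleftrightarrow> x \<in> carrier M \<and> y \<in> carrier M \<and> x \<ominus>\<^bsub>M\<^esub> y \<in> S" for x y
  have minus_zero: "x \<ominus>\<^bsub>M\<^esub> \<zero>\<^bsub>M\<^esub> = x" if "x \<in> carrier M" for x
    using that M.M.r_neg[OF M.M.zero_closed] M.M.l_zero[of "\<ominus>\<^bsub>M\<^esub> \<zero>\<^bsub>M\<^esub>"] by (simp add: M.M.minus_eq)
  have refl: "E x x" if "x \<in> carrier M" for x using that S' by (simp add: E_def M.M.minus_eq M.M.r_neg)
  have sym: "E y x" if "E x y" for x y
  proof -
    have "\<zero>\<^bsub>M\<^esub> \<ominus>\<^bsub>M\<^esub> (x \<ominus>\<^bsub>M\<^esub> y) \<in> S" using that S' M.submodule_minus[OF S] by (auto simp: E_def)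
    moreover have "\<zero>\<^bsub>M\<^esub> \<ominus>\<^bsub>M\<^esub> (x \<ominus>\<^bsub>M\<^esub> y) = y \<ominus>\<^bsub>M\<^esub> x" using that
      by (simp add: E_def M.M.minus_eq M.M.minus_add M.M.a_comm)
    ultimately show ?thesis using that by (simp add: E_def)
  qed
  have trans: "E x z" if "E x y" "E y z" for x y z
  proof -
    have "(x \<ominus>\<^bsub>M\<^esub> y) \<oplus>\<^bsub>M\<^esub> (y \<ominus>\<^bsub>M\<^esub> z) \<in> S" using that S' by (auto simp: E_def)
    moreover have "(x \<ominus>\<^bsub>M\<^esub> y) \<oplus>\<^bsub>M\<^esub> (y \<ominus>\<^bsub>M\<^esub> z) = x \<ominus>\<^bsub>M\<^esub> z" using that
      by (simp add: E_def M.M.minus_eq M.M.a_assoc M.M.r_neg2 M.M.r_neg1)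
    ultimately show ?thesis using that by (simp add: E_def)
  qed
  have addE: "E (x \<oplus>\<^bsub>M\<^esub> y) (x' \<oplus>\<^bsub>M\<^esub> y')" if "E x x'" "E y y'" for x y x' y'
  proof -
    have "(x \<ominus>\<^bsub>M\<^esub> x') \<oplus>\<^bsub>M\<^esub> (y \<ominus>\<^bsub>M\<^esub> y') \<in> S" using that S' by (auto simp: E_def)
    moreover have "(x \<ominus>\<^bsub>M\<^esub> x') \<oplus>\<^bsub>M\<^esub> (y \<ominus>\<^bsub>M\<^esub> y') = (x \<oplus>\<^bsub>M\<^esub> y) \<ominus>\<^bsub>M\<^esub> (x' \<oplus>\<^bsub>M\<^esub> y')" using that
      by (simp add: E_def M.M.minus_eq M.M.a_ac M.M.minus_add)
    ultimately show ?thesis using that by (simp add: E_def)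
  qed
  have smE: "E (a \<odot>\<^bsub>M\<^esub> x) (a \<odot>\<^bsub>M\<^esub> x')" if "E x x'" "a \<in> carrier \<Lambda>" for a x x'
  proof -
    have "a \<odot>\<^bsub>M\<^esub> (x \<ominus>\<^bsub>M\<^esub> x') \<in> S" using that S' by (auto simp: E_def)
    then show ?thesis using that by (simp add: E_def M.smult_minus M.smult_closed)
  qed
  define r where "r x = (SOME y. E x y)" for x
  have Er: "E x (r x)" if "x \<in> carrier M" for x
    unfolding r_def using refl[OF that] by (rule someI)
  have rE: "r x = r y" if "E x y" for x y
  proof -
    \<comment> \<open>\<open>E x\<close> and \<open>E y\<close> are equal as predicates, so
      \<open>SOME\<close> picks the same representative for both.\<close>
    have "E x = E y" using that trans sym by blast
    then show ?thesis by (simp add: r_def)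
  qed
  have rc: "r x \<in> carrier M" if "x \<in> carrier M" for x using Er[OF that] by (simp add: E_def)
  define N :: "('a, 'm) module" where "N = \<lparr>carrier = r ` carrier M, monoid.mult = undefined, one = undefined,
    ring.zero = r \<zero>\<^bsub>M\<^esub>, ring.add = (\<lambda>x y. r (x \<oplus>\<^bsub>M\<^esub> y)), smult = (\<lambda>a x. r (a \<odot>\<^bsub>M\<^esub> x))\<rparr>"
  have add: "r (x \<oplus>\<^bsub>M\<^esub> y) = r x \<oplus>\<^bsub>N\<^esub> r y" if "x \<in> carrier M" "y \<in> carrier M" for x y
    using that by (auto simp: N_def intro: rE addE Er)
  have sm: "r (a \<odot>\<^bsub>M\<^esub> x) = a \<odot>\<^bsub>N\<^esub> r x" if "x \<in> carrier M" "a \<in> carrier \<Lambda>" for x a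
    using that by (auto simp: N_def intro: rE smE Er)
  have N: "right_module \<Lambda> N"
    by (rule right_module_image[OF M, of r]) (auto simp: add sm, auto simp: N_def)
  have hom: "r \<in> rmod_hom \<Lambda> M N" unfolding rmod_hom_iff by (auto simp: add sm) (auto simp: N_def)
  have "r x = r \<zero>\<^bsub>M\<^esub> \<longleftrightarrow> x \<in> S" if x: "x \<in> carrier M" for x
  proof
    assume "r x = r \<zero>\<^bsub>M\<^esub>"
    then have "E x \<zero>\<^bsub>M\<^esub>" using Er[OF x] Er[OF M.M.zero_closed] sym trans by metis
    then show "x \<in> S" using x by (simp add: E_def minus_zero)
  next
    assume "x \<in> S"
    then have "E x \<zero>\<^bsub>M\<^esub>" using x by (simp add: E_def minus_zero)
    then show "r x = r \<zero>\<^bsub>M\<^esub>" by (rule rE)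
  qed
  then have "{x \<in> carrier M. r x = \<zero>\<^bsub>N\<^esub>} = S" using S' by (auto simp: N_def)
  then have "rmod_epi \<Lambda> M N S r" using hom by (simp add: rmod_epi_def) (simp add: N_def)
  with N show thesis by (rule that)
qed

section \<open>Length\<close>

definition submodule_chain ::
    "('a, 'c) ring_scheme \<Rightarrow> ('a, 'm) module \<Rightarrow> 'm set set \<Rightarrow> bool" where
  "submodule_chain \<Lambda> M C \<longleftrightarrow>
    (\<forall>S\<in>C. submodule S \<Lambda> M) \<and> (\<forall>S\<in>C. \<forall>T\<in>C. S \<subseteq> T \<or> T \<subseteq> S)"

text \<open>One bound for all chains, taken as sets of submodules: such a bound can be established
  directly by counting, before any composition series is available.\<close>

definition finite_length :: "('a, 'c) ring_scheme \<Rightarrow> ('a, 'm) module \<Rightarrow> bool" where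
  "finite_length \<Lambda> M \<longleftrightarrow> (\<exists>n. \<forall>C. submodule_chain \<Lambda> M C \<longrightarrow> finite C \<and> card C \<le> n)"

text \<open>The members of a chain are counted, zero and \<open>M\<close> included, so for modules
  of finite length this is the usual length plus one. It serves as a measure that strictly drops for
  proper submodules and proper quotients.\<close>

definition mlen :: "('a, 'c) ring_scheme \<Rightarrow> ('a, 'm) module \<Rightarrow> nat" where
  "mlen \<Lambda> M = Max {card C |C. submodule_chain \<Lambda> M C}"

lemma submodule_chain_insert:
  "submodule_chain \<Lambda> M C \<Longrightarrow> submodule U \<Lambda> M \<Longrightarrow> (\<And>T. T \<in> C \<Longrightarrow> U \<subseteq> T \<or> T \<subseteq> U) \<Longrightarrow>
    submodule_chain \<Lambda> M (insert U C)"
  by (auto simp: submodule_chain_def)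

lemma mlen_set:
  assumes "finite_length \<Lambda> M"
  shows "finite {card C |C. submodule_chain \<Lambda> M C}" "{card C |C. submodule_chain \<Lambda> M C} \<noteq> {}"
proof -
  obtain n where "\<And>C. submodule_chain \<Lambda> M C \<Longrightarrow> card C \<le> n"
    using assms by (auto simp: finite_length_def)
  then have "{card C |C. submodule_chain \<Lambda> M C} \<subseteq> {..n}" by auto
  then show "finite {card C |C. submodule_chain \<Lambda> M C}" by (rule finite_subset) simp
  have "submodule_chain \<Lambda> M {}" by (simp add: submodule_chain_def)
  then show "{card C |C. submodule_chain \<Lambda> M C} \<noteq> {}" by blast
qed

lemma mlen_chain:
  assumes "finite_length \<Lambda> M" "submodule_chain \<Lambda> M C"
  shows "finite C" "card C \<le> mlen \<Lambda> M"
  using assms mlen_set[OF assms(1)] unfolding mlen_def by (auto simp: finite_length_def intro!: Max_ge)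

lemma mlen_attained:
  assumes "finite_length \<Lambda> M"
  obtains C where "submodule_chain \<Lambda> M C" "card C = mlen \<Lambda> M"
  using Max_in[OF mlen_set[OF assms]] that unfolding mlen_def by auto

text \<open>Surjectivity gives back \<open>T\<close> as the image of its preimage, so pulling back a
  chain loses no members; every preimage contains the kernel \<open>S\<close>.\<close>

lemma submodule_chain_vimage:
  assumes M: "right_module \<Lambda> M" and N: "right_module \<Lambda> N" and g: "rmod_epi \<Lambda> M N S g"
    and C: "submodule_chain \<Lambda> N C"
  defines "C' \<equiv> (\<lambda>T. {x \<in> carrier M. g x \<in> T}) ` C"
  shows "submodule_chain \<Lambda> M C'" "inj_on (\<lambda>T. {x \<in> carrier M. g x \<in> T}) C" "\<And>T. T \<in> C' \<Longrightarrow> S \<subseteq> T"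
proof -
  interpret rmod_hom_loc \<Lambda> M N g
    using M N g by (simp add: rmod_hom_loc_def rmod_hom_loc_axioms_def rmod_epi_def)
  show "submodule_chain \<Lambda> M C'"
    using C vimage_submodule unfolding submodule_chain_def C'_def by blast
  show "inj_on (\<lambda>T. {x \<in> carrier M. g x \<in> T}) C"
  proof (rule inj_on_inverseI[where g = "\<lambda>U. g ` U"])
    fix T assume "T \<in> C"
    then have "T \<subseteq> carrier N" using C by (simp add: submodule_chain_def N.submodule_iff)
    then show "g ` {x \<in> carrier M. g x \<in> T} = T" using g by (auto simp: rmod_epi_def image_iff subset_iff)
  qed
  have "\<zero>\<^bsub>N\<^esub> \<in> T" if "T \<in> C" for T
    using C that by (simp add: submodule_chain_def N.submodule_iff)
  then show "S \<subseteq> T" if "T \<in> C'" for T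
    using g that by (auto simp: C'_def rmod_epi_def)
qed

text \<open>The preimages of a longest chain of \<open>N\<close> all contain \<open>S\<close>, so
  when \<open>S\<close> is nonzero the zero submodule can still be added below them.\<close>

lemma mlen_epi_less:
  assumes M: "right_module \<Lambda> M" and N: "right_module \<Lambda> N" and g: "rmod_epi \<Lambda> M N S g"
    and fl: "finite_length \<Lambda> M" and S: "S \<noteq> {\<zero>\<^bsub>M\<^esub>}"
  shows "mlen \<Lambda> N < mlen \<Lambda> M"
proof -
  note v = submodule_chain_vimage[OF M N g]
  have *: "finite C \<and> card C \<le> mlen \<Lambda> M" if "submodule_chain \<Lambda> N C" for C
    using mlen_chain[OF fl v(1)[OF that]] v(2)[OF that]
    by (auto simp: card_image dest: finite_imageD)
  then have fN: "finite_length \<Lambda> N" by (auto simp: finite_length_def)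
  obtain C where C: "submodule_chain \<Lambda> N C" "card C = mlen \<Lambda> N" using mlen_attained[OF fN] .
  interpret rmod_hom_loc \<Lambda> M N g
    using M N g by (simp add: rmod_hom_loc_def rmod_hom_loc_axioms_def rmod_epi_def)
  let ?C = "(\<lambda>T. {x \<in> carrier M. g x \<in> T}) ` C"
  have S0: "\<zero>\<^bsub>M\<^esub> \<in> S" using g by (auto simp: rmod_epi_def zero)
  have nin: "{\<zero>\<^bsub>M\<^esub>} \<notin> ?C" using v(3)[OF C(1)] S S0 by blast
  have "\<zero>\<^bsub>M\<^esub> \<in> T" if "T \<in> ?C" for T using v(1)[OF C(1)] that by (auto simp: submodule_chain_def M.submodule_iff)
  then have "submodule_chain \<Lambda> M (insert {\<zero>\<^bsub>M\<^esub>} ?C)"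
    by (intro submodule_chain_insert v(1)[OF C(1)] M.zero_submodule) blast
  from mlen_chain[OF fl this] nin have "Suc (card ?C) \<le> mlen \<Lambda> M"
    by (simp add: card_insert_disjoint)
  then show "mlen \<Lambda> N < mlen \<Lambda> M" using C(2) card_image[OF v(2)[OF C(1)]] by simp
qed

text \<open>A chain inside \<open>S\<close> is a chain in \<open>M\<close>, and if \<open>S\<close>
  is proper, \<open>carrier M\<close> can be added on top.\<close>

lemma
  assumes M: "right_module \<Lambda> M" and S: "submodule S \<Lambda> M" and fl: "finite_length \<Lambda> M"
  shows finite_length_sub: "finite_length \<Lambda> (M\<lparr>carrier := S\<rparr>)"
    and mlen_sub_le: "mlen \<Lambda> (M\<lparr>carrier := S\<rparr>) \<le> mlen \<Lambda> M"
    and mlen_sub_less: "S \<noteq> carrier M \<Longrightarrow> mlen \<Lambda> (M\<lparr>carrier := S\<rparr>) < mlen \<Lambda> M"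
proof -
  interpret right_module \<Lambda> M by fact
  have ch: "submodule_chain \<Lambda> M C" "\<forall>T\<in>C. T \<subseteq> S" if "submodule_chain \<Lambda> (M\<lparr>carrier := S\<rparr>) C" for C
    using that submodule_sub_iff[OF S] by (auto simp: submodule_chain_def)
  then have *: "finite C \<and> card C \<le> mlen \<Lambda> M" if "submodule_chain \<Lambda> (M\<lparr>carrier := S\<rparr>) C" for C
    using mlen_chain[OF fl] that by blast
  then show fN: "finite_length \<Lambda> (M\<lparr>carrier := S\<rparr>)" by (auto simp: finite_length_def)
  obtain C where C: "submodule_chain \<Lambda> (M\<lparr>carrier := S\<rparr>) C" "card C = mlen \<Lambda> (M\<lparr>carrier := S\<rparr>)"
    using mlen_attained[OF fN] .
  then show "mlen \<Lambda> (M\<lparr>carrier := S\<rparr>) \<le> mlen \<Lambda> M" using * by metis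
  assume ne: "S \<noteq> carrier M"
  have "S \<subseteq> carrier M" using S by (simp add: submodule_iff)
  then have nin: "carrier M \<notin> C" using ne ch(2)[OF C(1)] by blast
  have "submodule_chain \<Lambda> M (insert (carrier M) C)"
    by (rule submodule_chain_insert[OF ch(1)[OF C(1)] carrier_submodule])
      (use ch(2)[OF C(1)] \<open>S \<subseteq> carrier M\<close> in blast)
  from mlen_chain[OF fl this] nin have "Suc (card C) \<le> mlen \<Lambda> M"
    by (simp add: card_insert_disjoint)
  then show "mlen \<Lambda> (M\<lparr>carrier := S\<rparr>) < mlen \<Lambda> M" using C(2) by simp
qed

lemma mlen_sub_strict_mono:
  assumes M: "right_module \<Lambda> M" and S: "submodule S \<Lambda> M" and T: "submodule T \<Lambda> M"
    and fl: "finite_length \<Lambda> M" and less: "S \<subset> T"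
  shows "mlen \<Lambda> (M\<lparr>carrier := S\<rparr>) < mlen \<Lambda> (M\<lparr>carrier := T\<rparr>)"
proof -
  interpret right_module \<Lambda> M by fact
  show ?thesis
    using mlen_sub_less[OF right_module_sub[OF T] _ finite_length_sub[OF M T fl], of S]
      submodule_sub_iff[OF T] S less by auto
qed

text \<open>Among the spans of finite subsets one has the greatest length; an element outside it
  would give a longer one. Combined with \<open>finite_length_sub\<close>, this makes submodules of
  modules of finite length finitely generated.\<close>

lemma finite_length_imp_finitely_generated:
  assumes M: "right_module \<Lambda> M" and fl: "finite_length \<Lambda> M"
  shows "finitely_generated \<Lambda> M"
proof -
  interpret right_module \<Lambda> M by fact
  define sp where "sp S = \<Inter>{H. submodule H \<Lambda> M \<and> S \<subseteq> H}" for S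
  have sp: "submodule (sp S) \<Lambda> M" "S \<subseteq> sp S" if S: "S \<subseteq> carrier M" for S
  proof -
    show "S \<subseteq> sp S" by (auto simp: sp_def)
    have "sp S \<subseteq> carrier M" using carrier_submodule S by (auto simp: sp_def)
    then show "submodule (sp S) \<Lambda> M" unfolding submodule_iff by (auto simp: sp_def submodule_iff)
  qed
  have sp_le: "sp S \<subseteq> H" if "submodule H \<Lambda> M" "S \<subseteq> H" for S H using that by (auto simp: sp_def)
  let ?P = "\<lambda>S. finite S \<and> S \<subseteq> carrier M"
  obtain S where S: "?P S" "\<And>T. ?P T \<Longrightarrow> mlen \<Lambda> (M\<lparr>carrier := sp T\<rparr>) \<le> mlen \<Lambda> (M\<lparr>carrier := sp S\<rparr>)"
    using ex_has_greatest_nat[of ?P "{}" "\<lambda>S. mlen \<Lambda> (M\<lparr>carrier := sp S\<rparr>)" "Suc (mlen \<Lambda> M)"]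
      mlen_sub_le[OF M _ fl] sp by (auto simp: less_Suc_eq_le)
  have "x \<in> sp S" if x: "x \<in> carrier M" for x
  proof (rule ccontr)
    assume "x \<notin> sp S"
    moreover have P: "?P (insert x S)" using S x by simp
    ultimately have "sp S \<subset> sp (insert x S)"
      using sp_le[of "sp (insert x S)" S] sp[of "insert x S"] by auto
    then show False
      using mlen_sub_strict_mono[OF M sp(1) sp(1) fl, of S "insert x S"] S(1) S(2)[OF P] P by simp
  qed
  then have "H = carrier M" if "submodule H \<Lambda> M" "S \<subseteq> H" for H
    using sp_le[OF that] that by (auto simp: submodule_iff)
  then show ?thesis using S by (auto simp: finitely_generated_def)
qed

section \<open>Finite length over a finite-dimensional algebra\<close>

context finite_dimensional_algebra
begin

text \<open>Through the multiples of one by scalars of \<open>K\<close>, \<open>M\<close> becomes a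
  vector space, spanned by the products of finitely many generators of \<open>\<Lambda>\<close> and
  of \<open>M\<close>. Chains of subspaces are bounded by induction on a spanning set, and every
  submodule is a subspace.\<close>

lemma finitely_generated_imp_finite_length:
  assumes M: "right_module \<Lambda> M" and fg: "finitely_generated \<Lambda> M"
  shows "finite_length \<Lambda> M"
proof -
  interpret M: right_module \<Lambda> M by fact
  define sc where "sc c x = (c \<odot>\<^bsub>\<Lambda>\<^esub> \<one>\<^bsub>\<Lambda>\<^esub>) \<odot>\<^bsub>M\<^esub> x" for c x
  have sc_cl: "sc c x \<in> carrier M" if "c \<in> carrier K" "x \<in> carrier M" for c x
    using that by (simp add: sc_def M.smult_closed)
  have sc_add: "sc c (x \<oplus>\<^bsub>M\<^esub> y) = sc c x \<oplus>\<^bsub>M\<^esub> sc c y"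
    if "c \<in> carrier K" "x \<in> carrier M" "y \<in> carrier M" for c x y
    using that by (simp add: sc_def M.smult_add_module)
  have sc_add': "sc (c \<oplus>\<^bsub>K\<^esub> d) x = sc c x \<oplus>\<^bsub>M\<^esub> sc d x"
    if "c \<in> carrier K" "d \<in> carrier K" "x \<in> carrier M" for c d x
    using that by (simp add: sc_def M.smult_add_ring smult_l_distr)
  have sc_mult: "sc c (sc d x) = sc (c \<otimes>\<^bsub>K\<^esub> d) x"
    if "c \<in> carrier K" "d \<in> carrier K" "x \<in> carrier M" for c d x
  proof -
    \<comment> \<open>A right action turns \<open>sc c (sc d x)\<close> into the action of a product
      in the order d, c; commutativity of \<open>K\<close> restores the order.\<close>
    have "(d \<odot>\<^bsub>\<Lambda>\<^esub> \<one>\<^bsub>\<Lambda>\<^esub>) \<otimes>\<^bsub>\<Lambda>\<^esub> (c \<odot>\<^bsub>\<Lambda>\<^esub> \<one>\<^bsub>\<Lambda>\<^esub>) = (c \<otimes>\<^bsub>K\<^esub> d) \<odot>\<^bsub>\<Lambda>\<^esub> \<one>\<^bsub>\<Lambda>\<^esub>"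
      using that by (simp add: smult_mult_left smult_mult_right smult_assoc1 K.m_comm)
    then show ?thesis using that by (simp add: sc_def flip: M.smult_mult)
  qed
  have sc_one: "sc \<one>\<^bsub>K\<^esub> x = x" if "x \<in> carrier M" for x
    using that by (simp add: sc_def M.smult_one)
  have sc_mult_smult: "(c \<odot>\<^bsub>\<Lambda>\<^esub> a) \<odot>\<^bsub>M\<^esub> x = sc c (a \<odot>\<^bsub>M\<^esub> x)"
    if "c \<in> carrier K" "a \<in> carrier \<Lambda>" "x \<in> carrier M" for c a x
    using that by (simp add: sc_def smult_mult_right flip: M.smult_mult)
  define ksub where "ksub H \<longleftrightarrow> H \<subseteq> carrier M \<and> \<zero>\<^bsub>M\<^esub> \<in> H \<and> (\<forall>x\<in>H. \<forall>y\<in>H. x \<oplus>\<^bsub>M\<^esub> y \<in> H) \<and>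
    (\<forall>c\<in>carrier K. \<forall>x\<in>H. sc c x \<in> H)" for H
  have ksub_minus: "x \<ominus>\<^bsub>M\<^esub> y \<in> H" if H: "ksub H" "x \<in> H" "y \<in> H" for H x y
  proof -
    have y: "y \<in> carrier M" using H by (auto simp: ksub_def)
    have "sc (\<ominus>\<^bsub>K\<^esub> \<one>\<^bsub>K\<^esub>) y \<oplus>\<^bsub>M\<^esub> sc \<one>\<^bsub>K\<^esub> y = \<zero>\<^bsub>M\<^esub>"
      using y sc_add'[of "\<ominus>\<^bsub>K\<^esub> \<one>\<^bsub>K\<^esub>" "\<one>\<^bsub>K\<^esub>" y] by (simp add: K.l_neg sc_def M.smult_zero_ring)
    then have "\<ominus>\<^bsub>M\<^esub> y = sc (\<ominus>\<^bsub>K\<^esub> \<one>\<^bsub>K\<^esub>) y"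
      using y sc_one sc_cl M.M.minus_equality[of "sc (\<ominus>\<^bsub>K\<^esub> \<one>\<^bsub>K\<^esub>) y" y] by simp
    then show ?thesis using H by (simp add: ksub_def a_minus_def)
  qed
  \<comment> \<open>Adjoining a vector to a \<open>K\<close>-subspace at most doubles the bound on the size of chains of subspaces.\<close>
  define bd where "bd U n \<longleftrightarrow> ksub U \<and> (\<forall>C. (\<forall>S\<in>C. ksub S \<and> S \<subseteq> U) \<and> (\<forall>S\<in>C. \<forall>T\<in>C. S \<subseteq> T \<or> T \<subseteq> S)
    \<longrightarrow> finite C \<and> card C \<le> (n::nat))" for U n
  have step: "\<exists>U' n'. bd U' n' \<and> insert v U \<subseteq> U'" if U: "bd U n" and v: "v \<in> carrier M" for U n v
  proof -
    define U' where "U' = {u \<oplus>\<^bsub>M\<^esub> sc c v |u c. u \<in> U \<and> c \<in> carrier K}"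
    have kU: "ksub U" using U by (simp add: bd_def)
    then have Uc: "\<And>u. u \<in> U \<Longrightarrow> u \<in> carrier M" by (auto simp: ksub_def)
    have sc0: "sc \<zero>\<^bsub>K\<^esub> v = \<zero>\<^bsub>M\<^esub>" using v by (simp add: sc_def M.smult_zero_ring)
    have "u \<in> U'" if "u \<in> U" for u
      unfolding U'_def using that by (intro CollectI exI[of _ u] exI[of _ "\<zero>\<^bsub>K\<^esub>"]) (simp add: sc0 Uc)
    moreover have "v \<in> U'"
      unfolding U'_def using v kU
      by (intro CollectI exI[of _ "\<zero>\<^bsub>M\<^esub>"] exI[of _ "\<one>\<^bsub>K\<^esub>"]) (simp add: sc_one ksub_def)
    ultimately have sub: "insert v U \<subseteq> U'" by auto
    have kU': "ksub U'"
      unfolding ksub_def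
    proof (intro conjI ballI)
      show "U' \<subseteq> carrier M" using Uc v sc_cl by (auto simp: U'_def)
      show "\<zero>\<^bsub>M\<^esub> \<in> U'" using sub kU by (auto simp: ksub_def)
    next
      fix x y assume "x \<in> U'" "y \<in> U'"
      then obtain u c u' c' where *: "u \<in> U" "c \<in> carrier K" "x = u \<oplus>\<^bsub>M\<^esub> sc c v"
        "u' \<in> U" "c' \<in> carrier K" "y = u' \<oplus>\<^bsub>M\<^esub> sc c' v" by (auto simp: U'_def)
      then have "x \<oplus>\<^bsub>M\<^esub> y = (u \<oplus>\<^bsub>M\<^esub> u') \<oplus>\<^bsub>M\<^esub> sc (c \<oplus>\<^bsub>K\<^esub> c') v"
        using v Uc by (simp add: sc_add' sc_cl M.M.a_ac)
      then show "x \<oplus>\<^bsub>M\<^esub> y \<in> U'" using * kU unfolding U'_def ksub_def by blast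
    next
      fix d x assume "d \<in> carrier K" "x \<in> U'"
      then obtain u c where *: "u \<in> U" "c \<in> carrier K" "x = u \<oplus>\<^bsub>M\<^esub> sc c v" by (auto simp: U'_def)
      then have "sc d x = sc d u \<oplus>\<^bsub>M\<^esub> sc (d \<otimes>\<^bsub>K\<^esub> c) v"
        using v Uc \<open>d \<in> carrier K\<close> by (simp add: sc_add sc_cl sc_mult)
      then show "sc d x \<in> U'" using * kU \<open>d \<in> carrier K\<close> unfolding U'_def ksub_def by blast
    qed
    \<comment> \<open>If \<open>H\<close> leaves \<open>U\<close>, it contains some u + c v with c
      nonzero, and a multiple of it matches the \<open>v\<close>-coordinate of any \<open>x\<close>
      in \<open>H'\<close>. The difference lies in \<open>H' \<inter> U\<close>, which is
      \<open>H \<inter> U\<close>, so \<open>x\<close> lies in \<open>H\<close>.\<close>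
    have key: "H' \<subseteq> H" if H: "ksub H" "ksub H'" "H \<subseteq> H'" "H' \<subseteq> U'" "\<not> H \<subseteq> U" "H \<inter> U = H' \<inter> U" for H H'
    proof
      fix x assume x: "x \<in> H'"
      obtain h where h: "h \<in> H" "h \<notin> U" using H by blast
      have "h \<in> U'" using h H by blast
      then obtain u c where c: "u \<in> U" "c \<in> carrier K" "h = u \<oplus>\<^bsub>M\<^esub> sc c v" by (auto simp: U'_def)
      have "x \<in> U'" using x H by blast
      then obtain u' c' where c': "u' \<in> U" "c' \<in> carrier K" "x = u' \<oplus>\<^bsub>M\<^esub> sc c' v" by (auto simp: U'_def)
      have "c \<noteq> \<zero>\<^bsub>K\<^esub>" using h c sc0 Uc by auto
      then have cu: "c \<in> Units K" using c by (simp add: K.field_Units)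
      define d where "d = c' \<otimes>\<^bsub>K\<^esub> inv\<^bsub>K\<^esub> c"
      have d: "d \<in> carrier K" "d \<otimes>\<^bsub>K\<^esub> c = c'" using cu c' c by (simp_all add: d_def K.m_assoc)
      have dh: "sc d h = sc d u \<oplus>\<^bsub>M\<^esub> sc c' v" using c d v Uc by (simp add: sc_add sc_cl sc_mult)
      have "x = (u' \<ominus>\<^bsub>M\<^esub> sc d u) \<oplus>\<^bsub>M\<^esub> sc d h"
      proof -
        have cl: "sc d u \<in> carrier M" "sc c' v \<in> carrier M" "u' \<in> carrier M"
          using d c c' Uc v sc_cl by auto
        then show ?thesis unfolding dh c'(3)
          by (simp add: M.M.minus_eq M.M.a_assoc M.M.r_neg1)
      qed
      moreover have uu: "u' \<ominus>\<^bsub>M\<^esub> sc d u \<in> U" using ksub_minus[OF kU c'(1)] kU c d by (auto simp: ksub_def)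
      moreover have dhH: "sc d h \<in> H" using H(1) h d by (auto simp: ksub_def)
      moreover have "(u' \<ominus>\<^bsub>M\<^esub> sc d u) \<in> H'"
      proof -
        have "x \<ominus>\<^bsub>M\<^esub> sc d h \<in> H'" using ksub_minus[OF H(2) x] dhH H(3) by blast
        moreover have "x \<ominus>\<^bsub>M\<^esub> sc d h = u' \<ominus>\<^bsub>M\<^esub> sc d u"
        proof -
          have "sc d h \<in> carrier M" "u' \<ominus>\<^bsub>M\<^esub> sc d u \<in> carrier M"
            using dhH H(1) uu Uc by (auto simp: ksub_def)
          then show ?thesis using \<open>x = (u' \<ominus>\<^bsub>M\<^esub> sc d u) \<oplus>\<^bsub>M\<^esub> sc d h\<close>
            by (simp add: M.M.minus_eq[of "_ \<oplus>\<^bsub>M\<^esub> _"] M.M.a_assoc M.M.r_neg)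
        qed
        ultimately show ?thesis by simp
      qed
      ultimately have "x = (u' \<ominus>\<^bsub>M\<^esub> sc d u) \<oplus>\<^bsub>M\<^esub> sc d h" "u' \<ominus>\<^bsub>M\<^esub> sc d u \<in> H" "sc d h \<in> H"
        using H(6) by blast+
      then show "x \<in> H" using H(1) by (simp add: ksub_def)
    qed
    have bdU: "finite C \<and> card C \<le> n" if "\<And>S. S \<in> C \<Longrightarrow> ksub S" "\<And>S. S \<in> C \<Longrightarrow> S \<subseteq> U"
      "\<And>S T. S \<in> C \<Longrightarrow> T \<in> C \<Longrightarrow> S \<subseteq> T \<or> T \<subseteq> S" for C
      using U that by (simp add: bd_def)
    have "finite C \<and> card C \<le> n + n"
      if C: "\<forall>S\<in>C. ksub S \<and> S \<subseteq> U'" "\<forall>S\<in>C. \<forall>T\<in>C. S \<subseteq> T \<or> T \<subseteq> S" for C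
    proof -
      let ?A = "{S\<in>C. S \<subseteq> U}" and ?B = "{S\<in>C. \<not> S \<subseteq> U}"
      have A: "finite ?A \<and> card ?A \<le> n" by (rule bdU) (use C in auto)
      \<comment> \<open>By \<open>key\<close>, intersection with \<open>U\<close> is injective on
        the members that are not contained in \<open>U\<close>, so these too number at most
        \<open>n\<close>; hence the doubling.\<close>
      have inj: "inj_on (\<lambda>S. S \<inter> U) ?B"
      proof (rule inj_onI)
        fix S T assume "S \<in> ?B" "T \<in> ?B" "S \<inter> U = T \<inter> U"
        then have *: "S \<in> C" "T \<in> C" "\<not> S \<subseteq> U" "\<not> T \<subseteq> U" "T \<inter> U = S \<inter> U" by auto
        then have "S \<subseteq> T \<or> T \<subseteq> S" using C(2) by blast
        then show "S = T"
        proof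
          assume "S \<subseteq> T"
          moreover have "T \<subseteq> S" using key[of S T] C(1) * \<open>S \<subseteq> T\<close> by simp
          ultimately show ?thesis by simp
        next
          assume "T \<subseteq> S"
          moreover have "S \<subseteq> T" using key[of T S] C(1) * \<open>T \<subseteq> S\<close> by simp
          ultimately show ?thesis by simp
        qed
      qed
      have "ksub (S \<inter> U)" if "S \<in> C" for S using C(1) that kU unfolding ksub_def by auto
      then have "finite ((\<lambda>S. S \<inter> U) ` ?B) \<and> card ((\<lambda>S. S \<inter> U) ` ?B) \<le> n"
        by (intro bdU) (use C(2) in blast)+
      then have B: "finite ?B \<and> card ?B \<le> n" using inj by (auto simp: card_image dest: finite_imageD)
      have "C = ?A \<union> ?B" by blast
      then show ?thesis using A B by (metis (no_types, lifting) add_mono card_Un_le finite_UnI order_trans)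
    qed
    then have "bd U' (n + n)" using kU' by (simp add: bd_def)
    then show ?thesis using sub by blast
  qed
  have fin: "\<exists>U n. bd U n \<and> F \<subseteq> U" if "finite F" "F \<subseteq> carrier M" for F
    using that
  proof (induction F)
    case empty
    \<comment> \<open>The bound 2 counts the subsets of the zero space.\<close>
    have "bd {\<zero>\<^bsub>M\<^esub>} 2" unfolding bd_def
    proof (intro conjI allI impI)
      show "ksub {\<zero>\<^bsub>M\<^esub>}" by (auto simp: ksub_def sc_def M.smult_zero_module)
      fix C assume "(\<forall>S\<in>C. ksub S \<and> S \<subseteq> {\<zero>\<^bsub>M\<^esub>}) \<and> (\<forall>S\<in>C. \<forall>T\<in>C. S \<subseteq> T \<or> T \<subseteq> S)"
      then have "C \<subseteq> {{}, {\<zero>\<^bsub>M\<^esub>}}" by blast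
      then show "finite C" "card C \<le> 2" using card_mono[of "{{}, {\<zero>\<^bsub>M\<^esub>}}" C]
        by (auto intro: finite_subset order_trans[OF _ card_insert_le_m1])
    qed
    then show ?case by blast
  next
    case (insert v F)
    then obtain U n where "bd U n" "F \<subseteq> U" by auto
    then show ?case using step[of U n v] insert.prems by blast
  qed
  obtain E where E: "finite E" "E \<subseteq> carrier \<Lambda>" "\<And>H. submodule H K \<Lambda> \<Longrightarrow> E \<subseteq> H \<Longrightarrow> H = carrier \<Lambda>"
    using finite_dimensional by blast
  obtain S where S: "finite S" "S \<subseteq> carrier M" "\<And>H. submodule H \<Lambda> M \<Longrightarrow> S \<subseteq> H \<Longrightarrow> H = carrier M"
    using fg by (auto simp: finitely_generated_def)
  define F where "F = (\<lambda>(e, s). e \<odot>\<^bsub>M\<^esub> s) ` (E \<times> S)"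
  have "finite F" "F \<subseteq> carrier M" using E(1,2) S(1,2) M.smult_closed by (auto simp: F_def subset_iff)
  then obtain U n where U: "bd U n" "F \<subseteq> U" using fin by blast
  have kU: "ksub U" using U by (simp add: bd_def)
  \<comment> \<open>The ring elements that carry \<open>s\<close> into \<open>U\<close> form a
    \<open>K\<close>-subspace of \<open>\<Lambda>\<close> containing the spanning set
    \<open>E\<close>, so they are all of \<open>\<Lambda>\<close>.\<close>
  have as: "a \<odot>\<^bsub>M\<^esub> s \<in> U" if "a \<in> carrier \<Lambda>" "s \<in> S" for a s
  proof -
    let ?H = "{a \<in> carrier \<Lambda>. a \<odot>\<^bsub>M\<^esub> s \<in> U}"
    have s: "s \<in> carrier M" using S that by auto
    have neg: "(\<ominus>\<^bsub>\<Lambda>\<^esub> a) \<odot>\<^bsub>M\<^esub> s = \<zero>\<^bsub>M\<^esub> \<ominus>\<^bsub>M\<^esub> (a \<odot>\<^bsub>M\<^esub> s)" if "a \<in> carrier \<Lambda>" for a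
    proof -
      have "(\<ominus>\<^bsub>\<Lambda>\<^esub> a) \<odot>\<^bsub>M\<^esub> s \<oplus>\<^bsub>M\<^esub> a \<odot>\<^bsub>M\<^esub> s = \<zero>\<^bsub>M\<^esub>"
        using that s by (simp add: abelian_group.l_neg[OF ring.is_abelian_group[OF \<Lambda>.ring_axioms]] M.smult_zero_ring flip: M.smult_add_ring)
      then show ?thesis using that s by (simp add: M.M.minus_eq M.smult_closed M.M.minus_equality)
    qed
    have "subgroup ?H (add_monoid \<Lambda>)"
    proof (rule subgroup.intro)
      show "inv\<^bsub>add_monoid \<Lambda>\<^esub> x \<in> ?H" if "x \<in> ?H" for x
        using that neg[of x] ksub_minus[OF kU, of "\<zero>\<^bsub>M\<^esub>" "x \<odot>\<^bsub>M\<^esub> s"] kU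
        by (simp add: ksub_def flip: a_inv_def)
    qed (use s kU in \<open>auto simp: M.smult_add_ring ksub_def M.smult_zero_ring\<close>)
    then have "submodule ?H K \<Lambda>"
      using s kU by (auto simp: submodule_def submodule_axioms_def sc_mult_smult ksub_def)
    then show ?thesis using E(3)[of ?H] that U(2) E(2) unfolding F_def by blast
  qed
  \<comment> \<open>The elements whose whole orbit under \<open>\<Lambda>\<close> lies in
    \<open>U\<close> form a submodule containing the generators \<open>S\<close>, hence are all of
    \<open>M\<close>; acting with one puts the element itself into \<open>U\<close>.\<close>
  have "carrier M \<subseteq> U"
  proof -
    let ?H = "{x \<in> carrier M. \<forall>a\<in>carrier \<Lambda>. a \<odot>\<^bsub>M\<^esub> x \<in> U}"
    have "submodule ?H \<Lambda> M" unfolding M.submodule_iff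
      using kU by (auto simp: M.smult_zero_module M.smult_closed M.smult_add_module ksub_def simp flip: M.smult_mult)
    then have "?H = carrier M" using S(2) as by (intro S(3)) auto
    then show ?thesis using M.smult_one by force
  qed
  moreover have "ksub H" if "submodule H \<Lambda> M" for H
    using that unfolding M.submodule_iff by (auto simp: ksub_def sc_def)
  ultimately have "finite C \<and> card C \<le> n" if "submodule_chain \<Lambda> M C" for C
    using that U(1) unfolding bd_def submodule_chain_def by (meson M.submodule_iff subset_trans)
  then show ?thesis by (auto simp: finite_length_def)
qed

end

section \<open>Torsion classes\<close>

definition hom_vanishes ::
    "('a, 'c) ring_scheme \<Rightarrow> ('a, 'm) module \<Rightarrow> ('a, 'n) module \<Rightarrow> bool" where
  "hom_vanishes \<Lambda> X Y \<longleftrightarrow> (\<forall>f\<in>rmod_hom \<Lambda> X Y. \<forall>x\<in>carrier X. f x = \<zero>\<^bsub>Y\<^esub>)"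

definition nonzero :: "('a, 'm) module \<Rightarrow> bool" where
  "nonzero X \<longleftrightarrow> carrier X \<noteq> {\<zero>\<^bsub>X\<^esub>}"

lemma hom_vanishesD:
  "hom_vanishes \<Lambda> X Y \<Longrightarrow> f \<in> rmod_hom \<Lambda> X Y \<Longrightarrow> x \<in> carrier X \<Longrightarrow> f x = \<zero>\<^bsub>Y\<^esub>"
  by (simp add: hom_vanishes_def)

lemma hom_orthogonal_iff:
  "Y \<in> hom_orthogonal \<Lambda> \<T> \<longleftrightarrow> Y \<in> fg_modules \<Lambda> \<and> (\<forall>X\<in>\<T>. hom_vanishes \<Lambda> X Y)"
  by (auto simp: hom_orthogonal_def hom_vanishes_def)

lemma hom_orthogonal_antimono: "\<T>' \<subseteq> \<T> \<Longrightarrow> hom_orthogonal \<Lambda> \<T> \<subseteq> hom_orthogonal \<Lambda> \<T>'"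
  by (force simp: hom_orthogonal_iff)

lemma hom_vanishes_self:
  assumes "right_module \<Lambda> X" "hom_vanishes \<Lambda> X X"
  shows "\<not> nonzero X"
proof -
  interpret right_module \<Lambda> X by fact
  have "x = \<zero>\<^bsub>X\<^esub>" if "x \<in> carrier X" for x
    using hom_vanishesD[OF assms(2) rmod_hom_id that] .
  then show ?thesis using M.zero_closed unfolding nonzero_def by blast
qed

lemma hom_vanishes_epi:
  assumes "hom_vanishes \<Lambda> X Y" "g \<in> rmod_hom \<Lambda> X Z" "g ` carrier X = carrier Z"
  shows "hom_vanishes \<Lambda> Z Y"
  unfolding hom_vanishes_def
proof (intro ballI)
  fix f z assume "f \<in> rmod_hom \<Lambda> Z Y" "z \<in> carrier Z"
  then obtain x where "x \<in> carrier X" "z = g x" using assms(3) by blast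
  then show "f z = \<zero>\<^bsub>Y\<^esub>"
    using hom_vanishesD[OF assms(1) rmod_hom_comp[OF assms(2) \<open>f \<in> _\<close>]] by simp
qed

lemma hom_vanishes_mono:
  assumes Y: "right_module \<Lambda> Y" and Z: "right_module \<Lambda> Z"
    and v: "hom_vanishes \<Lambda> X Y" and i: "i \<in> rmod_hom \<Lambda> Z Y" "inj_on i (carrier Z)"
  shows "hom_vanishes \<Lambda> X Z"
  unfolding hom_vanishes_def
proof (intro ballI)
  interpret rmod_hom_loc \<Lambda> Z Y i
    using Y Z i by (simp add: rmod_hom_loc_def rmod_hom_loc_axioms_def)
  fix f x assume f: "f \<in> rmod_hom \<Lambda> X Z" and x: "x \<in> carrier X"
  then have "i (f x) = \<zero>\<^bsub>Y\<^esub>" using hom_vanishesD[OF v rmod_hom_comp[OF f i(1)]] by simp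
  moreover have "f x \<in> carrier Z" using f x by (simp add: rmod_hom_iff)
  ultimately show "f x = \<zero>\<^bsub>Z\<^esub>" using inj_iff i(2) by simp
qed

lemma hom_vanishes_sub:
  assumes "right_module \<Lambda> Y" "submodule S \<Lambda> Y" "hom_vanishes \<Lambda> X Y"
  shows "hom_vanishes \<Lambda> X (Y\<lparr>carrier := S\<rparr>)"
proof -
  interpret right_module \<Lambda> Y by fact
  have "S \<subseteq> carrier Y" using assms(2) by (simp add: submodule_iff)
  then show ?thesis
    using assms by (intro hom_vanishes_mono[where i = "\<lambda>x. x", OF assms(1) right_module_sub])
      (auto intro: rmod_hom_restrict_source rmod_hom_id)
qed

text \<open>A map out of \<open>M\<close> that vanishes on the image of \<open>L\<close> factors
  through \<open>N\<close>.\<close>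

lemma hom_vanishes_ext_left:
  assumes M: "right_module \<Lambda> M" and N: "right_module \<Lambda> N" and Y: "right_module \<Lambda> Y"
    and g: "rmod_epi \<Lambda> M N S g" and v: "hom_vanishes \<Lambda> L Y" "hom_vanishes \<Lambda> N Y"
    and i: "i \<in> rmod_hom \<Lambda> L M" "i ` carrier L = S"
  shows "hom_vanishes \<Lambda> M Y"
  unfolding hom_vanishes_def
proof (intro ballI)
  fix f x assume f: "f \<in> rmod_hom \<Lambda> M Y" and x: "x \<in> carrier M"
  have "f y = \<zero>\<^bsub>Y\<^esub>" if "y \<in> S" for y
    using that hom_vanishesD[OF v(1) rmod_hom_comp[OF i(1) f]] i(2) by auto
  from rmod_hom_factor[OF M N Y g f this] obtain k where
    k: "k \<in> rmod_hom \<Lambda> N Y" "\<And>x. x \<in> carrier M \<Longrightarrow> k (g x) = f x" by blast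
  have "g x \<in> carrier N" using g x by (auto simp: rmod_epi_def)
  then show "f x = \<zero>\<^bsub>Y\<^esub>" using hom_vanishesD[OF v(2) k(1)] k(2) x by metis
qed

section \<open>Torsion pairs and the criterion for minimal inclusions\<close>

locale finite_length_ring = \<Lambda>: ring \<Lambda> for \<Lambda> :: "('a, 'c) ring_scheme" +
  assumes fg_finite_length: "M \<in> fg_modules \<Lambda> \<Longrightarrow> finite_length \<Lambda> M"
begin

abbreviation perp :: "'a rmod set \<Rightarrow> 'a rmod set" where
  "perp \<equiv> hom_orthogonal \<Lambda>"

lemma fg_right_module: "M \<in> fg_modules \<Lambda> \<Longrightarrow> right_module \<Lambda> M"
  by (simp add: fg_modules_def)

text \<open>A submodule inherits finite length and is therefore finitely generated; this keeps
  \<open>fg_modules \<Lambda>\<close> closed under submodules.\<close>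

lemma fg_sub: "M \<in> fg_modules \<Lambda> \<Longrightarrow> submodule S \<Lambda> M \<Longrightarrow> M\<lparr>carrier := S\<rparr> \<in> fg_modules \<Lambda>"
  using fg_finite_length unfolding fg_modules_def
  by (simp add: right_module.right_module_sub finite_length_sub finite_length_imp_finitely_generated)

lemma fg_quotient:
  assumes "M \<in> fg_modules \<Lambda>" "submodule S \<Lambda> M"
  obtains N g where "N \<in> fg_modules \<Lambda>" "rmod_epi \<Lambda> M N S g"
proof -
  obtain N :: "'a rmod" and g where "right_module \<Lambda> N" "rmod_epi \<Lambda> M N S g"
    using quotient_exists[OF fg_right_module[OF assms(1)] assms(2)] .
  moreover from this have "finitely_generated \<Lambda> N"
    using finitely_generated_epi[of \<Lambda> M N g] assms(1) by (simp add: fg_modules_def rmod_epi_def)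
  ultimately show thesis using that by (simp add: fg_modules_def)
qed

lemma hom_loc:
  "M \<in> fg_modules \<Lambda> \<Longrightarrow> N \<in> fg_modules \<Lambda> \<Longrightarrow> f \<in> rmod_hom \<Lambda> M N \<Longrightarrow> rmod_hom_loc \<Lambda> M N f"
  by (simp add: fg_modules_def rmod_hom_loc_def rmod_hom_loc_axioms_def)

lemma
  assumes "torsion_class \<Lambda> \<T>"
  shows torsion_class_zero_modules: "zero_modules \<Lambda> \<subseteq> \<T>"
    and torsion_class_subset: "\<T> \<subseteq> fg_modules \<Lambda>"
  using assms unfolding torsion_class_def by - (elim conjE, assumption)+

lemma torsion_class_fg: "torsion_class \<Lambda> \<T> \<Longrightarrow> M \<in> \<T> \<Longrightarrow> M \<in> fg_modules \<Lambda>"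
  using torsion_class_subset by blast

lemma torsion_class_short_exact:
  "torsion_class \<Lambda> \<T> \<Longrightarrow> short_exact \<Lambda> L M N f g \<Longrightarrow> L \<in> \<T> \<Longrightarrow> N \<in> \<T> \<Longrightarrow> M \<in> fg_modules \<Lambda> \<Longrightarrow> M \<in> \<T>"
  unfolding torsion_class_def by (elim conjE) blast

lemma torsion_class_epi:
  "torsion_class \<Lambda> \<T> \<Longrightarrow> M \<in> \<T> \<Longrightarrow> N \<in> fg_modules \<Lambda> \<Longrightarrow> g \<in> rmod_hom \<Lambda> M N \<Longrightarrow>
    g ` carrier M = carrier N \<Longrightarrow> N \<in> \<T>"
  unfolding torsion_class_def by blast

lemma torsion_class_image:
  assumes "torsion_class \<Lambda> \<T>" "X \<in> \<T>" "M \<in> fg_modules \<Lambda>" "f \<in> rmod_hom \<Lambda> X M"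
  shows "submodule (f ` carrier X) \<Lambda> M" "M\<lparr>carrier := f ` carrier X\<rparr> \<in> \<T>"
proof -
  interpret rmod_hom_loc \<Lambda> X M f by (rule hom_loc[OF torsion_class_fg[OF assms(1,2)] assms(3,4)])
  show s: "submodule (f ` carrier X) \<Lambda> M" by (rule image_submodule[OF M.carrier_submodule])
  have "f \<in> rmod_hom \<Lambda> X (M\<lparr>carrier := f ` carrier X\<rparr>)"
    using assms(4) by (auto simp: rmod_hom_iff)
  then show "M\<lparr>carrier := f ` carrier X\<rparr> \<in> \<T>"
    by (intro torsion_class_epi[OF assms(1,2) fg_sub[OF assms(3) s]]) auto
qed

lemma torsion_class_ext:
  assumes "torsion_class \<Lambda> \<T>" "M \<in> fg_modules \<Lambda>" "rmod_epi \<Lambda> M N S g"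
    "M\<lparr>carrier := S\<rparr> \<in> \<T>" "N \<in> \<T>"
  shows "M \<in> \<T>"
proof -
  have "S \<subseteq> carrier M" using assms(3) by (auto simp: rmod_epi_def)
  then have "short_exact \<Lambda> (M\<lparr>carrier := S\<rparr>) M N (\<lambda>x. x) g"
    using assms(3) by (auto simp: short_exact_def rmod_epi_def a_kernel_def'
      intro: rmod_hom_restrict_source rmod_hom_id)
  then show ?thesis by (rule torsion_class_short_exact[OF assms(1) _ assms(4,5,2)])
qed

lemma torsion_class_zero:
  "torsion_class \<Lambda> \<T> \<Longrightarrow> M \<in> fg_modules \<Lambda> \<Longrightarrow> \<not> nonzero M \<Longrightarrow> M \<in> \<T>"
  using torsion_class_zero_modules unfolding zero_modules_def nonzero_def by blast

lemma perp_fg: "M \<in> perp \<T> \<Longrightarrow> M \<in> fg_modules \<Lambda>"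
  by (simp add: hom_orthogonal_iff)

lemma perp_sub: "M \<in> perp \<T> \<Longrightarrow> submodule S \<Lambda> M \<Longrightarrow> M\<lparr>carrier := S\<rparr> \<in> perp \<T>"
  unfolding hom_orthogonal_iff using fg_sub hom_vanishes_sub[OF fg_right_module] by metis

text \<open>A map from a module of \<open>\<T>\<close> to \<open>M\<close> dies in \<open>N\<close>,
  hence lands in \<open>S\<close>, where it is zero as well.\<close>

lemma perp_ext:
  assumes M: "M \<in> fg_modules \<Lambda>" and g: "rmod_epi \<Lambda> M N S g"
    and S: "M\<lparr>carrier := S\<rparr> \<in> perp \<T>" and N: "N \<in> perp \<T>"
  shows "M \<in> perp \<T>"
  unfolding hom_orthogonal_iff hom_vanishes_def
proof (intro conjI ballI M)
  fix X f x assume X: "X \<in> \<T>" and f: "f \<in> rmod_hom \<Lambda> X M" and x: "x \<in> carrier X"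
  have g': "g \<in> rmod_hom \<Lambda> M N" using g by (simp add: rmod_epi_def)
  have v: "hom_vanishes \<Lambda> X N" "hom_vanishes \<Lambda> X (M\<lparr>carrier := S\<rparr>)"
    using N S X by (simp_all add: hom_orthogonal_iff)
  have "f y \<in> S" if y: "y \<in> carrier X" for y
  proof -
    have "g (f y) = \<zero>\<^bsub>N\<^esub>" by (rule hom_vanishesD[OF v(1) rmod_hom_comp[OF f g'] y])
    moreover have "f y \<in> carrier M" using f y by (simp add: rmod_hom_iff)
    ultimately show ?thesis using g by (auto simp: rmod_epi_def)
  qed
  then have "f \<in> rmod_hom \<Lambda> X (M\<lparr>carrier := S\<rparr>)" using f by (auto simp: rmod_hom_iff)
  then show "f x = \<zero>\<^bsub>M\<^esub>"
    using hom_vanishesD[OF v(2) _ x] by simp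
qed

lemma torsion_perp_zero: "M \<in> \<T> \<Longrightarrow> M \<in> perp \<T> \<Longrightarrow> \<not> nonzero M"
  using hom_vanishes_self[OF fg_right_module, of M] unfolding hom_orthogonal_iff by simp

text \<open>Modules without nonzero maps to \<open>Y\<close> are closed under quotients and
  extensions. This supplies both the torsion class against which minimality is tested and the new
  middle term of a square.\<close>

lemma torsion_class_left_perp:
  assumes T: "torsion_class \<Lambda> \<T>" and Y: "Y \<in> fg_modules \<Lambda>"
  shows "torsion_class \<Lambda> {X \<in> \<T>. hom_vanishes \<Lambda> X Y}" (is "torsion_class \<Lambda> ?U")
  unfolding torsion_class_def
proof (intro conjI ballI allI impI)
  show "zero_modules \<Lambda> \<subseteq> ?U"
  proof
    fix Z assume Z: "Z \<in> zero_modules \<Lambda>"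
    then have "Z \<in> \<T>" using torsion_class_zero_modules[OF T] by blast
    moreover have "hom_vanishes \<Lambda> Z Y"
      unfolding hom_vanishes_def
    proof (intro ballI)
      fix f x assume f: "f \<in> rmod_hom \<Lambda> Z Y" and x: "x \<in> carrier Z"
      have "Z \<in> fg_modules \<Lambda>" using Z by (simp add: zero_modules_def)
      then interpret rmod_hom_loc \<Lambda> Z Y f by (rule hom_loc[OF _ Y f])
      show "f x = \<zero>\<^bsub>Y\<^esub>" using x Z zero by (simp add: zero_modules_def)
    qed
    ultimately show "Z \<in> ?U" by simp
  qed
  show "?U \<subseteq> fg_modules \<Lambda>" using torsion_class_subset[OF T] by blast
next
  fix M N g assume "M \<in> ?U" "N \<in> fg_modules \<Lambda>" "g \<in> rmod_hom \<Lambda> M N" "g ` carrier M = carrier N"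
  then show "N \<in> ?U" using torsion_class_epi[OF T, of M N g] hom_vanishes_epi[of \<Lambda> M Y g N] by simp
next
  fix L N M f g assume *: "L \<in> ?U" "N \<in> ?U" "M \<in> fg_modules \<Lambda>" "short_exact \<Lambda> L M N f g"
  then have "M \<in> \<T>" using torsion_class_short_exact[OF T *(4)] by simp
  moreover have "hom_vanishes \<Lambda> M Y"
  proof (rule hom_vanishes_ext_left)
    show "right_module \<Lambda> M" "right_module \<Lambda> N" "right_module \<Lambda> Y"
      using * Y torsion_class_fg[OF T] fg_right_module by simp_all
    show "rmod_epi \<Lambda> M N (f ` carrier L) g" "f \<in> rmod_hom \<Lambda> L M"
      using * by (auto simp: short_exact_def rmod_epi_def a_kernel_def')
    show "hom_vanishes \<Lambda> L Y" "hom_vanishes \<Lambda> N Y" using * by auto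
  qed simp
  ultimately show "M \<in> ?U" by simp
qed

lemma rmod_epi_restrict:
  assumes "M \<in> fg_modules \<Lambda>" "N \<in> fg_modules \<Lambda>" "rmod_epi \<Lambda> M N S g" "submodule I \<Lambda> N"
  defines "P \<equiv> {x \<in> carrier M. g x \<in> I}"
  shows "submodule P \<Lambda> M" "S \<subseteq> P" "g ` P = I" "rmod_epi \<Lambda> (M\<lparr>carrier := P\<rparr>) (N\<lparr>carrier := I\<rparr>) S g"
proof -
  interpret rmod_hom_loc \<Lambda> M N g using assms hom_loc by (simp add: rmod_epi_def)
  show "submodule P \<Lambda> M" unfolding P_def by (rule vimage_submodule) fact
  have I: "I \<subseteq> carrier N" "\<zero>\<^bsub>N\<^esub> \<in> I" using assms(4) by (simp_all add: N.submodule_iff)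
  then show SP: "S \<subseteq> P" using assms(3) by (auto simp: P_def rmod_epi_def)
  show gP: "g ` P = I" using assms(3) I by (auto simp: P_def rmod_epi_def image_iff subset_iff)
  have "g \<in> rmod_hom \<Lambda> (M\<lparr>carrier := P\<rparr>) (N\<lparr>carrier := I\<rparr>)"
    using assms(3) gP by (intro rmod_hom_restrict) (auto simp: rmod_epi_def P_def)
  then show "rmod_epi \<Lambda> (M\<lparr>carrier := P\<rparr>) (N\<lparr>carrier := I\<rparr>) S g"
    using assms(3) gP SP by (auto simp: rmod_epi_def P_def)
qed

lemma mlen_sub_mono_fg:
  assumes "M \<in> fg_modules \<Lambda>" "submodule S \<Lambda> M" "submodule T \<Lambda> M" "S \<subset> T"
  shows "mlen \<Lambda> (M\<lparr>carrier := S\<rparr>) < mlen \<Lambda> (M\<lparr>carrier := T\<rparr>)"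
  using mlen_sub_strict_mono assms fg_right_module fg_finite_length by blast

lemma maximal_submodule:
  assumes M: "M \<in> fg_modules \<Lambda>" and ex: "submodule S\<^sub>0 \<Lambda> M" "Q S\<^sub>0"
  obtains S where "submodule S \<Lambda> M" "Q S" "\<And>T. submodule T \<Lambda> M \<Longrightarrow> Q T \<Longrightarrow> S \<subseteq> T \<Longrightarrow> T = S"
proof -
  let ?P = "\<lambda>S. submodule S \<Lambda> M \<and> Q S" and ?l = "\<lambda>S. mlen \<Lambda> (M\<lparr>carrier := S\<rparr>)"
  have "\<forall>S. ?P S \<longrightarrow> ?l S < Suc (mlen \<Lambda> M)"
    using mlen_sub_le[OF fg_right_module[OF M] _ fg_finite_length[OF M]] by (simp add: less_Suc_eq_le)
  then obtain S where S: "?P S" "\<And>T. ?P T \<Longrightarrow> ?l T \<le> ?l S"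
    using ex_has_greatest_nat[of ?P S\<^sub>0 ?l "Suc (mlen \<Lambda> M)"] ex by auto
  show thesis
  proof (rule that[of S])
    fix T assume "submodule T \<Lambda> M" "Q T" "S \<subseteq> T"
    then show "T = S" using S mlen_sub_mono_fg[OF M, of S T] by (metis leD psubsetI)
  qed (use S in auto)
qed

text \<open>\<open>S\<close> is maximal among the submodules that lie in \<open>\<T>\<close>. The
  image of a map from \<open>\<T>\<close> to the quotient has a preimage that is an extension of
  this image by \<open>S\<close>, hence lies in \<open>\<T>\<close> and equals \<open>S\<close>; so
  the map is zero.\<close>

lemma torsion_part:
  assumes T: "torsion_class \<Lambda> \<T>" and M: "M \<in> fg_modules \<Lambda>"
  obtains S N g where "submodule S \<Lambda> M" "M\<lparr>carrier := S\<rparr> \<in> \<T>" "N \<in> perp \<T>" "rmod_epi \<Lambda> M N S g"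
proof -
  interpret M: right_module \<Lambda> M using M by (rule fg_right_module)
  have "M\<lparr>carrier := {\<zero>\<^bsub>M\<^esub>}\<rparr> \<in> \<T>"
    by (rule torsion_class_zero[OF T fg_sub[OF M M.zero_submodule]]) (simp add: nonzero_def)
  then obtain S where S: "submodule S \<Lambda> M" "M\<lparr>carrier := S\<rparr> \<in> \<T>"
    "\<And>P. submodule P \<Lambda> M \<Longrightarrow> M\<lparr>carrier := P\<rparr> \<in> \<T> \<Longrightarrow> S \<subseteq> P \<Longrightarrow> P = S"
    using maximal_submodule[OF M M.zero_submodule, of "\<lambda>S. M\<lparr>carrier := S\<rparr> \<in> \<T>"] by metis
  obtain N g where N: "N \<in> fg_modules \<Lambda>" and g: "rmod_epi \<Lambda> M N S g" using fg_quotient[OF M S(1)] .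
  have "N \<in> perp \<T>"
    unfolding hom_orthogonal_iff hom_vanishes_def
  proof (intro conjI ballI N)
    fix X f x assume X: "X \<in> \<T>" and f: "f \<in> rmod_hom \<Lambda> X N" and x: "x \<in> carrier X"
    let ?I = "f ` carrier X" let ?P = "{x \<in> carrier M. g x \<in> ?I}"
    note I = torsion_class_image[OF T X N f]
    note P = rmod_epi_restrict[OF M N g I(1)]
    have "M\<lparr>carrier := ?P\<rparr> \<in> \<T>"
      by (rule torsion_class_ext[OF T fg_sub[OF M P(1)] P(4)]) (simp_all add: S I)
    then have "?P = S" using S(3) P by blast
    then have "?I = g ` S" using P(3) by simp
    then show "f x = \<zero>\<^bsub>N\<^esub>" using g x by (auto simp: rmod_epi_def)
  qed
  then show thesis using that S g by blast
qed

text \<open>A module of \<open>\<T>\<close> outside \<open>\<T>'\<close> is divided by its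
  \<open>\<T>'\<close>-torsion part; if the quotient were zero, the module would be an extension
  inside \<open>\<T>'\<close>.\<close>

lemma exists_nonzero_between:
  assumes "torsion_class \<Lambda> \<T>" "torsion_class \<Lambda> \<T>'" "\<not> \<T> \<subseteq> \<T>'"
  obtains X where "X \<in> \<T>" "X \<in> perp \<T>'" "nonzero X"
proof -
  obtain M where M: "M \<in> \<T>" "M \<notin> \<T>'" using assms by blast
  have Mfg: "M \<in> fg_modules \<Lambda>" using M(1) torsion_class_fg assms by blast
  obtain S N g where S: "submodule S \<Lambda> M" "M\<lparr>carrier := S\<rparr> \<in> \<T>'" "N \<in> perp \<T>'" "rmod_epi \<Lambda> M N S g"
    using torsion_part[OF assms(2) Mfg] .
  have "N \<in> \<T>"
    using torsion_class_epi[OF assms(1) M(1) perp_fg[OF S(3)]] S(4) by (auto simp: rmod_epi_def)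
  moreover have "nonzero N"
  proof (rule ccontr)
    assume "\<not> nonzero N"
    then have "N \<in> \<T>'" using torsion_class_zero[OF assms(2)] S(3) perp_fg by blast
    then show False using M(2) torsion_class_ext[OF assms(2) Mfg S(4,2)] by blast
  qed
  ultimately show thesis using that S(3) by blast
qed

text \<open>The modules of \<open>\<T>\<close> without nonzero maps to \<open>Y\<close> form a
  torsion class that contains \<open>\<T>'\<close> and misses \<open>Y\<close>, so minimality
  identifies it with \<open>\<T>'\<close>.\<close>

lemma minimal_inclusion_left:
  assumes min: "minimal_inclusion \<Lambda> \<T> \<T>'" and Y: "Y \<in> \<T>" "Y \<in> perp \<T>'" "nonzero Y"
    and X: "X \<in> \<T>" "hom_vanishes \<Lambda> X Y"
  shows "X \<in> \<T>'"
proof -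
  let ?U = "{X \<in> \<T>. hom_vanishes \<Lambda> X Y}"
  have Yfg: "Y \<in> fg_modules \<Lambda>" using Y(2) by (rule perp_fg)
  have "torsion_class \<Lambda> ?U" using min torsion_class_left_perp[OF _ Yfg] by (simp add: minimal_inclusion_def)
  moreover have "\<T>' \<subseteq> ?U" using min Y(2) by (auto simp: minimal_inclusion_def hom_orthogonal_iff)
  moreover have "?U \<subset> \<T>" using Y hom_vanishes_self[OF fg_right_module[OF Yfg]] by blast
  ultimately have "?U = \<T>'" using min unfolding minimal_inclusion_def by (metis (no_types, lifting) psubsetI)
  then show ?thesis using X by blast
qed

text \<open>A torsion class \<open>\<U>\<close> strictly between would give a nonzero
  \<open>X\<close> in \<open>\<U>\<close> and a nonzero \<open>Y\<close> orthogonal to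
  \<open>\<U>\<close>, both in \<open>\<T> \<inter> perp \<T>'\<close>, with no nonzero map from
  \<open>X\<close> to \<open>Y\<close>.\<close>

lemma minimal_inclusionI:
  assumes T: "torsion_class \<Lambda> \<T>" and T': "torsion_class \<Lambda> \<T>'" and sub: "\<T>' \<subset> \<T>"
    and conn: "\<And>X Y. X \<in> \<T> \<inter> perp \<T>' \<Longrightarrow> Y \<in> \<T> \<inter> perp \<T>' \<Longrightarrow> nonzero X \<Longrightarrow> nonzero Y \<Longrightarrow>
      \<not> hom_vanishes \<Lambda> X Y"
  shows "minimal_inclusion \<Lambda> \<T> \<T>'"
  unfolding minimal_inclusion_def
proof (intro conjI T T' sub notI)
  assume "\<exists>\<U>. torsion_class \<Lambda> \<U> \<and> \<T>' \<subset> \<U> \<and> \<U> \<subset> \<T>"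
  then obtain \<U> where U: "torsion_class \<Lambda> \<U>" "\<T>' \<subset> \<U>" "\<U> \<subset> \<T>" by blast
  obtain X where X: "X \<in> \<U>" "X \<in> perp \<T>'" "nonzero X"
    using exists_nonzero_between[OF U(1) T'] U(2) by blast
  obtain Y where Y: "Y \<in> \<T>" "Y \<in> perp \<U>" "nonzero Y"
    using exists_nonzero_between[OF T U(1)] U(3) by blast
  have "Y \<in> perp \<T>'" using Y(2) U(2) hom_orthogonal_antimono[of \<T>' \<U>] by blast
  then show False using conn[of X Y] X Y U(3) by (auto simp: hom_orthogonal_iff)
qed

end

section \<open>Existence of brick labels\<close>

lemma rmod_hom_diff:
  assumes M: "right_module \<Lambda> M" and N: "right_module \<Lambda> N"
    and f: "f \<in> rmod_hom \<Lambda> M N" and g: "g \<in> rmod_hom \<Lambda> M N"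
  shows "(\<lambda>x. f x \<ominus>\<^bsub>N\<^esub> g x) \<in> rmod_hom \<Lambda> M N"
proof -
  interpret f: rmod_hom_loc \<Lambda> M N f
    using M N f by (simp add: rmod_hom_loc_def rmod_hom_loc_axioms_def)
  interpret g: rmod_hom_loc \<Lambda> M N g
    using M N g by (simp add: rmod_hom_loc_def rmod_hom_loc_axioms_def)
  show ?thesis unfolding rmod_hom_iff
  proof (intro conjI ballI)
    fix x y assume "x \<in> carrier M" "y \<in> carrier M"
    then show "f (x \<oplus>\<^bsub>M\<^esub> y) \<ominus>\<^bsub>N\<^esub> g (x \<oplus>\<^bsub>M\<^esub> y) = f x \<ominus>\<^bsub>N\<^esub> g x \<oplus>\<^bsub>N\<^esub> (f y \<ominus>\<^bsub>N\<^esub> g y)"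
      by (simp add: f.closed g.closed f.add g.add f.N.M.minus_eq f.N.M.minus_add f.N.M.a_ac)
  qed (simp_all add: f.closed g.closed f.smult g.smult f.N.smult_minus)
qed

lemma rmod_hom_inverse:
  assumes M: "right_module \<Lambda> M" and f: "f \<in> rmod_hom \<Lambda> M N" "inj_on f (carrier M)"
  shows "inv_into (carrier M) f \<in> rmod_hom \<Lambda> (N\<lparr>carrier := f ` carrier M\<rparr>) M"
proof -
  interpret right_module \<Lambda> M by fact
  show ?thesis
    using f unfolding rmod_hom_iff
    by (auto simp: inv_into_f_f smult_closed simp del: f_inv_into_f
        intro!: inv_into_f_eq[OF f(2)])
qed

text \<open>The \<open>S\<close>-component of an element is well defined because two decompositions
  differ by an element of \<open>S \<inter> T\<close>. The projection presents \<open>S\<close> as a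
  quotient of \<open>M\<close> by \<open>T\<close>, so that closure under quotients and extensions
  applies to direct sums.\<close>

lemma direct_sum_projection:
  assumes M: "right_module \<Lambda> M" and ds: "internal_direct_sum \<Lambda> M S T"
  obtains p where "rmod_epi \<Lambda> M (M\<lparr>carrier := S\<rparr>) T p" "\<And>s. s \<in> S \<Longrightarrow> p s = s"
proof -
  interpret right_module \<Lambda> M by fact
  have S: "submodule S \<Lambda> M" and T: "submodule T \<Lambda> M" and 0: "S \<inter> T = {\<zero>\<^bsub>M\<^esub>}"
    and sum: "S <+>\<^bsub>M\<^esub> T = carrier M" using ds by (auto simp: internal_direct_sum_def)
  note S' = S[unfolded submodule_iff] and T' = T[unfolded submodule_iff]
  have Sc: "s \<in> carrier M" if "s \<in> S" for s using S' that by blast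
  have Tc: "t \<in> carrier M" if "t \<in> T" for t using T' that by blast
  have uniq: "s = s'" if "s \<in> S" "s' \<in> S" "t \<in> T" "t' \<in> T" "s \<oplus>\<^bsub>M\<^esub> t = s' \<oplus>\<^bsub>M\<^esub> t'" for s s' t t'
  proof -
    have "s \<ominus>\<^bsub>M\<^esub> s' = (s \<oplus>\<^bsub>M\<^esub> t) \<ominus>\<^bsub>M\<^esub> (s' \<oplus>\<^bsub>M\<^esub> t)"
      using that(1-4) by (simp add: Sc Tc M.minus_eq M.minus_add M.a_ac M.r_neg M.r_neg1 M.r_neg2)
    also have "\<dots> = t' \<ominus>\<^bsub>M\<^esub> t"
      unfolding that(5) using that(1-4)
      by (simp add: Sc Tc M.minus_eq M.minus_add M.a_comm[of s' t'] M.a_assoc M.r_neg1 M.r_neg2)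
    finally have "s \<ominus>\<^bsub>M\<^esub> s' \<in> S \<inter> T" using submodule_minus[OF S that(1,2)] submodule_minus[OF T that(4,3)] by simp
    then show ?thesis using 0 that Sc minus_eq_zero_iff by auto
  qed
  define p where "p x = (THE s. s \<in> S \<and> (\<exists>t\<in>T. x = s \<oplus>\<^bsub>M\<^esub> t))" for x
  have p: "p (s \<oplus>\<^bsub>M\<^esub> t) = s" if "s \<in> S" "t \<in> T" for s t
    unfolding p_def using that uniq by (intro the_equality) auto
  have dec: "\<exists>s\<in>S. \<exists>t\<in>T. x = s \<oplus>\<^bsub>M\<^esub> t" if "x \<in> carrier M" for x
    using that sum submodule_sum_iff by blast
  have hom: "p \<in> rmod_hom \<Lambda> M (M\<lparr>carrier := S\<rparr>)"
    unfolding rmod_hom_iff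
  proof (intro conjI ballI)
    fix x assume "x \<in> carrier M"
    then obtain s t where "s \<in> S" "t \<in> T" "x = s \<oplus>\<^bsub>M\<^esub> t" using dec by blast
    then show "p x \<in> carrier (M\<lparr>carrier := S\<rparr>)" by (simp add: p)
  next
    fix x y assume "x \<in> carrier M" "y \<in> carrier M"
    then obtain s t s' t' where *: "s \<in> S" "t \<in> T" "x = s \<oplus>\<^bsub>M\<^esub> t" "s' \<in> S" "t' \<in> T" "y = s' \<oplus>\<^bsub>M\<^esub> t'"
      using dec by meson
    then have "x \<oplus>\<^bsub>M\<^esub> y = (s \<oplus>\<^bsub>M\<^esub> s') \<oplus>\<^bsub>M\<^esub> (t \<oplus>\<^bsub>M\<^esub> t')" by (simp add: Sc Tc M.a_ac)
    then show "p (x \<oplus>\<^bsub>M\<^esub> y) = p x \<oplus>\<^bsub>M\<lparr>carrier := S\<rparr>\<^esub> p y"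
      using * S' T' by (simp add: p)
  next
    fix a x assume a: "a \<in> carrier \<Lambda>" and "x \<in> carrier M"
    then obtain s t where *: "s \<in> S" "t \<in> T" "x = s \<oplus>\<^bsub>M\<^esub> t" using dec by blast
    then have "a \<odot>\<^bsub>M\<^esub> x = a \<odot>\<^bsub>M\<^esub> s \<oplus>\<^bsub>M\<^esub> a \<odot>\<^bsub>M\<^esub> t" using a by (simp add: Sc Tc smult_add_module)
    then show "p (a \<odot>\<^bsub>M\<^esub> x) = a \<odot>\<^bsub>M\<lparr>carrier := S\<rparr>\<^esub> p x"
      using * S' T' a by (simp add: p)
  qed
  have pS: "p s = s" if "s \<in> S" for s
    using p[OF that, of "\<zero>\<^bsub>M\<^esub>"] T' that by (simp add: Sc)
  have pT: "p t = \<zero>\<^bsub>M\<^esub>" if "t \<in> T" for t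
    using p[of "\<zero>\<^bsub>M\<^esub>" t] S' that by (simp add: Tc)
  have "rmod_epi \<Lambda> M (M\<lparr>carrier := S\<rparr>) T p"
    unfolding rmod_epi_def
  proof (intro conjI hom)
    show "p ` carrier M = carrier (M\<lparr>carrier := S\<rparr>)"
      using hom pS Sc by (auto simp: rmod_hom_iff image_iff) metis
    show "{x \<in> carrier M. p x = \<zero>\<^bsub>M\<lparr>carrier := S\<rparr>\<^esub>} = T"
    proof (intro Set.set_eqI iffI)
      fix x assume x: "x \<in> {x \<in> carrier M. p x = \<zero>\<^bsub>M\<lparr>carrier := S\<rparr>\<^esub>}"
      then obtain s t where *: "s \<in> S" "t \<in> T" "x = s \<oplus>\<^bsub>M\<^esub> t" using dec by blast
      then show "x \<in> T" using x p by (simp add: Tc)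
    qed (simp add: pT Tc)
  qed
  then show thesis using that pS by blast
qed

lemma internal_direct_sum_commute:
  assumes "right_module \<Lambda> M" "internal_direct_sum \<Lambda> M S T"
  shows "internal_direct_sum \<Lambda> M T S"
proof -
  interpret right_module \<Lambda> M by fact
  have S: "submodule S \<Lambda> M" and T: "submodule T \<Lambda> M" using assms by (auto simp: internal_direct_sum_def)
  have Sc: "S \<subseteq> carrier M" and Tc: "T \<subseteq> carrier M" using S T by (simp_all add: submodule_iff)
  have "S <+>\<^bsub>M\<^esub> T = T <+>\<^bsub>M\<^esub> S"
  proof (rule Set.set_eqI)
    fix x
    have "s \<oplus>\<^bsub>M\<^esub> t = t \<oplus>\<^bsub>M\<^esub> s" if "s \<in> S" "t \<in> T" for s t
      using that Sc Tc by (intro M.a_comm) auto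
    then show "x \<in> S <+>\<^bsub>M\<^esub> T \<longleftrightarrow> x \<in> T <+>\<^bsub>M\<^esub> S" unfolding submodule_sum_iff by metis
  qed
  then show ?thesis using assms(2) by (simp add: internal_direct_sum_def Int_commute)
qed

lemma right_module_power:
  assumes "right_module \<Lambda> B"
  shows "right_module \<Lambda> (power_module B n)"
proof -
  interpret right_module \<Lambda> B by fact
  have "abelian_group (power_module B n)"
  proof (rule abelian_groupI, goal_cases)
    case (6 x)
    show ?case
    proof (rule bexI)
      show "(\<lambda>i\<in>{..<n}. \<ominus>\<^bsub>B\<^esub> x i) \<in> carrier (power_module B n)"
        using 6 by (auto simp: power_module_def PiE_iff)
      show "(\<lambda>i\<in>{..<n}. \<ominus>\<^bsub>B\<^esub> x i) \<oplus>\<^bsub>power_module B n\<^esub> x = \<zero>\<^bsub>power_module B n\<^esub>"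
        using 6 by (auto simp: power_module_def PiE_iff M.l_neg fun_eq_iff)
    qed
  qed (auto simp: power_module_def PiE_iff M.a_ac fun_eq_iff extensional_def)
  then show ?thesis
    unfolding right_module_def right_module_axioms_def
    by (auto simp: \<Lambda>.ring_axioms power_module_def PiE_iff fun_eq_iff smult_closed smult_add_ring
        smult_add_module smult_mult smult_one extensional_def)
qed

section \<open>Endomorphism rings and bricks\<close>

lemma End_ring_simps [simp]:
  "carrier (End_ring \<Lambda> M) = rmod_hom \<Lambda> M M \<inter> extensional (carrier M)"
  "f \<otimes>\<^bsub>End_ring \<Lambda> M\<^esub> g = compose (carrier M) f g"
  "\<one>\<^bsub>End_ring \<Lambda> M\<^esub> = (\<lambda>x\<in>carrier M. x)"
  "\<zero>\<^bsub>End_ring \<Lambda> M\<^esub> = (\<lambda>x\<in>carrier M. \<zero>\<^bsub>M\<^esub>)"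
  "f \<oplus>\<^bsub>End_ring \<Lambda> M\<^esub> g = (\<lambda>x\<in>carrier M. f x \<oplus>\<^bsub>M\<^esub> g x)"
  by (simp_all add: End_ring_def)

lemma ring_End_ring:
  assumes "right_module \<Lambda> M"
  shows "ring (End_ring \<Lambda> M)"
proof -
  interpret right_module \<Lambda> M by fact
  have neg: "a \<odot>\<^bsub>M\<^esub> (\<ominus>\<^bsub>M\<^esub> x) = \<ominus>\<^bsub>M\<^esub> (a \<odot>\<^bsub>M\<^esub> x)" if "a \<in> carrier \<Lambda>" "x \<in> carrier M" for a x
    using smult_minus[OF that(1) M.zero_closed that(2)] that
    by (simp add: M.minus_eq smult_zero_module smult_closed)
  have ext: "f = g" if "f \<in> extensional (carrier M)" "g \<in> extensional (carrier M)"
    "\<And>x. x \<in> carrier M \<Longrightarrow> f x = g x" for f g :: "'c \<Rightarrow> 'c"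
    using that by (rule extensionalityI)
  show ?thesis
  proof (rule ringI)
    show "abelian_group (End_ring \<Lambda> M)"
    proof (rule abelian_groupI, goal_cases)
      case (1 f g)
      then show ?case by (auto simp: rmod_hom_iff M.a_ac smult_add_module smult_closed)
    next
      case 2
      then show ?case by (auto simp: rmod_hom_iff smult_zero_module smult_closed)
    next
      case (3 f g h)
      then show ?case by (auto simp: rmod_hom_iff M.a_assoc intro!: restrict_ext)
    next
      case (4 f g)
      then show ?case by (auto simp: rmod_hom_iff M.a_comm intro!: restrict_ext)
    next
      case (5 f)
      then show ?case by (intro ext) (auto simp: rmod_hom_iff)
    next
      case (6 f)
      then have f: "\<And>x. x \<in> carrier M \<Longrightarrow> f x \<in> carrier M" by (simp add: rmod_hom_iff)
      show ?case
      proof (rule bexI[of _ "\<lambda>x\<in>carrier M. \<ominus>\<^bsub>M\<^esub> f x"])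
        show "(\<lambda>x\<in>carrier M. \<ominus>\<^bsub>M\<^esub> f x) \<oplus>\<^bsub>End_ring \<Lambda> M\<^esub> f = \<zero>\<^bsub>End_ring \<Lambda> M\<^esub>"
          using f by (auto simp: M.l_neg intro!: restrict_ext)
        show "(\<lambda>x\<in>carrier M. \<ominus>\<^bsub>M\<^esub> f x) \<in> carrier (End_ring \<Lambda> M)"
          using 6 f by (auto simp: rmod_hom_iff smult_closed neg M.minus_add M.a_comm)
      qed
    qed
    show "monoid (End_ring \<Lambda> M)"
    proof (rule monoidI, goal_cases)
      case (1 f g)
      then show ?case by (auto simp: rmod_hom_iff compose_def smult_closed)
    next
      case 2
      then show ?case by (auto simp: rmod_hom_iff smult_closed)
    next
      case (3 f g h)
      then show ?case by (auto simp: rmod_hom_iff compose_def intro!: restrict_ext)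
    next
      case (4 f)
      then show ?case by (intro ext) (auto simp: rmod_hom_iff compose_def)
    next
      case (5 f)
      then show ?case by (intro ext) (auto simp: rmod_hom_iff compose_def)
    qed
  qed (auto simp: rmod_hom_iff compose_def intro!: restrict_ext)
qed

text \<open>In the style of Schur's lemma: once all nonzero endomorphisms are bijective, the
  set-theoretic inverse is linear again and provides the unit.\<close>

lemma brickI:
  assumes M: "right_module \<Lambda> M" and nz: "nonzero M"
    and bij: "\<And>f. f \<in> rmod_hom \<Lambda> M M \<Longrightarrow> \<exists>x\<in>carrier M. f x \<noteq> \<zero>\<^bsub>M\<^esub> \<Longrightarrow>
      inj_on f (carrier M) \<and> f ` carrier M = carrier M"
  shows "brick \<Lambda> M"
proof -
  interpret right_module \<Lambda> M by fact
  have "Units (End_ring \<Lambda> M) = carrier (End_ring \<Lambda> M) - {\<zero>\<^bsub>End_ring \<Lambda> M\<^esub>}"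
  proof (intro Set.set_eqI iffI)
    fix f assume f: "f \<in> Units (End_ring \<Lambda> M)"
    then obtain g where g: "g \<in> rmod_hom \<Lambda> M M" "compose (carrier M) f g = (\<lambda>x\<in>carrier M. x)"
      by (auto simp: Units_def)
    obtain x where x: "x \<in> carrier M" "x \<noteq> \<zero>\<^bsub>M\<^esub>"
      using nz M.zero_closed unfolding nonzero_def by blast
    have "f (g x) = x" using fun_cong[OF g(2), of x] x(1) by (simp add: compose_def)
    moreover have "g x \<in> carrier M" using g(1) x(1) by (simp add: rmod_hom_iff)
    ultimately have "f \<noteq> (\<lambda>x\<in>carrier M. \<zero>\<^bsub>M\<^esub>)" using x(2) by auto
    then show "f \<in> carrier (End_ring \<Lambda> M) - {\<zero>\<^bsub>End_ring \<Lambda> M\<^esub>}" using f by (simp add: Units_def)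
  next
    fix f assume "f \<in> carrier (End_ring \<Lambda> M) - {\<zero>\<^bsub>End_ring \<Lambda> M\<^esub>}"
    then have f: "f \<in> rmod_hom \<Lambda> M M" "f \<in> extensional (carrier M)" "f \<noteq> (\<lambda>x\<in>carrier M. \<zero>\<^bsub>M\<^esub>)" by auto
    have "\<exists>x\<in>carrier M. f x \<noteq> \<zero>\<^bsub>M\<^esub>"
      using f extensionalityI[of f "carrier M" "\<lambda>x\<in>carrier M. \<zero>\<^bsub>M\<^esub>"] by auto
    then have b: "inj_on f (carrier M)" "f ` carrier M = carrier M" using bij[OF f(1)] by auto
    \<comment> \<open>Elements of \<open>End_ring\<close> are \<open>undefined\<close> outside the
      carrier, so the inverse has to be cut down to it.\<close>
    let ?g = "restrict (inv_into (carrier M) f) (carrier M)"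
    have "inv_into (carrier M) f \<in> rmod_hom \<Lambda> M M"
      using rmod_hom_inverse[OF M f(1) b(1)] b(2) by simp
    then have "?g \<in> rmod_hom \<Lambda> M M" by (auto simp: rmod_hom_iff smult_closed)
    moreover have "compose (carrier M) ?g f = (\<lambda>x\<in>carrier M. x)"
      using f b(1) by (auto simp: compose_def rmod_hom_iff inv_into_f_f intro!: restrict_ext)
    moreover have "compose (carrier M) f ?g = (\<lambda>x\<in>carrier M. x)"
      using b by (auto simp: compose_def f_inv_into_f intro!: restrict_ext)
    ultimately show "f \<in> Units (End_ring \<Lambda> M)"
      using f unfolding Units_def by (auto intro!: bexI[of _ ?g])
  qed
  then show ?thesis
    using ring_End_ring[OF M] by (simp add: brick_def skew_field_def skew_field_axioms_def)
qed

section \<open>Filtered modules inside the class of two torsion classes\<close>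

context finite_length_ring
begin

lemma perp_zero: "M \<in> fg_modules \<Lambda> \<Longrightarrow> \<not> nonzero M \<Longrightarrow> M \<in> perp \<T>"
  unfolding hom_orthogonal_iff hom_vanishes_def by (auto simp: nonzero_def rmod_hom_iff)

lemma minimal_inclusion_torsion:
  assumes "minimal_inclusion \<Lambda> \<T> \<T>'"
  shows "torsion_class \<Lambda> \<T>" "torsion_class \<Lambda> \<T>'" "\<T>' \<subset> \<T>"
  using assms by (simp_all add: minimal_inclusion_def)

lemma minimal_inclusion_not_vanishes:
  assumes "minimal_inclusion \<Lambda> \<T> \<T>'" "X \<in> \<T> \<inter> perp \<T>'" "Y \<in> \<T> \<inter> perp \<T>'" "nonzero X" "nonzero Y"
  shows "\<not> hom_vanishes \<Lambda> X Y"
  using minimal_inclusion_left[OF assms(1), of Y X] torsion_perp_zero[of X \<T>'] assms by blast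

text \<open>Induction on the number \<open>k\<close> of leading coordinates that may be nonzero: the
  last of them is split off through the inclusion of \<open>B\<close> at that place, and along this
  inclusion \<open>q\<close> restricts to a map from \<open>B\<close> to \<open>N\<close>.\<close>

lemma power_module_vanishes:
  assumes B: "right_module \<Lambda> B" and q: "q \<in> rmod_hom \<Lambda> (power_module B n) N" and N: "right_module \<Lambda> N"
    and v: "hom_vanishes \<Lambda> B N" and x: "x \<in> carrier (power_module B n)"
  shows "q x = \<zero>\<^bsub>N\<^esub>"
proof -
  let ?P = "power_module B n"
  interpret B: right_module \<Lambda> B by fact
  interpret q: rmod_hom_loc \<Lambda> ?P N q
    using right_module_power[OF B] N q by (simp add: rmod_hom_loc_def rmod_hom_loc_axioms_def)
  have "q y = \<zero>\<^bsub>N\<^esub>" if "y \<in> carrier ?P" "\<And>i. k \<le> i \<Longrightarrow> i < n \<Longrightarrow> y i = \<zero>\<^bsub>B\<^esub>" "k \<le> n" for k y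
    using that
  proof (induction k arbitrary: y)
    case 0
    then have "y = \<zero>\<^bsub>?P\<^esub>"
      by (intro extensionalityI[where A = "{..<n}"]) (auto simp: power_module_def PiE_iff)
    then show ?case by (simp add: q.zero)
  next
    case (Suc k)
    define i where "i b = (\<lambda>j\<in>{..<n}. if j = k then b else \<zero>\<^bsub>B\<^esub>)" for b
    define y' where "y' = (\<lambda>j\<in>{..<n}. if j = k then \<zero>\<^bsub>B\<^esub> else y j)"
    have yc: "y j \<in> carrier B" if "j < n" for j
      using Suc.prems(1) that by (auto simp: power_module_def PiE_iff)
    have i: "i \<in> rmod_hom \<Lambda> B ?P"
      unfolding rmod_hom_iff i_def
      by (auto simp: power_module_def B.smult_zero_module fun_eq_iff)
    have y': "y' \<in> carrier ?P" using yc by (auto simp: power_module_def y'_def)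
    have k: "k < n" using Suc.prems by simp
    have "y = y' \<oplus>\<^bsub>?P\<^esub> i (y k)"
      using Suc.prems(1) yc k
      by (intro extensionalityI[where A = "{..<n}"]) (auto simp: power_module_def PiE_iff i_def y'_def)
    moreover have "i (y k) \<in> carrier ?P" using i yc[OF k] by (simp add: rmod_hom_iff)
    ultimately have "q y = q y' \<oplus>\<^bsub>N\<^esub> q (i (y k))" using q.add[OF y'] by metis
    also have "q y' = \<zero>\<^bsub>N\<^esub>"
      using Suc.prems by (intro Suc.IH y') (auto simp: y'_def)
    also have "q (i (y k)) = \<zero>\<^bsub>N\<^esub>"
      by (rule hom_vanishesD[OF v rmod_hom_comp[OF i q] yc[OF k]])
    finally show ?case by simp
  qed
  from this[OF x, of n] show ?thesis by simp
qed

text \<open>Orthogonality is tested coordinatewise, along maps from \<open>X\<close> through the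
  power of \<open>B\<close> to \<open>B\<close>. For membership in \<open>\<T>\<close>, the power of
  \<open>B\<close> projects onto \<open>X\<close> and hence onto the torsion-free quotient of
  \<open>X\<close>; as \<open>B\<close> has no nonzero map there, that quotient is zero.\<close>

lemma add_closure_subset:
  assumes T: "torsion_class \<Lambda> \<T>" and B: "B \<in> \<T>" "B \<in> perp \<T>'"
  shows "add_closure \<Lambda> B \<subseteq> \<T> \<inter> perp \<T>'"
proof
  fix X assume "X \<in> add_closure \<Lambda> B"
  then obtain n S S' \<phi> where X: "X \<in> fg_modules \<Lambda>"
    and ds: "internal_direct_sum \<Lambda> (power_module B n) S S'"
    and \<phi>: "\<phi> \<in> rmod_hom \<Lambda> X ((power_module B n)\<lparr>carrier := S\<rparr>)" "inj_on \<phi> (carrier X)" "\<phi> ` carrier X = S"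
    by (auto simp: add_closure_def rmod_isomorphic_def bij_betw_def)
  let ?P = "power_module B n"
  have Bm: "right_module \<Lambda> B" by (rule fg_right_module[OF perp_fg[OF B(2)]])
  have Xm: "right_module \<Lambda> X" by (rule fg_right_module[OF X])
  interpret B: right_module \<Lambda> B by (rule Bm)
  interpret P: right_module \<Lambda> ?P by (rule right_module_power[OF Bm])
  have S: "submodule S \<Lambda> ?P" using ds by (simp add: internal_direct_sum_def)
  have SP: "S \<subseteq> carrier ?P" using S by (simp add: P.submodule_iff)
  have \<phi>P: "\<phi> \<in> rmod_hom \<Lambda> X ?P" by (rule rmod_hom_extend_target[OF \<phi>(1) SP])
  interpret \<phi>: rmod_hom_loc \<Lambda> X ?P \<phi>
    using Xm P.right_module_axioms \<phi>P by (simp add: rmod_hom_loc_def rmod_hom_loc_axioms_def)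
  have "X \<in> perp \<T>'"
    unfolding hom_orthogonal_iff hom_vanishes_def
  proof (intro conjI X ballI)
    fix V u v assume V: "V \<in> \<T>'" and u: "u \<in> rmod_hom \<Lambda> V X" and v: "v \<in> carrier V"
    have vB: "hom_vanishes \<Lambda> V B" using B(2) V by (simp add: hom_orthogonal_iff)
    have uv: "u v \<in> carrier X" using u v by (simp add: rmod_hom_iff)
    have "\<phi> (u v) = \<zero>\<^bsub>?P\<^esub>"
    proof (rule extensionalityI[where A = "{..<n}"])
      show "\<phi> (u v) \<in> extensional {..<n}" using \<phi>.closed[OF uv] by (simp add: power_module_def PiE_iff)
      fix j assume j: "j \<in> {..<n}"
      have "(\<lambda>p. p j) \<in> rmod_hom \<Lambda> ?P B" using j by (auto simp: rmod_hom_iff power_module_def)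
      from hom_vanishesD[OF vB rmod_hom_comp[OF u rmod_hom_comp[OF \<phi>P this]] v]
      show "\<phi> (u v) j = \<zero>\<^bsub>?P\<^esub> j" using j by (simp add: power_module_def)
    qed (simp add: power_module_def)
    then show "u v = \<zero>\<^bsub>X\<^esub>" using \<phi>.inj_iff \<phi>(2) uv by blast
  qed
  moreover have "X \<in> \<T>"
  proof -
    obtain J N g where J: "submodule J \<Lambda> X" "X\<lparr>carrier := J\<rparr> \<in> \<T>" "N \<in> perp \<T>" "rmod_epi \<Lambda> X N J g"
      using torsion_part[OF T X] .
    have Nm: "right_module \<Lambda> N" by (rule fg_right_module[OF perp_fg[OF J(3)]])
    have g: "g \<in> rmod_hom \<Lambda> X N" "g ` carrier X = carrier N" using J(4) by (simp_all add: rmod_epi_def)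
    obtain p where p: "rmod_epi \<Lambda> ?P (?P\<lparr>carrier := S\<rparr>) S' p" "\<And>s. s \<in> S \<Longrightarrow> p s = s"
      using direct_sum_projection[OF P.right_module_axioms ds] by blast
    have e: "inv_into (carrier X) \<phi> \<in> rmod_hom \<Lambda> (?P\<lparr>carrier := S\<rparr>) X"
      using rmod_hom_inverse[OF Xm \<phi>P \<phi>(2)] \<phi>(3) by simp
    have q: "(\<lambda>x. g (inv_into (carrier X) \<phi> (p x))) \<in> rmod_hom \<Lambda> ?P N"
      using rmod_hom_comp[OF _ rmod_hom_comp[OF e g(1)], of p] p(1) by (simp add: rmod_epi_def)
    have v: "hom_vanishes \<Lambda> B N" using J(3) B(1) by (simp add: hom_orthogonal_iff)
    have "g x = \<zero>\<^bsub>N\<^esub>" if x: "x \<in> carrier X" for x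
    proof -
      have "\<phi> x \<in> S" using \<phi>(3) x by blast
      then have "g (inv_into (carrier X) \<phi> (p (\<phi> x))) = g x" using p(2) \<phi>(2) x by simp
      then show ?thesis using power_module_vanishes[OF Bm q Nm v] \<phi>.closed[OF x] by metis
    qed
    then have "J = carrier X" using J(4) by (auto simp: rmod_epi_def)
    then show ?thesis using J(2) by simp
  qed
  ultimately show "X \<in> \<T> \<inter> perp \<T>'" by simp
qed

text \<open>\<open>\<T>\<close> and \<open>perp \<T>'\<close> are both closed under extensions, so
  membership climbs the filtration from zero.\<close>

lemma Filt_subset:
  assumes T: "torsion_class \<Lambda> \<T>" and B: "B \<in> \<T>" "B \<in> perp \<T>'"
  shows "Filt \<Lambda> B \<subseteq> \<T> \<inter> perp \<T>'"
proof
  fix M assume "M \<in> Filt \<Lambda> B"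
  then obtain Ns where M: "M \<in> fg_modules \<Lambda>" and Ns: "Ns \<noteq> []" "hd Ns = {\<zero>\<^bsub>M\<^esub>}" "last Ns = carrier M"
    "\<And>N. N \<in> set Ns \<Longrightarrow> submodule N \<Lambda> M"
    "\<And>i. Suc i < length Ns \<Longrightarrow> \<exists>X\<in>add_closure \<Lambda> B. factor_isomorphic \<Lambda> M (Ns ! Suc i) (Ns ! i) X"
    by (auto simp: Filt_def)
  have "M\<lparr>carrier := Ns ! i\<rparr> \<in> \<T> \<and> M\<lparr>carrier := Ns ! i\<rparr> \<in> perp \<T>'" if "i < length Ns" for i
    using that
  proof (induction i)
    case 0
    have "submodule (Ns ! 0) \<Lambda> M" using Ns(1,4) by simp
    then have "M\<lparr>carrier := Ns ! 0\<rparr> \<in> fg_modules \<Lambda>" by (rule fg_sub[OF M])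
    moreover have "\<not> nonzero (M\<lparr>carrier := Ns ! 0\<rparr>)" using Ns(1,2) by (simp add: nonzero_def hd_conv_nth)
    ultimately show ?case using torsion_class_zero[OF T] perp_zero by blast
  next
    case (Suc i)
    obtain X where X: "X \<in> add_closure \<Lambda> B" "factor_isomorphic \<Lambda> M (Ns ! Suc i) (Ns ! i) X"
      using Ns(5)[OF Suc.prems] by blast
    then obtain p where p: "rmod_epi \<Lambda> (M\<lparr>carrier := Ns ! Suc i\<rparr>) X (Ns ! i) p"
      by (auto simp: factor_isomorphic_def rmod_epi_def a_kernel_def')
    have S: "M\<lparr>carrier := Ns ! Suc i\<rparr> \<in> fg_modules \<Lambda>"
      using Ns(4) Suc.prems by (intro fg_sub[OF M]) simp
    have IH: "M\<lparr>carrier := Ns ! i\<rparr> \<in> \<T>" "M\<lparr>carrier := Ns ! i\<rparr> \<in> perp \<T>'"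
      using Suc.IH Suc.prems by simp_all
    have X': "X \<in> \<T>" "X \<in> perp \<T>'" using add_closure_subset[OF T B] X(1) by auto
    show ?case
      using torsion_class_ext[OF T S p _ X'(1)] perp_ext[OF S p _ X'(2)] IH by simp
  qed
  from this[of "length Ns - 1"] Ns(1,3) show "M \<in> \<T> \<inter> perp \<T>'" by (simp add: last_conv_nth)
qed

text \<open>The first power of \<open>B\<close> with zero complement; this allows \<open>B\<close>
  itself as a factor of a filtration.\<close>

lemma mem_add_closure:
  assumes B: "B \<in> fg_modules \<Lambda>"
  shows "B \<in> add_closure \<Lambda> B"
proof -
  let ?P = "power_module B (Suc 0)"
  interpret B: right_module \<Lambda> B by (rule fg_right_module[OF B])
  interpret P: right_module \<Lambda> ?P by (rule right_module_power[OF fg_right_module[OF B]])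
  have "internal_direct_sum \<Lambda> ?P (carrier ?P) {\<zero>\<^bsub>?P\<^esub>}"
    unfolding internal_direct_sum_def
  proof (intro conjI P.carrier_submodule P.zero_submodule)
    show "carrier ?P <+>\<^bsub>?P\<^esub> {\<zero>\<^bsub>?P\<^esub>} = carrier ?P"
      using P.submodule_sum_ge(1)[OF P.carrier_submodule P.zero_submodule]
        P.submodule_sum[OF P.carrier_submodule P.zero_submodule] unfolding P.submodule_iff by blast
  qed auto
  moreover have "rmod_isomorphic \<Lambda> B ?P"
    unfolding rmod_isomorphic_def
  proof (rule bexI)
    let ?f = "\<lambda>b. \<lambda>i\<in>{..<Suc 0}. b"
    show "?f \<in> rmod_hom \<Lambda> B ?P" by (auto simp: rmod_hom_iff power_module_def fun_eq_iff)
    show "bij_betw ?f (carrier B) (carrier ?P)"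
      by (rule bij_betwI[where g = "\<lambda>p. p 0"])
        (auto simp: power_module_def PiE_iff fun_eq_iff extensional_def)
  qed
  ultimately show ?thesis using B by (auto simp: add_closure_def intro!: exI[of _ "Suc 0"])
qed

lemma rmod_epi_comp:
  assumes "rmod_epi \<Lambda> L M S g" "rmod_epi \<Lambda> M N T h"
  shows "rmod_epi \<Lambda> L N {x \<in> carrier L. g x \<in> T} (\<lambda>x. h (g x))"
proof -
  have g: "g \<in> rmod_hom \<Lambda> L M" "g ` carrier L = carrier M" and h: "h \<in> rmod_hom \<Lambda> M N" "h ` carrier M = carrier N"
    using assms by (simp_all add: rmod_epi_def)
  have "(\<lambda>x. h (g x)) ` carrier L = carrier N" unfolding h(2)[symmetric] g(2)[symmetric] by auto
  moreover have "h (g x) = \<zero>\<^bsub>N\<^esub> \<longleftrightarrow> g x \<in> T" if "x \<in> carrier L" for x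
    using assms(2) g(2) that by (auto simp: rmod_epi_def)
  ultimately show ?thesis using rmod_hom_comp[OF g(1) h(1)] by (auto simp: rmod_epi_def)
qed

lemma perp_epi_zero:
  assumes M: "M \<in> fg_modules \<Lambda>" and N: "N \<in> perp \<T>" and g: "rmod_epi \<Lambda> M N {\<zero>\<^bsub>M\<^esub>} g"
  shows "M \<in> perp \<T>"
proof -
  interpret M: right_module \<Lambda> M by (rule fg_right_module[OF M])
  have "M\<lparr>carrier := {\<zero>\<^bsub>M\<^esub>}\<rparr> \<in> perp \<T>"
    by (rule perp_zero[OF fg_sub[OF M M.zero_submodule]]) (simp add: nonzero_def)
  then show ?thesis by (rule perp_ext[OF M g _ N])
qed

section \<open>A nonzero module of least length in the class of a minimal inclusion\<close>

context
  fixes \<T> \<T>' B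
  assumes min: "minimal_inclusion \<Lambda> \<T> \<T>'" and B: "B \<in> \<T>" "B \<in> perp \<T>'" "nonzero B"
    and least: "\<And>X. X \<in> \<T> \<Longrightarrow> X \<in> perp \<T>' \<Longrightarrow> nonzero X \<Longrightarrow> mlen \<Lambda> B \<le> mlen \<Lambda> X"
begin

private lemma B_fg: "B \<in> fg_modules \<Lambda>"
  using B(2) by (rule perp_fg)

private lemma tc: "torsion_class \<Lambda> \<T>" "torsion_class \<Lambda> \<T>'" "\<T>' \<subseteq> \<T>"
  using minimal_inclusion_torsion[OF min] by auto

text \<open>The image is nonzero and lies in \<open>\<T> \<inter> perp \<T>'\<close>, so it is no
  shorter than \<open>B\<close>; a nonzero kernel would make it shorter.\<close>

private lemma hom_from_least_inj:
  assumes X: "X \<in> perp \<T>'" and f: "f \<in> rmod_hom \<Lambda> B X" and nz: "\<exists>x\<in>carrier B. f x \<noteq> \<zero>\<^bsub>X\<^esub>"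
  shows "inj_on f (carrier B)"
proof -
  have Xfg: "X \<in> fg_modules \<Lambda>" using X by (rule perp_fg)
  interpret rmod_hom_loc \<Lambda> B X f by (rule hom_loc[OF B_fg Xfg f])
  let ?I = "X\<lparr>carrier := f ` carrier B\<rparr>" and ?K = "{x \<in> carrier B. f x = \<zero>\<^bsub>X\<^esub>}"
  note I = torsion_class_image[OF tc(1) B(1) Xfg f]
  have I': "?I \<in> perp \<T>'" by (rule perp_sub[OF X I(1)])
  have "nonzero ?I" using nz by (auto simp: nonzero_def)
  then have le: "mlen \<Lambda> B \<le> mlen \<Lambda> ?I" by (rule least[OF I(2) I'])
  have "f \<in> rmod_hom \<Lambda> B ?I" using f by (auto simp: rmod_hom_iff)
  then have "rmod_epi \<Lambda> B ?I ?K f" by (simp add: rmod_epi_def)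
  then have "?K = {\<zero>\<^bsub>B\<^esub>}"
    using mlen_epi_less[OF fg_right_module[OF B_fg] fg_right_module[OF perp_fg[OF I']] _ fg_finite_length[OF B_fg]] le
    by (meson leD)
  then show ?thesis unfolding inj_iff by blast
qed

text \<open>The image lies in \<open>\<T>\<close> as a quotient of \<open>X\<close> and in
  \<open>perp \<T>'\<close> as a submodule of \<open>B\<close>; leastness of \<open>B\<close>
  excludes a proper submodule of this kind.\<close>

private lemma hom_to_least_surj:
  assumes X: "X \<in> \<T>" and f: "f \<in> rmod_hom \<Lambda> X B" and nz: "\<exists>x\<in>carrier X. f x \<noteq> \<zero>\<^bsub>B\<^esub>"
  shows "f ` carrier X = carrier B"
proof (rule ccontr)
  assume ne: "f ` carrier X \<noteq> carrier B"
  note I = torsion_class_image[OF tc(1) X B_fg f]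
  have "nonzero (B\<lparr>carrier := f ` carrier X\<rparr>)" using nz by (auto simp: nonzero_def)
  from least[OF I(2) perp_sub[OF B(2) I(1)] this] mlen_sub_less[OF fg_right_module[OF B_fg] I(1) fg_finite_length[OF B_fg] ne]
  show False by simp
qed

private lemma least_brick: "brick \<Lambda> B"
  using B hom_from_least_inj[OF B(2)] hom_to_least_surj[OF B(1)]
  by (intro brickI fg_right_module[OF B_fg]) auto

text \<open>
  The preimage \<open>Y\<close> in \<open>N\<close> of the \<open>\<T>'\<close>-torsion part \<open>J\<close> of \<open>N'\<close> lies in \<open>\<T> \<inter> \<T>'\<^sup>\<bottom>\<close>, so it has a nonzero map \<open>k\<close> to \<open>B\<close>.
  It does not vanish on \<open>f(B)\<close> and hence splits \<open>f\<close>; the complement of \<open>f(B)\<close> in \<open>Y\<close> is a quotient of \<open>J\<close>, so it is zero.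
\<close>

private lemma quotient_by_least:
  assumes N: "N \<in> \<T>" "N \<in> perp \<T>'" and f: "f \<in> rmod_hom \<Lambda> B N" "inj_on f (carrier B)"
    and N': "N' \<in> fg_modules \<Lambda>" and h: "rmod_epi \<Lambda> N N' (f ` carrier B) h"
  shows "N' \<in> \<T> \<inter> perp \<T>'"
proof -
  have Nfg: "N \<in> fg_modules \<Lambda>" using N(2) by (rule perp_fg)
  have h': "h \<in> rmod_hom \<Lambda> N N'" "h ` carrier N = carrier N'" using h by (simp_all add: rmod_epi_def)
  have N'T: "N' \<in> \<T>" by (rule torsion_class_epi[OF tc(1) N(1) N' h'])
  obtain J N'' g where J: "submodule J \<Lambda> N'" "N'\<lparr>carrier := J\<rparr> \<in> \<T>'" "N'' \<in> perp \<T>'" "rmod_epi \<Lambda> N' N'' J g"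
    using torsion_part[OF tc(2) N'] .
  define Y where "Y = {x \<in> carrier N. h x \<in> J}"
  note Y = rmod_epi_restrict[OF Nfg N' h J(1), folded Y_def]
  let ?Y = "N\<lparr>carrier := Y\<rparr>" and ?I = "f ` carrier B" and ?J = "N'\<lparr>carrier := J\<rparr>"
  have Yc: "Y \<subseteq> carrier N" by (auto simp: Y_def)
  have Yfg: "?Y \<in> fg_modules \<Lambda>" by (rule fg_sub[OF Nfg Y(1)])
  have Yp: "?Y \<in> perp \<T>'" by (rule perp_sub[OF N(2) Y(1)])
  have YT: "?Y \<in> \<T>"
  proof (rule torsion_class_ext[OF tc(1) Yfg Y(4)])
    show "?Y\<lparr>carrier := ?I\<rparr> \<in> \<T>" using torsion_class_image(2)[OF tc(1) B(1) Nfg f(1)] by simp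
    show "?J \<in> \<T>" using J(2) tc(3) by blast
  qed
  have Ym: "right_module \<Lambda> ?Y" and Jm: "right_module \<Lambda> ?J" and Bm: "right_module \<Lambda> B"
    by (rule fg_right_module[OF Yfg] fg_right_module[OF fg_sub[OF N' J(1)]] fg_right_module[OF B_fg])+
  have fY: "f \<in> rmod_hom \<Lambda> B ?Y" using f(1) Y(2) by (auto simp: rmod_hom_iff)
  interpret Y: right_module \<Lambda> ?Y by (rule Ym)
  interpret N: right_module \<Lambda> N by (rule fg_right_module[OF Nfg])
  interpret B: right_module \<Lambda> B by (rule Bm)
  have "nonzero ?Y"
  proof -
    obtain b where "b \<in> carrier B" "b \<noteq> \<zero>\<^bsub>B\<^esub>" using B(3) B.M.zero_closed unfolding nonzero_def by blast
    moreover have "f \<zero>\<^bsub>B\<^esub> = \<zero>\<^bsub>N\<^esub>" by (rule rmod_hom_loc.zero[OF hom_loc[OF B_fg Nfg f(1)]])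
    ultimately have "f b \<noteq> \<zero>\<^bsub>N\<^esub>" "f b \<in> Y" using f(2) Y(2) B.M.zero_closed by (metis inj_onD, blast)
    then show ?thesis by (auto simp: nonzero_def)
  qed
  then have "\<not> hom_vanishes \<Lambda> ?Y B"
    using minimal_inclusion_not_vanishes[OF min, of ?Y B] B YT Yp by blast
  then obtain k where k: "k \<in> rmod_hom \<Lambda> ?Y B" "\<exists>y\<in>carrier ?Y. k y \<noteq> \<zero>\<^bsub>B\<^esub>"
    by (auto simp: hom_vanishes_def)
  have vJ: "hom_vanishes \<Lambda> ?J Z" if "Z \<in> perp \<T>'" for Z
    using that J(2) by (simp add: hom_orthogonal_iff)
  \<comment> \<open>A map from \<open>Y\<close> that kills f(B) factors through the quotient
    \<open>J\<close>, a module of \<open>\<T>'\<close>, and so vanishes when its target is in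
    \<open>perp \<T>'\<close>.\<close>
  have factor: "u y = \<zero>\<^bsub>Z\<^esub>"
    if Z: "Z \<in> perp \<T>'" and u: "u \<in> rmod_hom \<Lambda> ?Y Z" and u0: "\<And>b. b \<in> carrier B \<Longrightarrow> u (f b) = \<zero>\<^bsub>Z\<^esub>"
      and y: "y \<in> Y" for Z :: "'a rmod" and u y
  proof -
    obtain v where v: "v \<in> rmod_hom \<Lambda> ?J Z" "\<And>x. x \<in> carrier ?Y \<Longrightarrow> v (h x) = u x"
      using rmod_hom_factor[OF Ym Jm fg_right_module[OF perp_fg[OF Z]] Y(4) u] u0 by blast
    have "h y \<in> carrier ?J" using y by (simp add: Y_def)
    from hom_vanishesD[OF vJ[OF Z] v(1) this] v(2)[of y] y show ?thesis by simp
  qed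
  have kf: "(\<lambda>b. k (f b)) \<in> rmod_hom \<Lambda> B B" by (rule rmod_hom_comp[OF fY k(1)])
  have kf0: "\<exists>b\<in>carrier B. k (f b) \<noteq> \<zero>\<^bsub>B\<^esub>"
    using factor[OF B(2) k(1)] k(2) by auto
  have inj: "inj_on (\<lambda>b. k (f b)) (carrier B)" by (rule hom_from_least_inj[OF B(2) kf kf0])
  have surj: "(\<lambda>b. k (f b)) ` carrier B = carrier B" by (rule hom_to_least_surj[OF B(1) kf kf0])
  \<comment> \<open>The inverse of the automorphism \<open>\<lambda>b. k (f b)\<close>. Then
    \<open>\<lambda>y. f (e (k y))\<close> is a projection onto f(B), and its difference from the
    identity kills f(B), hence all of \<open>Y\<close> by \<open>factor\<close>.\<close>
  define e where "e = inv_into (carrier B) (\<lambda>b. k (f b))"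
  have e: "e \<in> rmod_hom \<Lambda> B B"
    using rmod_hom_inverse[OF Bm kf inj] surj by (simp add: e_def)
  have ekf: "e (k (f b)) = b" if "b \<in> carrier B" for b
    using inv_into_f_f[OF inj that] by (simp add: e_def)
  have s: "(\<lambda>y. f (e (k y))) \<in> rmod_hom \<Lambda> ?Y ?Y"
    by (rule rmod_hom_comp[OF rmod_hom_comp[OF k(1) e] fY])
  have u: "(\<lambda>y. y \<ominus>\<^bsub>?Y\<^esub> f (e (k y))) \<in> rmod_hom \<Lambda> ?Y ?Y"
    by (rule rmod_hom_diff[OF Ym Ym rmod_hom_id s])
  have fc: "f b \<in> carrier ?Y" if "b \<in> carrier B" for b using fY that unfolding rmod_hom_iff by blast
  have "Y \<subseteq> ?I"
  proof
    fix y assume y: "y \<in> Y"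
    have ek: "e (k y) \<in> carrier B" using y k(1) e unfolding rmod_hom_iff by simp
    have "f b \<ominus>\<^bsub>?Y\<^esub> f (e (k (f b))) = \<zero>\<^bsub>?Y\<^esub>" if "b \<in> carrier B" for b
      using ekf[OF that] fc[OF that] Y.minus_eq_zero_iff by simp
    from factor[OF Yp u this y] have "y \<ominus>\<^bsub>?Y\<^esub> f (e (k y)) = \<zero>\<^bsub>?Y\<^esub>" by simp
    then have "y = f (e (k y))" using Y.minus_eq_zero_iff[of y "f (e (k y))"] y fc[OF ek] by simp
    then show "y \<in> ?I" using ek by blast
  qed
  then have "h y = \<zero>\<^bsub>N'\<^esub>" if "y \<in> Y" for y using h that by (auto simp: rmod_epi_def)
  moreover have "\<zero>\<^bsub>N'\<^esub> \<in> J"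
    using right_module.submodule_iff[OF fg_right_module[OF N']] J(1) by blast
  ultimately have "J = {\<zero>\<^bsub>N'\<^esub>}" using Y(3) by blast
  then have "N' \<in> perp \<T>'" using perp_epi_zero[OF N' J(3)] J(4) by simp
  then show ?thesis using N'T by simp
qed

text \<open>Among the submodules that end a filtration with factors in
  \<open>add_closure \<Lambda> B\<close> and whose quotient still lies in
  \<open>\<T> \<inter> perp \<T>'\<close>, a maximal one is taken. Into a nonzero quotient
  \<open>N\<close> the module \<open>B\<close> embeds, and \<open>quotient_by_least\<close> keeps
  the next quotient in the class, so the filtration could be prolonged.\<close>

private lemma Filt_superset: "\<T> \<inter> perp \<T>' \<subseteq> Filt \<Lambda> B"
proof
  fix X assume "X \<in> \<T> \<inter> perp \<T>'"
  then have X: "X \<in> \<T>" "X \<in> perp \<T>'" by auto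
  have Xfg: "X \<in> fg_modules \<Lambda>" using X(2) by (rule perp_fg)
  interpret X: right_module \<Lambda> X by (rule fg_right_module[OF Xfg])
  define filtered where "filtered Ns \<longleftrightarrow> Ns \<noteq> [] \<and> hd Ns = {\<zero>\<^bsub>X\<^esub>} \<and> (\<forall>N\<in>set Ns. submodule N \<Lambda> X) \<and>
      (\<forall>i. Suc i < length Ns \<longrightarrow> Ns ! i \<subseteq> Ns ! Suc i \<and>
        (\<exists>X'\<in>add_closure \<Lambda> B. factor_isomorphic \<Lambda> X (Ns ! Suc i) (Ns ! i) X'))" for Ns
  define Q where "Q S \<longleftrightarrow> (\<exists>Ns. filtered Ns \<and> last Ns = S) \<and> (\<exists>N g. N \<in> \<T> \<inter> perp \<T>' \<and> rmod_epi \<Lambda> X N S g)" for S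
  have "filtered [{\<zero>\<^bsub>X\<^esub>}]" using X.zero_submodule by (simp add: filtered_def)
  moreover have "rmod_epi \<Lambda> X X {\<zero>\<^bsub>X\<^esub>} (\<lambda>x. x)" using rmod_hom_id by (auto simp: rmod_epi_def)
  ultimately have "Q {\<zero>\<^bsub>X\<^esub>}" unfolding Q_def using X by (metis IntI last.simps)
  then obtain S where S: "submodule S \<Lambda> X" "Q S" "\<And>T. submodule T \<Lambda> X \<Longrightarrow> Q T \<Longrightarrow> S \<subseteq> T \<Longrightarrow> T = S"
    using maximal_submodule[OF Xfg X.zero_submodule, of Q] by metis
  obtain Ns N g where Ns: "filtered Ns" "last Ns = S" and N: "N \<in> \<T>" "N \<in> perp \<T>'" and g: "rmod_epi \<Lambda> X N S g"
    using S(2) by (auto simp: Q_def)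
  have Nfg: "N \<in> fg_modules \<Lambda>" using N(2) by (rule perp_fg)
  have "\<not> nonzero N"
  proof
    assume "nonzero N"
    then have "\<not> hom_vanishes \<Lambda> B N" using minimal_inclusion_not_vanishes[OF min] B N by blast
    then obtain f where f: "f \<in> rmod_hom \<Lambda> B N" and f0: "\<exists>b\<in>carrier B. f b \<noteq> \<zero>\<^bsub>N\<^esub>"
      by (auto simp: hom_vanishes_def)
    have inj: "inj_on f (carrier B)" by (rule hom_from_least_inj[OF N(2) f f0])
    let ?I = "f ` carrier B"
    have I: "submodule ?I \<Lambda> N" by (rule torsion_class_image(1)[OF tc(1) B(1) Nfg f])
    define S' where "S' = {x \<in> carrier X. g x \<in> ?I}"
    note S' = rmod_epi_restrict[OF Xfg Nfg g I, folded S'_def]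
    obtain N' h where N': "N' \<in> fg_modules \<Lambda>" and h: "rmod_epi \<Lambda> N N' ?I h" using fg_quotient[OF Nfg I] .
    have W: "N' \<in> \<T> \<inter> perp \<T>'" by (rule quotient_by_least[OF N f inj N' h])
    let ?e = "inv_into (carrier B) f"
    have e: "?e \<in> rmod_hom \<Lambda> (N\<lparr>carrier := ?I\<rparr>) B"
      by (rule rmod_hom_inverse[OF fg_right_module[OF B_fg] f inj])
    interpret f: rmod_hom_loc \<Lambda> B N f by (rule hom_loc[OF B_fg Nfg f])
    have e0: "?e y = \<zero>\<^bsub>B\<^esub> \<longleftrightarrow> y = \<zero>\<^bsub>N\<^esub>" if "y \<in> ?I" for y
    proof -
      from that obtain b where b: "y = f b" "b \<in> carrier B" by (rule imageE)
      have "f b = \<zero>\<^bsub>N\<^esub> \<longleftrightarrow> b = \<zero>\<^bsub>B\<^esub>" using inj b(2) f.zero unfolding f.inj_iff by metis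
      then show ?thesis unfolding b(1) inv_into_f_f[OF inj b(2)] by metis
    qed
    have eI: "?e ` ?I = carrier B" using inv_into_image_cancel[OF inj subset_refl] .
    \<comment> \<open>The new factor: \<open>S'\<close> maps onto the copy of \<open>B\<close> in
      \<open>N\<close>, and the inverse of \<open>f\<close> carries that copy to \<open>B\<close>;
      the kernel is \<open>S\<close>.\<close>
    have "rmod_epi \<Lambda> (X\<lparr>carrier := S'\<rparr>) B S (\<lambda>x. ?e (g x))"
      unfolding rmod_epi_def
    proof (intro conjI)
      show "(\<lambda>x. ?e (g x)) \<in> rmod_hom \<Lambda> (X\<lparr>carrier := S'\<rparr>) B"
        using rmod_hom_comp[OF _ e, of g] S'(4) by (simp add: rmod_epi_def)
      have "(\<lambda>x. ?e (g x)) ` S' = ?e ` (g ` S')" by (simp add: image_image)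
      then show "(\<lambda>x. ?e (g x)) ` carrier (X\<lparr>carrier := S'\<rparr>) = carrier B" using S'(3) eI by simp
      have "?e (g x) = \<zero>\<^bsub>B\<^esub> \<longleftrightarrow> g x = \<zero>\<^bsub>N\<^esub>" if "x \<in> S'" for x using e0 that S'_def by blast
      then show "{x \<in> carrier (X\<lparr>carrier := S'\<rparr>). ?e (g x) = \<zero>\<^bsub>B\<^esub>} = S"
        using S'(4) by (auto simp: rmod_epi_def)
    qed
    then have fac: "factor_isomorphic \<Lambda> X S' S B"
      by (auto simp: factor_isomorphic_def rmod_epi_def a_kernel_def')
    have step: "(Ns @ [S']) ! i \<subseteq> (Ns @ [S']) ! Suc i \<and>
      (\<exists>X'\<in>add_closure \<Lambda> B. factor_isomorphic \<Lambda> X ((Ns @ [S']) ! Suc i) ((Ns @ [S']) ! i) X')"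
      if i: "Suc i < length (Ns @ [S'])" for i
    proof (cases "Suc i < length Ns")
      case True
      then show ?thesis using Ns(1) by (simp add: filtered_def nth_append)
    next
      case False
      then have len: "Suc i = length Ns" using i by simp
      moreover from this have "Ns ! i = S" using Ns by (metis diff_Suc_1 filtered_def last_conv_nth)
      ultimately show ?thesis using S'(2) fac mem_add_closure[OF B_fg] by (auto simp: nth_append)
    qed
    have "hd (Ns @ [S']) = {\<zero>\<^bsub>X\<^esub>}" "\<forall>N\<in>set (Ns @ [S']). submodule N \<Lambda> X"
      using Ns(1) S'(1) by (auto simp: filtered_def)
    with step have "filtered (Ns @ [S'])" unfolding filtered_def by blast
    moreover have "rmod_epi \<Lambda> X N' S' (\<lambda>x. h (g x))"
      unfolding S'_def by (rule rmod_epi_comp[OF g h])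
    ultimately have "Q S'" unfolding Q_def using W by (metis last_snoc)
    \<comment> \<open>Maximality of \<open>S\<close> collapses the copy of \<open>B\<close> in
      \<open>N\<close> to zero, against \<open>f0\<close>.\<close>
    then have "S' = S" using S(3)[OF S'(1)] S'(2) by blast
    then have "?I = g ` S" using S'(3) by simp
    then have "f b = \<zero>\<^bsub>N\<^esub>" if "b \<in> carrier B" for b using g that by (auto simp: rmod_epi_def)
    then show False using f0 by blast
  qed
  then have "S = carrier X" using g by (auto simp: rmod_epi_def nonzero_def)
  then have "last Ns = carrier X" using Ns(2) by simp
  then show "X \<in> Filt \<Lambda> B"
    using Ns(1) Xfg unfolding Filt_def filtered_def by blast
qed

lemma brick_label_least: "brick_label \<Lambda> \<T> \<T>' B"
  unfolding brick_label_def
  by (intro conjI B_fg least_brick subset_antisym Filt_superset Filt_subset[OF tc(1) B(1,2)])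

end

text \<open>The class of a minimal inclusion has a nonzero member, so one of least length exists.
  This makes every step of a sequence visible in \<open>bricks_of\<close>.\<close>

lemma brick_label_exists:
  assumes min: "minimal_inclusion \<Lambda> \<T> \<T>'"
  obtains B where "brick_label \<Lambda> \<T> \<T>' B"
proof -
  let ?P = "\<lambda>X. X \<in> \<T> \<and> X \<in> perp \<T>' \<and> nonzero X"
  have "\<not> \<T> \<subseteq> \<T>'" using minimal_inclusion_torsion(3)[OF min] by blast
  then obtain X where "?P X"
    by (rule exists_nonzero_between[OF minimal_inclusion_torsion(1,2)[OF min]]) (rule that, simp)
  then have "\<exists>B. ?P B \<and> (\<forall>Y. ?P Y \<longrightarrow> mlen \<Lambda> B \<le> mlen \<Lambda> Y)" by (rule ex_has_least_nat)
  then obtain B where B: "?P B \<and> (\<forall>Y. ?P Y \<longrightarrow> mlen \<Lambda> B \<le> mlen \<Lambda> Y)" ..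
  have "brick_label \<Lambda> \<T> \<T>' B" by (rule brick_label_least[OF min]) (use B in simp_all)
  then show thesis by (rule that)
qed

section \<open>Maximal green sequences\<close>

lemma saturated_chain:
  assumes "M \<in> fg_modules \<Lambda>" "submodule A \<Lambda> M" "submodule B \<Lambda> M" "A \<subseteq> B"
  defines "cov \<equiv> \<lambda>X Y. X \<subset> Y \<and> (\<nexists>H. submodule H \<Lambda> M \<and> X \<subset> H \<and> H \<subset> Y)"
  shows "\<exists>Ns. Ns \<noteq> [] \<and> hd Ns = A \<and> last Ns = B \<and> (\<forall>N\<in>set Ns. submodule N \<Lambda> M) \<and> successively cov Ns"
  using assms(2-4)
proof (induction "mlen \<Lambda> (M\<lparr>carrier := B\<rparr>) - mlen \<Lambda> (M\<lparr>carrier := A\<rparr>)" arbitrary: A B rule: less_induct)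
  case less
  note len = mlen_sub_mono_fg[OF assms(1)]
  \<comment> \<open>When something lies strictly between, both halves have a smaller difference of
    lengths, and their chains are glued at \<open>H\<close>.\<close>
  consider "A = B" | "cov A B" | H where "submodule H \<Lambda> M" "A \<subset> H" "H \<subset> B"
    using less.prems(3) unfolding cov_def by blast
  then show ?case
  proof cases
    case 1
    then show ?thesis using less.prems by (intro exI[of _ "[A]"]) simp
  next
    case 2
    then show ?thesis using less.prems by (intro exI[of _ "[A, B]"]) simp
  next
    case 3
    have l: "mlen \<Lambda> (M\<lparr>carrier := A\<rparr>) < mlen \<Lambda> (M\<lparr>carrier := H\<rparr>)"
      "mlen \<Lambda> (M\<lparr>carrier := H\<rparr>) < mlen \<Lambda> (M\<lparr>carrier := B\<rparr>)"
      using len less.prems 3 by auto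
    obtain xs where xs: "xs \<noteq> []" "hd xs = A" "last xs = H" "\<forall>N\<in>set xs. submodule N \<Lambda> M" "successively cov xs"
      using less.hyps[of H A, OF _ less.prems(1) 3(1) psubset_imp_subset[OF 3(2)]] l by force
    obtain ys where ys: "ys \<noteq> []" "hd ys = H" "last ys = B" "\<forall>N\<in>set ys. submodule N \<Lambda> M" "successively cov ys"
      using less.hyps[of B H, OF _ 3(1) less.prems(2) psubset_imp_subset[OF 3(3)]] l by force
    obtain ys' where ys': "ys = H # ys'" using ys(1,2) by (cases ys) auto
    show ?thesis
      using xs ys unfolding ys' by (intro exI[of _ "xs @ ys'"])
        (auto simp: successively_append_iff successively_Cons split: if_splits)
  qed
qed

text \<open>Each submodule is a term of some composition series, by refinement below and above it.
  Uniqueness makes the two series coincide, and the terms of one series are nested.\<close>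

lemma uniserial_comparable:
  assumes M: "M \<in> fg_modules \<Lambda>" and u: "uniserial \<Lambda> M" and S: "submodule S \<Lambda> M" and T: "submodule T \<Lambda> M"
  shows "S \<subseteq> T \<or> T \<subseteq> S"
proof -
  interpret right_module \<Lambda> M by (rule fg_right_module[OF M])
  define cov where "cov = (\<lambda>X Y. X \<subset> Y \<and> (\<nexists>H. submodule H \<Lambda> M \<and> X \<subset> H \<and> H \<subset> Y))"
  have cs: "composition_series \<Lambda> M Ns \<longleftrightarrow> Ns \<noteq> [] \<and> hd Ns = {\<zero>\<^bsub>M\<^esub>} \<and> last Ns = carrier M \<and>
    (\<forall>N\<in>set Ns. submodule N \<Lambda> M) \<and> successively cov Ns" for Ns
    by (simp add: composition_series_def successively_conv_nth cov_def)
  have ex: "\<exists>Ns. composition_series \<Lambda> M Ns \<and> S \<in> set Ns" if S: "submodule S \<Lambda> M" for S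
  proof -
    have S': "{\<zero>\<^bsub>M\<^esub>} \<subseteq> S" "S \<subseteq> carrier M" using S by (simp_all add: submodule_iff)
    obtain xs where xs: "xs \<noteq> []" "hd xs = {\<zero>\<^bsub>M\<^esub>}" "last xs = S" "\<forall>N\<in>set xs. submodule N \<Lambda> M" "successively cov xs"
      using saturated_chain[OF M zero_submodule S S'(1)] unfolding cov_def by blast
    obtain ys where ys: "ys \<noteq> []" "hd ys = S" "last ys = carrier M" "\<forall>N\<in>set ys. submodule N \<Lambda> M" "successively cov ys"
      using saturated_chain[OF M S carrier_submodule S'(2)] unfolding cov_def by blast
    obtain ys' where ys': "ys = S # ys'" using ys(1,2) by (cases ys) auto
    have "S \<in> set xs" using xs(1,3) last_in_set by blast
    then show ?thesis
      using xs ys unfolding ys' cs by (intro exI[of _ "xs @ ys'"])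
        (auto simp: successively_append_iff successively_Cons split: if_splits)
  qed
  obtain Ns where Ns: "composition_series \<Lambda> M Ns" "S \<in> set Ns" "T \<in> set Ns"
    using ex[OF S] ex[OF T] u unfolding uniserial_def by blast
  have "successively (\<subset>) Ns"
    using Ns(1) unfolding cs by (auto simp: cov_def intro: successively_mono)
  then have "sorted_wrt (\<subset>) Ns" by (simp add: successively_conv_sorted_wrt transp_def psubset_trans)
  then show ?thesis
    using Ns(2,3) unfolding in_set_conv_nth sorted_wrt_iff_nth_less
    by (metis linorder_neqE_nat order_refl psubset_imp_subset)
qed

text \<open>Decomposition into finitely many indecomposables, packaged as an induction on length:
  \<open>P\<close> is carried down to summands, and \<open>Q\<close> is carried up from
  them.\<close>

lemma indecomposable_induct [consumes 2, case_names summand zero indec sum]: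
  assumes "M \<in> fg_modules \<Lambda>" "P M"
    and sm: "\<And>M S T. M \<in> fg_modules \<Lambda> \<Longrightarrow> P M \<Longrightarrow> internal_direct_sum \<Lambda> M S T \<Longrightarrow> P (M\<lparr>carrier := S\<rparr>)"
    and zero: "\<And>M. M \<in> fg_modules \<Lambda> \<Longrightarrow> \<not> nonzero M \<Longrightarrow> Q M"
    and ind: "\<And>M. M \<in> fg_modules \<Lambda> \<Longrightarrow> P M \<Longrightarrow> indecomposable \<Lambda> M \<Longrightarrow> Q M"
    and sum: "\<And>M S T. M \<in> fg_modules \<Lambda> \<Longrightarrow> internal_direct_sum \<Lambda> M S T \<Longrightarrow> Q (M\<lparr>carrier := S\<rparr>) \<Longrightarrow>
      Q (M\<lparr>carrier := T\<rparr>) \<Longrightarrow> Q M"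
  shows "Q M"
  using assms(1,2)
proof (induction "mlen \<Lambda> M" arbitrary: M rule: less_induct)
  case less
  note M = fg_right_module[OF less.prems(1)]
  interpret right_module \<Lambda> M by (rule M)
  consider "\<not> nonzero M" | "indecomposable \<Lambda> M"
    | S T where "internal_direct_sum \<Lambda> M S T" "S \<noteq> {\<zero>\<^bsub>M\<^esub>}" "T \<noteq> {\<zero>\<^bsub>M\<^esub>}"
    unfolding indecomposable_def nonzero_def by blast
  then show ?case
  proof cases
    case 3
    have proper: "Q (M\<lparr>carrier := S\<rparr>)" if ds: "internal_direct_sum \<Lambda> M S T" and T: "T \<noteq> {\<zero>\<^bsub>M\<^esub>}" for S T
    proof (rule less.hyps)
      have s: "submodule S \<Lambda> M" "submodule T \<Lambda> M" "S \<inter> T = {\<zero>\<^bsub>M\<^esub>}" using ds by (auto simp: internal_direct_sum_def)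
      then have "S \<noteq> carrier M" using T by (auto simp: submodule_iff)
      then show "mlen \<Lambda> (M\<lparr>carrier := S\<rparr>) < mlen \<Lambda> M"
        by (rule mlen_sub_less[OF M s(1) fg_finite_length[OF less.prems(1)]])
      show "M\<lparr>carrier := S\<rparr> \<in> fg_modules \<Lambda>" by (rule fg_sub[OF less.prems(1) s(1)])
      show "P (M\<lparr>carrier := S\<rparr>)" by (rule sm[OF less.prems ds])
    qed
    show ?thesis
      using sum[OF less.prems(1) 3(1)] proper[OF 3(1,3)] proper[OF internal_direct_sum_commute[OF M 3(1)] 3(2)] by simp
  qed (use less.prems zero ind in auto)
qed

lemma torsion_class_summand:
  assumes "torsion_class \<Lambda> \<T>" "M \<in> \<T>" "internal_direct_sum \<Lambda> M S T"
  shows "M\<lparr>carrier := S\<rparr> \<in> \<T>"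
proof -
  have M: "M \<in> fg_modules \<Lambda>" by (rule torsion_class_fg[OF assms(1,2)])
  obtain p where p: "rmod_epi \<Lambda> M (M\<lparr>carrier := S\<rparr>) T p"
    using direct_sum_projection[OF fg_right_module[OF M] assms(3)] by blast
  have "submodule S \<Lambda> M" using assms(3) by (simp add: internal_direct_sum_def)
  then show ?thesis
    using p by (intro torsion_class_epi[OF assms(1,2) fg_sub[OF M], of S p]) (simp_all add: rmod_epi_def)
qed

lemma perp_summand:
  "M \<in> perp \<T> \<Longrightarrow> internal_direct_sum \<Lambda> M S T \<Longrightarrow> M\<lparr>carrier := S\<rparr> \<in> perp \<T>"
  by (rule perp_sub) (simp_all add: internal_direct_sum_def)

lemma torsion_class_sum:
  assumes "torsion_class \<Lambda> \<T>" "M \<in> fg_modules \<Lambda>" "internal_direct_sum \<Lambda> M S T"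
    "M\<lparr>carrier := S\<rparr> \<in> \<T>" "M\<lparr>carrier := T\<rparr> \<in> \<T>"
  shows "M \<in> \<T>"
proof -
  obtain p where "rmod_epi \<Lambda> M (M\<lparr>carrier := S\<rparr>) T p"
    using direct_sum_projection[OF fg_right_module[OF assms(2)] assms(3)] by blast
  then show ?thesis by (rule torsion_class_ext[OF assms(1,2) _ assms(5,4)])
qed

lemma perp_sum:
  assumes "M \<in> fg_modules \<Lambda>" "internal_direct_sum \<Lambda> M S T"
    "M\<lparr>carrier := S\<rparr> \<in> perp \<T>" "M\<lparr>carrier := T\<rparr> \<in> perp \<T>"
  shows "M \<in> perp \<T>"
proof -
  obtain p where "rmod_epi \<Lambda> M (M\<lparr>carrier := S\<rparr>) T p"
    using direct_sum_projection[OF fg_right_module[OF assms(1)] assms(2)] by blast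
  then show ?thesis by (rule perp_ext[OF assms(1) _ assms(4,3)])
qed

section \<open>The classes attached to the steps of a sequence\<close>

definition label :: "'a rmod set list \<Rightarrow> nat \<Rightarrow> 'a rmod set" where
  "label \<G> i = \<G> ! i \<inter> perp (\<G> ! Suc i)"

lemma label_fg: "X \<in> label \<G> i \<Longrightarrow> X \<in> fg_modules \<Lambda>"
  by (auto simp: label_def intro: perp_fg)

lemma mgs_minimal_inclusion:
  "maximal_green_sequence \<Lambda> \<G> \<Longrightarrow> Suc i < length \<G> \<Longrightarrow> minimal_inclusion \<Lambda> (\<G> ! i) (\<G> ! Suc i)"
  by (simp add: maximal_green_sequence_def)

lemma mgs_torsion_class:
  "maximal_green_sequence \<Lambda> \<G> \<Longrightarrow> i < length \<G> \<Longrightarrow> torsion_class \<Lambda> (\<G> ! i)"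
  by (simp add: maximal_green_sequence_def)

lemma mgs_decreasing:
  assumes "maximal_green_sequence \<Lambda> \<G>" "i \<le> j" "j < length \<G>"
  shows "\<G> ! j \<subseteq> \<G> ! i"
  using assms(2,3)
proof (induction j rule: dec_induct)
  case (step j)
  then show ?case using minimal_inclusion_torsion(3)[OF mgs_minimal_inclusion[OF assms(1), of j]] by auto
qed simp

text \<open>If \<open>b < a\<close>, then \<open>\<G> ! a\<close> is contained in
  \<open>\<G> ! Suc b\<close>, to which \<open>Y\<close> is orthogonal.\<close>

lemma label_order:
  assumes G: "maximal_green_sequence \<Lambda> \<G>" and len: "Suc a < length \<G>" "Suc b < length \<G>"
    and X: "X \<in> label \<G> a" and Y: "Y \<in> label \<G> b" and nv: "\<not> hom_vanishes \<Lambda> X Y"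
  shows "a \<le> b"
proof (rule ccontr)
  assume "\<not> a \<le> b"
  then have "\<G> ! a \<subseteq> \<G> ! Suc b" using len by (intro mgs_decreasing[OF G]) auto
  then show False using X Y nv by (auto simp: label_def hom_orthogonal_iff)
qed

lemma label_nonzero:
  assumes G: "maximal_green_sequence \<Lambda> \<G>" and i: "Suc i < length \<G>"
  obtains X where "X \<in> label \<G> i" "nonzero X"
proof -
  note mi = minimal_inclusion_torsion[OF mgs_minimal_inclusion[OF G i]]
  have "\<not> \<G> ! i \<subseteq> \<G> ! Suc i" using mi(3) by blast
  from exists_nonzero_between[OF mi(1,2) this] show thesis using that by (metis IntI label_def)
qed

text \<open>A nonzero module common to both classes has its identity as a nonzero map in either
  direction, so \<open>label_order\<close> applies twice.\<close>

lemma label_inj: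
  assumes G: "maximal_green_sequence \<Lambda> \<G>" and len: "Suc a < length \<G>" "Suc b < length \<G>"
    and eq: "label \<G> a = label \<G> b"
  shows "a = b"
proof -
  obtain X where X: "X \<in> label \<G> a" "nonzero X" using label_nonzero[OF G len(1)] .
  have nv: "\<not> hom_vanishes \<Lambda> X X" using hom_vanishes_self[OF fg_right_module[OF label_fg[OF X(1)]]] X(2) by blast
  have X': "X \<in> label \<G> b" using X eq by simp
  show ?thesis using label_order[OF G len X(1) X' nv] label_order[OF G len(2,1) X' X(1) nv] by simp
qed

definition labels :: "'a rmod set list \<Rightarrow> 'a rmod set set" where
  "labels \<G> = label \<G> ` {i. Suc i < length \<G>}"

text \<open>A brick \<open>B\<close> that labels a step in each sequence makes both classes equal to
  \<open>Filt \<Lambda> B\<close>; \<open>brick_label_exists\<close> provides such a brick for every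
  class.\<close>

lemma labels_eq_if_bricks_of_eq:
  assumes G: "maximal_green_sequence \<Lambda> \<G>" and G': "maximal_green_sequence \<Lambda> \<G>'"
    and eq: "bricks_of \<Lambda> \<G> = bricks_of \<Lambda> \<G>'"
  shows "labels \<G> = labels \<G>'"
proof -
  have "labels \<G> \<subseteq> labels \<G>'"
    if G: "maximal_green_sequence \<Lambda> \<G>" and eq: "bricks_of \<Lambda> \<G> = bricks_of \<Lambda> \<G>'" for \<G> \<G>'
  proof
    fix L assume "L \<in> labels \<G>"
    then obtain i where i: "Suc i < length \<G>" "L = label \<G> i" by (auto simp: labels_def)
    obtain B where B: "brick_label \<Lambda> (\<G> ! i) (\<G> ! Suc i) B"
      using brick_label_exists[OF mgs_minimal_inclusion[OF G i(1)]] .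
    then have "B \<in> bricks_of \<Lambda> \<G>" using i(1) unfolding bricks_of_def by blast
    then have "B \<in> bricks_of \<Lambda> \<G>'" by (simp add: eq)
    then obtain j where j: "Suc j < length \<G>'" "brick_label \<Lambda> (\<G>' ! j) (\<G>' ! Suc j) B"
      by (auto simp: bricks_of_def)
    have "L = label \<G>' j" using B j(2) i(2) by (simp add: brick_label_def label_def)
    then show "L \<in> labels \<G>'" using j(1) by (simp add: labels_def)
  qed
  from this[OF G eq] this[OF G' eq[symmetric]] show ?thesis by (rule subset_antisym)
qed

text \<open>Distinct steps have distinct classes by \<open>label_inj\<close>, so the number of
  classes is the number of steps, one less than the number of terms.\<close>

lemma length_eq_if_labels_eq:
  assumes G: "maximal_green_sequence \<Lambda> \<G>" and G': "maximal_green_sequence \<Lambda> \<G>'"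
    and eq: "labels \<G> = labels \<G>'"
  shows "length \<G> = length \<G>'"
proof -
  have card: "Suc (card (labels \<G>)) = length \<G>" if G: "maximal_green_sequence \<Lambda> \<G>" for \<G>
  proof -
    have "inj_on (label \<G>) {i. Suc i < length \<G>}" using label_inj[OF G] by (auto intro: inj_onI)
    moreover have "{i. Suc i < length \<G>} = {..<length \<G> - 1}" by auto
    moreover have "length \<G> > 0" using G by (simp add: maximal_green_sequence_def)
    ultimately show ?thesis by (simp add: labels_def card_image)
  qed
  from card[OF G] card[OF G'] eq show ?thesis by simp
qed

text \<open>Each module of \<open>\<T>\<close> is an extension of a quotient in
  \<open>\<T> \<inter> perp \<T>'\<close> by its torsion part in \<open>\<T>'\<close>.\<close>

lemma torsion_class_determined:
  assumes "torsion_class \<Lambda> \<T>" "torsion_class \<Lambda> \<U>" "torsion_class \<Lambda> \<T>'" "\<T>' \<subseteq> \<U>"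
    "\<T> \<inter> perp \<T>' \<subseteq> \<U>"
  shows "\<T> \<subseteq> \<U>"
proof
  fix M assume M: "M \<in> \<T>"
  have Mfg: "M \<in> fg_modules \<Lambda>" by (rule torsion_class_fg[OF assms(1) M])
  obtain S N g where S: "submodule S \<Lambda> M" "M\<lparr>carrier := S\<rparr> \<in> \<T>'" "N \<in> perp \<T>'" "rmod_epi \<Lambda> M N S g"
    using torsion_part[OF assms(3) Mfg] .
  have "N \<in> \<T>"
    using S(4) by (intro torsion_class_epi[OF assms(1) M perp_fg[OF S(3)], of g]) (simp_all add: rmod_epi_def)
  then have "N \<in> \<U>" using S(3) assms(5) by blast
  moreover have "M\<lparr>carrier := S\<rparr> \<in> \<U>" using S(2) assms(4) by blast
  ultimately show "M \<in> \<U>" by (intro torsion_class_ext[OF assms(2) Mfg S(4)])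
qed

text \<open>The torsion classes are rebuilt from the small end: both sequences finish with the zero
  modules, and a term is determined by its successor together with the class of the step.\<close>

lemma mgs_determined_by_labels:
  assumes G: "maximal_green_sequence \<Lambda> \<G>" and G': "maximal_green_sequence \<Lambda> \<G>'"
    and len: "length \<G> = length \<G>'" and eq: "\<And>i. Suc i < length \<G> \<Longrightarrow> label \<G> i = label \<G>' i"
  shows "\<G> = \<G>'"
proof (rule nth_equalityI[OF len])
  have ne: "\<G> \<noteq> []" "\<G>' \<noteq> []" using G G' by (auto simp: maximal_green_sequence_def)
  fix i assume "i < length \<G>"
  then have "i \<le> length \<G> - 1" by simp
  then show "\<G> ! i = \<G>' ! i"
  proof (induction i rule: inc_induct)
    case base
    then show ?case using G G' ne len by (simp add: maximal_green_sequence_def last_conv_nth)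
  next
    case (step i)
    then have i: "Suc i < length \<G>" "Suc i < length \<G>'" using len by simp_all
    note t = minimal_inclusion_torsion[OF mgs_minimal_inclusion[OF G i(1)]]
    note t' = minimal_inclusion_torsion[OF mgs_minimal_inclusion[OF G' i(2)]]
    have l: "\<G> ! i \<inter> perp (\<G> ! Suc i) = \<G>' ! i \<inter> perp (\<G> ! Suc i)"
      using eq[OF i(1)] step.IH by (simp add: label_def)
    show ?case
    proof (rule subset_antisym)
      show "\<G> ! i \<subseteq> \<G>' ! i" by (rule torsion_class_determined[OF t(1) t'(1) t(2)]) (use t' l step.IH in auto)
      show "\<G>' ! i \<subseteq> \<G> ! i" by (rule torsion_class_determined[OF t'(1) t(1) t(2)]) (use t l in auto)
    qed
  qed
qed

end

section \<open>Deformations across squares\<close>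

locale comparable_submodules_ring = finite_length_ring +
  assumes comparable: "\<lbrakk>M \<in> fg_modules \<Lambda>; indecomposable \<Lambda> M; submodule S \<Lambda> M; submodule T \<Lambda> M\<rbrakk> \<Longrightarrow>
    S \<subseteq> T \<or> T \<subseteq> S"
begin

text \<open>Witness: the canonical map between the two quotients, which is onto a nonzero
  module.\<close>

lemma rmod_epi_nonvanishing:
  assumes "M \<in> fg_modules \<Lambda>" "N \<in> fg_modules \<Lambda>" "P \<in> fg_modules \<Lambda>"
    and g: "rmod_epi \<Lambda> M N S g" and h: "rmod_epi \<Lambda> M P T h" and sub: "S \<subseteq> T" and ne: "T \<noteq> carrier M"
  shows "\<not> hom_vanishes \<Lambda> N P"
proof
  assume v: "hom_vanishes \<Lambda> N P"
  have h': "h \<in> rmod_hom \<Lambda> M P" using h by (simp add: rmod_epi_def)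
  have "h x = \<zero>\<^bsub>P\<^esub>" if "x \<in> S" for x using that sub h by (auto simp: rmod_epi_def)
  then obtain k where k: "k \<in> rmod_hom \<Lambda> N P" "\<And>x. x \<in> carrier M \<Longrightarrow> k (g x) = h x"
    using rmod_hom_factor[OF assms(1-3)[THEN fg_right_module] g h'] by metis
  have "h x = \<zero>\<^bsub>P\<^esub>" if x: "x \<in> carrier M" for x
  proof -
    have "g x \<in> carrier N" using g x by (auto simp: rmod_epi_def)
    then show ?thesis using hom_vanishesD[OF v k(1)] k(2)[OF x] by metis
  qed
  then show False using h ne by (auto simp: rmod_epi_def)
qed

text \<open>Witness: the quotient map restricted to \<open>Y\<close>.\<close>

lemma sub_nonvanishing:
  assumes g: "rmod_epi \<Lambda> M N S g" and Y: "Y \<subseteq> carrier M" "\<not> Y \<subseteq> S"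
  shows "\<not> hom_vanishes \<Lambda> (M\<lparr>carrier := Y\<rparr>) N"
proof
  assume v: "hom_vanishes \<Lambda> (M\<lparr>carrier := Y\<rparr>) N"
  have "g \<in> rmod_hom \<Lambda> (M\<lparr>carrier := Y\<rparr>) N"
    using g by (intro rmod_hom_restrict_source Y) (simp add: rmod_epi_def)
  from hom_vanishesD[OF v this] have "g y = \<zero>\<^bsub>N\<^esub>" if "y \<in> Y" for y using that by simp
  then show False using Y g by (auto simp: rmod_epi_def)
qed

section \<open>Exchange of two adjacent classes\<close>

context
  fixes \<G> \<G>' i p q
  assumes G: "maximal_green_sequence \<Lambda> \<G>" and G': "maximal_green_sequence \<Lambda> \<G>'"
    and labels: "labels \<G> = labels \<G>'" and i: "Suc (Suc i) < length \<G>"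
    and p: "Suc p < length \<G>'" "label \<G>' p = label \<G> i"
    and q: "Suc q < length \<G>'" "label \<G>' q = label \<G> (Suc i)"
    and qp: "q < p"
begin

private abbreviation "T0 \<equiv> \<G> ! i"
private abbreviation "T1 \<equiv> \<G> ! Suc i"
private abbreviation "T2 \<equiv> \<G> ! Suc (Suc i)"

private lemma tc: "torsion_class \<Lambda> T0" "torsion_class \<Lambda> T1" "torsion_class \<Lambda> T2"
  using i by (simp_all add: mgs_torsion_class[OF G])

private lemma T_sub: "T1 \<subseteq> T0" "T2 \<subseteq> T1"
  using i by (simp_all add: mgs_decreasing[OF G])

private lemma indecomposable_in_label:
  assumes E: "E \<in> T0" "E \<in> perp T2" "indecomposable \<Lambda> E"
  shows "E \<in> label \<G> i \<or> E \<in> label \<G> (Suc i)"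
proof (rule ccontr)
  assume contra: "\<not> ?thesis"
  have Efg: "E \<in> fg_modules \<Lambda>" using E(2) by (rule perp_fg)
  interpret E: right_module \<Lambda> E by (rule fg_right_module[OF Efg])
  obtain Y X g where Y: "submodule Y \<Lambda> E" "E\<lparr>carrier := Y\<rparr> \<in> T1" and X: "X \<in> perp T1"
    and g: "rmod_epi \<Lambda> E X Y g" using torsion_part[OF tc(2) Efg] .
  have Xfg: "X \<in> fg_modules \<Lambda>" using X by (rule perp_fg)
  have Yc: "Y \<subseteq> carrier E" using Y(1) by (simp add: E.submodule_iff)
  have "X \<in> T0" using g by (intro torsion_class_epi[OF tc(1) E(1) Xfg, of g]) (simp_all add: rmod_epi_def)
  then have Xl: "X \<in> label \<G> i" using X by (simp add: label_def)
  have Yl: "E\<lparr>carrier := Y\<rparr> \<in> label \<G> (Suc i)" using Y perp_sub[OF E(2) Y(1)] by (simp add: label_def)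
  have Yproper: "Y \<noteq> carrier E" using Yl contra by auto
  have Ynz: "Y \<noteq> {\<zero>\<^bsub>E\<^esub>}"
  proof
    assume "Y = {\<zero>\<^bsub>E\<^esub>}"
    then have "E \<in> perp T1" using perp_epi_zero[OF Efg X] g by simp
    then show False using contra E(1) by (simp add: label_def)
  qed
  have G'0: "\<G>' ! 0 = fg_modules \<Lambda>" "\<G>' ! (length \<G>' - 1) = zero_modules \<Lambda>" "length \<G>' > 0"
    using G' by (auto simp: maximal_green_sequence_def hd_conv_nth last_conv_nth)
  have "E \<notin> zero_modules \<Lambda>" using E(3) by (simp add: zero_modules_def indecomposable_def)
  \<comment> \<open>\<open>E\<close> belongs to the first term and, being nonzero, not to the last,
    so there is a step \<open>s\<close> at which it drops out.\<close>
  then obtain s where s: "s < length \<G>' - 1" "E \<in> \<G>' ! s" "E \<notin> \<G>' ! Suc s"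
    using ex_least_nat_less[of "\<lambda>k. E \<notin> \<G>' ! k" "length \<G>' - 1"] G'0 Efg by auto
  have ss: "Suc s < length \<G>'" using s(1) by simp
  note tcs = mgs_torsion_class[OF G' ss]
  obtain E' C h where E': "submodule E' \<Lambda> E" "E\<lparr>carrier := E'\<rparr> \<in> \<G>' ! Suc s" and C: "C \<in> perp (\<G>' ! Suc s)"
    and h: "rmod_epi \<Lambda> E C E' h" using torsion_part[OF tcs Efg] .
  have Cfg: "C \<in> fg_modules \<Lambda>" using C by (rule perp_fg)
  have "C \<in> \<G>' ! s"
    using h ss by (intro torsion_class_epi[OF mgs_torsion_class[OF G'] s(2) Cfg, of h]) (simp_all add: rmod_epi_def)
  then have Cl': "C \<in> label \<G>' s" using C by (simp add: label_def)
  \<comment> \<open>Equality of the sets of classes gives \<open>C\<close> an index \<open>c\<close>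
    in the first sequence as well, where it can be compared with \<open>i\<close>.\<close>
  have "label \<G>' s \<in> labels \<G>" unfolding labels using ss by (simp add: labels_def)
  then obtain c where c: "Suc c < length \<G>" "C \<in> label \<G> c" using Cl' by (auto simp: labels_def)
  have E'proper: "E' \<noteq> carrier E" using E'(2) s(3) by auto
  have i': "Suc i < length \<G>" using i by simp
  show False
  proof (cases "Y \<subseteq> E'")
    case False
    then have "E' \<subseteq> Y" using comparable[OF Efg E(3) Y(1) E'(1)] by blast
    have "Suc i \<le> c" by (rule label_order[OF G i c(1) Yl c(2) sub_nonvanishing[OF h Yc False]])
    moreover have "c \<le> i"
      by (rule label_order[OF G c(1) i' c(2) Xl rmod_epi_nonvanishing[OF Efg Cfg Xfg h g \<open>E' \<subseteq> Y\<close> Yproper]])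
    ultimately show False by simp
  next
    case True
    have "p \<le> s"
      by (rule label_order[OF G' p(1) ss _ Cl' rmod_epi_nonvanishing[OF Efg Xfg Cfg g h True E'proper]])
        (use Xl p(2) in simp)
    \<comment> \<open>From \<open>p \<le> s\<close>, the torsion part \<open>E'\<close> lies in the
      term after step \<open>p\<close>, to which \<open>X\<close> is orthogonal; so
      \<open>E'\<close> maps to zero in \<open>X\<close> and sits inside \<open>Y\<close>.\<close>
    have E'T: "E\<lparr>carrier := E'\<rparr> \<in> \<G>' ! Suc p"
      using mgs_decreasing[OF G', of "Suc p" "Suc s"] \<open>p \<le> s\<close> ss E'(2) by auto
    have "X \<in> perp (\<G>' ! Suc p)" using Xl p(2) by (auto simp: label_def)
    then have v: "hom_vanishes \<Lambda> (E\<lparr>carrier := E'\<rparr>) X" using E'T by (simp add: hom_orthogonal_iff)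
    have "E' \<subseteq> carrier E" using E'(1) by (simp add: E.submodule_iff)
    then have "E' \<subseteq> Y" using sub_nonvanishing[OF g] v by blast
    then have "E' = Y" using True by simp
    \<comment> \<open>Since \<open>q < p\<close>, the module on \<open>Y\<close> lies in the term
      after step \<open>q\<close>; belonging to the class of step \<open>q\<close>, it is also
      orthogonal to that term, and so it is zero.\<close>
    moreover have "\<G>' ! Suc p \<subseteq> \<G>' ! Suc q" using mgs_decreasing[OF G', of "Suc q" "Suc p"] qp p(1) by simp
    ultimately have "E\<lparr>carrier := Y\<rparr> \<in> \<G>' ! Suc q" using E'T by blast
    moreover have "E\<lparr>carrier := Y\<rparr> \<in> perp (\<G>' ! Suc q)" using Yl q(2) by (auto simp: label_def)
    ultimately have "\<not> nonzero (E\<lparr>carrier := Y\<rparr>)" by (rule torsion_perp_zero)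
    then show False using Ynz by (simp add: nonzero_def)
  qed
qed

text \<open>In the second sequence \<open>q < p\<close>, so a nonzero map would violate
  \<open>label_order\<close> there; the order in the first sequence alone would permit it.\<close>

private lemma labels_vanish:
  assumes "X \<in> label \<G> i" "Y \<in> label \<G> (Suc i)"
  shows "hom_vanishes \<Lambda> X Y"
  using label_order[OF G' p(1) q(1)] assms p(2) q(2) qp by fastforce

text \<open>The new middle term consists of the modules of \<open>\<G> ! i\<close> without nonzero
  maps to one nonzero \<open>Y0\<close> from the class of step \<open>Suc i\<close>. Its two classes
  turn out to be the old ones in exchanged order; both new steps are minimal because nonvanishing of
  maps within the class decides minimality.\<close>

lemma mgs_swap:
  obtains \<T> where "\<T> \<noteq> \<G> ! Suc i" "maximal_green_sequence \<Lambda> (\<G>[Suc i := \<T>])"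
    "label (\<G>[Suc i := \<T>]) i = label \<G> (Suc i)" "label (\<G>[Suc i := \<T>]) (Suc i) = label \<G> i"
proof -
  have i': "Suc i < length \<G>" using i by simp
  obtain Y0 where Y0: "Y0 \<in> label \<G> (Suc i)" "nonzero Y0" using label_nonzero[OF G i] .
  obtain X0 where X0: "X0 \<in> label \<G> i" "nonzero X0" using label_nonzero[OF G i'] .
  have Y0fg: "Y0 \<in> fg_modules \<Lambda>" using Y0(1) by (rule label_fg)
  define \<T> where "\<T> = {X \<in> T0. hom_vanishes \<Lambda> X Y0}"
  have tcT: "torsion_class \<Lambda> \<T>" unfolding \<T>_def by (rule torsion_class_left_perp[OF tc(1) Y0fg])
  have Y0': "Y0 \<in> T1" "Y0 \<in> perp T2" using Y0 by (auto simp: label_def)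
  have T2T: "T2 \<subseteq> \<T>" using T_sub Y0'(2) by (auto simp: \<T>_def hom_orthogonal_iff)
  have XT: "label \<G> i \<subseteq> \<T>" using labels_vanish[OF _ Y0(1)] by (auto simp: \<T>_def label_def)
  have Y0nT: "Y0 \<notin> \<T>" using hom_vanishes_self[OF fg_right_module[OF Y0fg]] Y0(2) by (auto simp: \<T>_def)
  have X0': "X0 \<in> perp T1" using X0(1) by (simp add: label_def)
  have perp12: "perp T1 \<subseteq> perp T2" using T_sub(2) by (rule hom_orthogonal_antimono)
  have min1: "minimal_inclusion \<Lambda> T0 T1" and min2: "minimal_inclusion \<Lambda> T1 T2"
    using mgs_minimal_inclusion[OF G] i by auto
  \<comment> \<open>Both conditions on \<open>Z\<close> pass to summands, so only indecomposable
    modules matter. For these \<open>indecomposable_in_label\<close> leaves two classes, and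
    vanishing of the maps to \<open>Y0\<close> leaves only zero in the second.\<close>
  have inT: "Z \<in> label \<G> i" if Z: "Z \<in> \<T>" "Z \<in> perp T2" for Z
  proof -
    have Zfg: "Z \<in> fg_modules \<Lambda>" by (rule perp_fg[OF Z(2)])
    have "Z \<in> \<T> \<and> Z \<in> perp T2" using Z by simp
    with Zfg have "Z \<in> T0 \<and> Z \<in> perp T1"
    proof (induction Z rule: indecomposable_induct)
      case (summand M S T)
      then show ?case using torsion_class_summand[OF tcT] perp_summand by blast
    next
      case (zero M)
      then show ?case using torsion_class_zero[OF tc(1)] perp_zero by blast
    next
      case (indec M)
      then have M: "M \<in> T0" "hom_vanishes \<Lambda> M Y0" "M \<in> perp T2" by (simp_all add: \<T>_def)
      have "M \<in> label \<G> i \<or> M \<in> label \<G> (Suc i)" by (rule indecomposable_in_label[OF M(1,3) indec(3)])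
      then show ?case
      proof
        assume "M \<in> label \<G> (Suc i)"
        then have "M \<in> T1" by (simp add: label_def)
        \<comment> \<open>Minimality of the step from \<open>T1\<close> to \<open>T2\<close>, tested
          on \<open>Y0\<close>.\<close>
        from minimal_inclusion_left[OF min2 Y0' Y0(2) this M(2)] have "M \<in> T2" .
        then have "\<not> nonzero M" using M(3) by (rule torsion_perp_zero)
        then show ?thesis using M(1) perp_zero indec(1) by blast
      qed (simp add: label_def)
    next
      case (sum M S T)
      then show ?case using torsion_class_sum[OF tc(1), of M S T] perp_sum[of M S T] by blast
    qed
    then show ?thesis by (simp add: label_def)
  qed
  have l2: "\<T> \<inter> perp T2 = label \<G> i"
    using inT XT perp12 by (auto simp: label_def)
  have inY: "Z \<in> label \<G> (Suc i)" if Z: "Z \<in> T0" "Z \<in> perp \<T>" for Z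
  proof -
    have Zfg: "Z \<in> fg_modules \<Lambda>" by (rule perp_fg[OF Z(2)])
    have "Z \<in> T0 \<and> Z \<in> perp \<T>" using Z by simp
    with Zfg have "Z \<in> T1 \<and> Z \<in> perp T2"
    proof (induction Z rule: indecomposable_induct)
      case (summand M S T)
      then show ?case using torsion_class_summand[OF tc(1)] perp_summand by blast
    next
      case (zero M)
      then show ?case using torsion_class_zero[OF tc(2)] perp_zero by blast
    next
      case (indec M)
      then have M: "M \<in> T0" "M \<in> perp T2" using hom_orthogonal_antimono[OF T2T] by blast+
      have "M \<in> label \<G> i \<or> M \<in> label \<G> (Suc i)" by (rule indecomposable_in_label[OF M indec(3)])
      then show ?case
      proof
        assume "M \<in> label \<G> i"
        then have "M \<in> \<T>" using XT by blast
        then have "\<not> nonzero M" using indec(2) torsion_perp_zero by blast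
        then show ?thesis using M(2) torsion_class_zero[OF tc(2)] indec(1) by blast
      qed (simp add: label_def)
    next
      case (sum M S T)
      then show ?case using torsion_class_sum[OF tc(2), of M S T] perp_sum[of M S T] by blast
    qed
    then show ?thesis by (simp add: label_def)
  qed
  have l1: "T0 \<inter> perp \<T> = label \<G> (Suc i)"
  proof (intro subset_antisym subsetI)
    fix Z assume Z: "Z \<in> label \<G> (Suc i)"
    then have Z': "Z \<in> T1" "Z \<in> perp T2" by (auto simp: label_def)
    have Zfg: "Z \<in> fg_modules \<Lambda>" using Z by (rule label_fg)
    have "Z \<in> perp \<T>"
      unfolding hom_orthogonal_iff hom_vanishes_def
    proof (intro conjI Zfg ballI)
      fix V f v assume V: "V \<in> \<T>" and f: "f \<in> rmod_hom \<Lambda> V Z" and v: "v \<in> carrier V"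
      let ?I = "Z\<lparr>carrier := f ` carrier V\<rparr>"
      note I = torsion_class_image[OF tcT V Zfg f]
      \<comment> \<open>The image is in \<open>\<T>\<close> as a quotient of \<open>V\<close> and in
        \<open>perp T2\<close> as a submodule of \<open>Z\<close>, so it is in the first class,
        which has no nonzero maps to the second; its inclusion into \<open>Z\<close> is therefore
        zero.\<close>
      have "?I \<in> label \<G> i" using l2 I(2) perp_sub[OF Z'(2) I(1)] by blast
      then have "hom_vanishes \<Lambda> ?I Z" using labels_vanish Z by blast
      moreover have "(\<lambda>x. x) \<in> rmod_hom \<Lambda> ?I Z"
        using f by (intro rmod_hom_restrict_source rmod_hom_id) (auto simp: rmod_hom_iff)
      ultimately show "f v = \<zero>\<^bsub>Z\<^esub>" using hom_vanishesD[of \<Lambda> ?I Z "\<lambda>x. x" "f v"] v by simp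
    qed
    then show "Z \<in> T0 \<inter> perp \<T>" using Z'(1) T_sub(1) by blast
  qed (use inY in blast)
  have m1: "minimal_inclusion \<Lambda> T0 \<T>"
  proof (rule minimal_inclusionI[OF tc(1) tcT])
    show "\<T> \<subset> T0" using Y0nT Y0'(1) T_sub(1) by (auto simp: \<T>_def)
    show "\<not> hom_vanishes \<Lambda> X Y" if "X \<in> T0 \<inter> perp \<T>" "Y \<in> T0 \<inter> perp \<T>" "nonzero X" "nonzero Y" for X Y
      using that minimal_inclusion_not_vanishes[OF min2, of X Y] unfolding l1 label_def by blast
  qed
  have m2: "minimal_inclusion \<Lambda> \<T> T2"
  proof (rule minimal_inclusionI[OF tcT tc(3)])
    have "X0 \<notin> T2" using torsion_perp_zero[of X0 T2] X0' perp12 X0(2) by blast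
    then show "T2 \<subset> \<T>" using T2T XT X0(1) by blast
    show "\<not> hom_vanishes \<Lambda> X Y" if "X \<in> \<T> \<inter> perp T2" "Y \<in> \<T> \<inter> perp T2" "nonzero X" "nonzero Y" for X Y
      using that minimal_inclusion_not_vanishes[OF min1, of X Y] unfolding l2 label_def by blast
  qed
  let ?G = "\<G>[Suc i := \<T>]"
  have "maximal_green_sequence \<Lambda> ?G"
    unfolding maximal_green_sequence_def
  proof (intro conjI allI impI ballI)
    show "?G \<noteq> []" using i by auto
    show "hd ?G = fg_modules \<Lambda>" using G i by (cases \<G>) (simp_all add: maximal_green_sequence_def)
    show "last ?G = zero_modules \<Lambda>" using G i by (auto simp: maximal_green_sequence_def last_list_update)
    show "torsion_class \<Lambda> \<U>" if "\<U> \<in> set ?G" for \<U>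
      using that set_update_subset_insert[of \<G> "Suc i" \<T>] tcT G by (auto simp: maximal_green_sequence_def)
    fix k assume k: "Suc k < length ?G"
    consider "k = i" | "k = Suc i" | "k \<noteq> i" "k \<noteq> Suc i" by blast
    then show "minimal_inclusion \<Lambda> (?G ! k) (?G ! Suc k)"
      by cases (use m1 m2 k i mgs_minimal_inclusion[OF G, of k] in auto)
  qed
  moreover have "\<T> \<noteq> T1" using Y0nT Y0'(1) by blast
  moreover have "label ?G i = label \<G> (Suc i)" using l1 i by (simp add: label_def)
  moreover have "label ?G (Suc i) = label \<G> i" using l2 i by (simp add: label_def)
  ultimately show thesis using that by blast
qed

end

section \<open>Sorting by adjacent exchanges\<close>

lemma sum_swap_less:
  fixes f g :: "nat \<Rightarrow> nat"
  assumes i: "Suc i < r" and less: "f (Suc i) < f i" and g: "g i = f (Suc i)" "g (Suc i) = f i"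
    "\<And>j. j \<noteq> i \<Longrightarrow> j \<noteq> Suc i \<Longrightarrow> g j = f j"
  shows "(\<Sum>j<r. j * f j) < (\<Sum>j<r. j * g j)"
proof -
  have split: "(\<Sum>j<r. j * h j) = i * h i + Suc i * h (Suc i) + (\<Sum>j\<in>{..<r} - {i, Suc i}. j * h j)" for h :: "nat \<Rightarrow> nat"
    using i sum.subset_diff[of "{i, Suc i}" "{..<r}" "\<lambda>j. j * h j"] by simp
  have "(\<Sum>j\<in>{..<r} - {i, Suc i}. j * g j) = (\<Sum>j\<in>{..<r} - {i, Suc i}. j * f j)"
    using g(3) by (intro sum.cong) auto
  \<comment> \<open>The sums differ by \<open>f i - f (Suc i)\<close>: the exchange moves the larger
    value to the larger weight.\<close>
  then show ?thesis using less unfolding split g(1,2) by (simp add: algebra_simps)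
qed

lemma label_update:
  "Suc i < length \<G> \<Longrightarrow> j \<noteq> i \<Longrightarrow> j \<noteq> Suc i \<Longrightarrow> label (\<G>[Suc i := \<T>]) j = label \<G> j"
  by (simp add: label_def)

text \<open>The positions of its classes in \<open>\<H>\<close> turn \<open>\<G>\<close> into a
  permutation, and each descent can be removed by a square. The weighted sum \<open>\<Phi>\<close>
  grows with every exchange and is bounded; without descents the permutation is the
  identity.\<close>

lemma mgs_equivalent_if_labels_eq:
  assumes H: "maximal_green_sequence \<Lambda> \<H>" and G: "maximal_green_sequence \<Lambda> \<G>" and eq: "labels \<G> = labels \<H>"
  shows "mgs_equivalent \<Lambda> \<G> \<H>"
proof -
  define r where "r = length \<H> - 1"
  have rl: "length \<H> = Suc r" using H by (auto simp: r_def maximal_green_sequence_def)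
  define pos where "pos L = (THE j. j < r \<and> label \<H> j = L)" for L
  have pos_label: "pos (label \<H> j) = j" if "j < r" for j
    unfolding pos_def using that label_inj[OF H] rl by (intro the_equality) auto
  have pos: "pos L < r \<and> label \<H> (pos L) = L" if "L \<in> labels \<H>" for L
    using that pos_label rl by (auto simp: labels_def)
  define \<Phi> where "\<Phi> \<G> = (\<Sum>j<r. j * pos (label \<G> j))" for \<G>
  from G eq show ?thesis
  \<comment> \<open>Each of the \<open>r\<close> summands of \<open>\<Phi>\<close> is at most
    \<open>r * r\<close>, as index and position are both below \<open>r\<close>.\<close>
  proof (induction "r * (r * r) - \<Phi> \<G>" arbitrary: \<G> rule: less_induct)
    case less
    note G = less.prems(1) and eq = less.prems(2)
    have len: "length \<G> = Suc r" using length_eq_if_labels_eq[OF G H eq] rl by simp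
    have lab: "label \<G> j \<in> labels \<H>" if "j < r" for j
      using that len unfolding eq[symmetric] by (simp add: labels_def)
    have inj: "a = b" if "a < r" "b < r" "pos (label \<G> a) = pos (label \<G> b)" for a b
      using that label_inj[OF G, of a b] pos[OF lab] len by (metis Suc_less_eq)
    show ?case
    proof (cases "\<exists>i. Suc i < r \<and> pos (label \<G> (Suc i)) < pos (label \<G> i)")
      case True
      then obtain i where i: "Suc i < r" "pos (label \<G> (Suc i)) < pos (label \<G> i)" by blast
      \<comment> \<open>A descent means that two adjacent classes occur in \<open>\<H>\<close> in
        the opposite order, as \<open>mgs_swap\<close> requires.\<close>
      have p: "Suc (pos (label \<G> i)) < length \<H>" "label \<H> (pos (label \<G> i)) = label \<G> i"
        and q: "Suc (pos (label \<G> (Suc i))) < length \<H>" "label \<H> (pos (label \<G> (Suc i))) = label \<G> (Suc i)"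
        using pos[OF lab, of i] pos[OF lab, of "Suc i"] i(1) rl by auto
      have il: "Suc (Suc i) < length \<G>" using i(1) len by simp
      obtain \<T> where T: "\<T> \<noteq> \<G> ! Suc i" "maximal_green_sequence \<Lambda> (\<G>[Suc i := \<T>])"
        "label (\<G>[Suc i := \<T>]) i = label \<G> (Suc i)" "label (\<G>[Suc i := \<T>]) (Suc i) = label \<G> i"
        using mgs_swap[OF G H eq il p q i(2)] .
      let ?G = "\<G>[Suc i := \<T>]"
      have upd: "label ?G j = label \<G> j" if "j \<noteq> i" "j \<noteq> Suc i" for j
        using that il by (intro label_update) auto
      have "labels ?G = labels \<G>"
      proof -
        have "label ?G ` {j. Suc j < length \<G>} = label \<G> ` {j. Suc j < length \<G>}" (is "?A = ?B")
        proof
          show "?A \<subseteq> ?B"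
          proof
            fix L assume "L \<in> ?A"
            then obtain j where j: "Suc j < length \<G>" "L = label ?G j" by blast
            show "L \<in> ?B"
              using j T(3,4) upd il by (cases "j = i"; cases "j = Suc i") auto
          qed
          show "?B \<subseteq> ?A"
          proof
            fix L assume "L \<in> ?B"
            then obtain j where j: "Suc j < length \<G>" "L = label \<G> j" by blast
            have i': "Suc i < length \<G>" using il by simp
            consider "j = i" | "j = Suc i" | "j \<noteq> i" "j \<noteq> Suc i" by blast
            then show "L \<in> ?A"
            proof cases
              case 1 then show ?thesis using j T(4) il by (intro image_eqI[of _ _ "Suc i"]) auto
            next
              case 2 then show ?thesis using j T(3) i' by (intro image_eqI[of _ _ i]) auto
            next
              case 3 then show ?thesis using j upd by (intro image_eqI[of _ _ j]) auto
            qed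
          qed
        qed
        then show ?thesis by (simp add: labels_def)
      qed
      then have eq': "labels ?G = labels \<H>" using eq by simp
      have less\<Phi>: "\<Phi> \<G> < \<Phi> ?G"
        unfolding \<Phi>_def
        by (rule sum_swap_less[OF i(1), of "\<lambda>j. pos (label \<G> j)"]) (use i(2) T(3,4) upd in simp_all)
      have "\<Phi> ?G \<le> (\<Sum>j<r. r * r)"
        unfolding \<Phi>_def
      proof (rule sum_mono)
        fix j assume "j \<in> {..<r}"
        then have "label ?G j \<in> labels \<H>" using len unfolding eq'[symmetric] by (simp add: labels_def)
        then show "j * pos (label ?G j) \<le> r * r" using pos \<open>j \<in> _\<close> by (intro mult_le_mono) (auto intro: less_imp_le)
      qed
      then have "r * (r * r) - \<Phi> ?G < r * (r * r) - \<Phi> \<G>" using less\<Phi> by simp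
      then have IH: "mgs_equivalent \<Lambda> ?G \<H>" by (rule less.hyps[OF _ T(2) eq'])
      have "square_deformation \<Lambda> \<G> ?G"
        unfolding square_deformation_def using G T(1,2) il by blast
      then show ?thesis
        using IH unfolding mgs_equivalent_def by (meson equivclp_trans r_into_equivclp)
    next
      case False
      \<comment> \<open>Sorted, distinct and filling all positions below \<open>r\<close>, this list
        can only be \<open>[0..<r]\<close>, so every class sits at the same place in both
        sequences.\<close>
      let ?xs = "map (\<lambda>j. pos (label \<G> j)) [0..<r]"
      have "sorted ?xs" using False by (simp add: sorted_iff_nth_Suc) (meson not_less)
      moreover have "distinct ?xs" using inj by (auto simp: distinct_map inj_on_def)
      moreover have "set ?xs = set [0..<r]"
      proof (rule card_subset_eq)
        show "set ?xs \<subseteq> set [0..<r]" using pos[OF lab] by auto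
        show "card (set ?xs) = card (set [0..<r])" using \<open>distinct ?xs\<close> by (simp only: distinct_card) simp
      qed simp
      ultimately have xs: "?xs = [0..<r]" by (intro sorted_distinct_set_unique) auto
      have "label \<G> j = label \<H> j" if "j < r" for j
      proof -
        have "?xs ! j = [0..<r] ! j" unfolding xs ..
        then have "pos (label \<G> j) = j" using that by simp
        then show ?thesis using pos[OF lab[OF that]] by simp
      qed
      then have "\<G> = \<H>" using len rl by (intro mgs_determined_by_labels[OF G H]) auto
      then show ?thesis by (simp add: mgs_equivalent_def)
    qed
  qed
qed

end

theorem theorem5p8:
  fixes K :: "('k, 'c) ring_scheme" and \<Lambda> :: "('k, 'a) module"
    and \<G>\<^sub>1 \<G>\<^sub>2 :: "'a rmod set list"
  assumes "nakayama_algebra K \<Lambda>"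
    and "maximal_green_sequence \<Lambda> \<G>\<^sub>1"
    and "maximal_green_sequence \<Lambda> \<G>\<^sub>2"
    and "bricks_of \<Lambda> \<G>\<^sub>1 = bricks_of \<Lambda> \<G>\<^sub>2"
  shows "mgs_equivalent \<Lambda> \<G>\<^sub>1 \<G>\<^sub>2"
proof -
  interpret nakayama_algebra K \<Lambda> by fact
  interpret L: finite_length_ring \<Lambda>
    by unfold_locales (simp add: fg_modules_def finitely_generated_imp_finite_length)
  \<comment> \<open>The Nakayama hypothesis, turned into comparability of the submodules of an
    indecomposable module.\<close>
  interpret L: comparable_submodules_ring \<Lambda>
    by unfold_locales (rule L.uniserial_comparable[OF _ indecomposable_uniserial])
  show ?thesis
    using assms L.labels_eq_if_bricks_of_eq by (intro L.mgs_equivalent_if_labels_eq)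
qed

end
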